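(* Let $u\in U$ be a point in hyperbolic Dehn filling space of the figure-eight knot complement $M$ for which $\dim\ker\frac{\partial w}{\partial y}=1$ and $\dim H^0(x;\mathfrak{v}_u)=1$. Then $\dim H^1(M;\mathfrak{v}_u)=1$ and $\mathrm{res}_x:H^1(M;\mathfrak{v}_u)\to H^1(x;\mathfrak{v}_u)$ is an isomorphism. Additionally, there exist a smooth local choice of basis elements $a_u$ of $H^0(T^2;\mathfrak{v}_u)$ and a cohomology class $z_u\in H^1(M;\mathfrak{v}_u)$ (represented by a crossed homomorphism also denoted $z_u$) for which $z_u(x)=a_u$ and $z_u(l)=ta_u$, where $t$ is some real number. If $t$ is non-zero, then $t=s_u^{-1}$, where $s_u$ is the slope of the representation $\rho_u$. In this case, if the generalized Dehn filling coefficients of $u$ are relatively prime integers $(p,q)$ and $s_u\neq -q/p$, then the Dehn-surgered manifold $M_{p,q}$ is infinitesimally projectively rigid, and $H^1(M_{p,q};\mathfrak{v}_u)=0$.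
   Context: $\pi_1(M)=\langle x,y\mid ax=ya\rangle$, $a=xy^{-1}x^{-1}y$, $b=xy^{-1}$, $l=b^{-1}a^{-1}ba$; $x$ and $l$ are a meridian and longitude generating $\pi_1(\partial M)=\pi_1(T^2)\cong\mathbb{Z}^2$. Set $w=axa^{-1}y^{-1}=xy^{-1}x^{-1}yxy^{-1}xyx^{-1}y^{-1}$; its Fox derivative with respect to $y$, viewed as a linear endomorphism of $\mathfrak{v}_u$ via the action below, is $\frac{\partial w}{\partial y}=-xy^{-1}-yxy^{-1}x^{-1}-1+yxy^{-1}+xy^{-1}x^{-1}$. Representations: $z_1,z_2\in\mathbb{C}$ have positive imaginary part and satisfy $2\mathrm{Log} z_1+\mathrm{Log}\frac1{1-z_1}+\mathrm{Log} z_2+2\mathrm{Log}(1-\frac1{z_2})=2\pi i$ and $\mathrm{Log}\frac1{1-z_1}+2\mathrm{Log}(1-\frac1{z_1})+\mathrm{Log} z_2+2\mathrm{Log}\frac1{1-z_2}=2\pi i$; with $k=z_1(1-z_2)$ and $u=\mathrm{Log}\,k$ (branch with $u=0$ at $z_1=z_2=e^{\pi i/3}$), $\rho_u:\pi_1(M)\to \mathrm{PSL}(2,\mathbb{C})$ is $\rho_u(x)=\begin{pmatrix}k^{-1/2}&-k^{-1/2}\\0&k^{1/2}\end{pmatrix}$, $\rho_u(y)=\begin{pmatrix}k^{1/2}&0\\-z_2k^{-1/2}&k^{-1/2}\end{pmatrix}$. It is the holonomy of a hyperbolic structure on $M$, complete exactly when $u=0$. $U\subset\mathbb{C}$ (hyperbolic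 Dehn filling space) is the connected open neighborhood of $0$ parametrizing these holonomies, on which $u\mapsto$ generalized Dehn filling coefficients ($\infty$ for $u=0$; for $u\ne0$ the unique real solution $(p,q)$ of $pu+qv=2\pi i$, where $v=2\mathrm{Log}(-(1-z_2)^2/z_2)$, $v=0$ at $u=0$) is a diffeomorphism onto a neighborhood of $\infty\in S^2=\mathbb{R}^2\cup\{\infty\}$. If $(p,q)$ are relatively prime integers, $M_{p,q}$ is the closed hyperbolic manifold obtained by gluing a solid torus to $M$ killing $x^pl^q$, and $\rho_u$ factors through its holonomy. (The pairs $(0,\pm1)$ are not hyperbolic fillings, so $p\neq0$.) Via $\mathrm{PSL}(2,\mathbb{C})\cong\mathrm{PSO}(3,1)\subset\mathrm{PGL}(4,\mathbb{R})$, $\pi_1(M)$ acts by conjugation ($\mathrm{Ad}\,\rho_u$) on $\mathfrak{sl}(4,\mathbb{R})=\mathfrak{so}(3,1)\oplus\mathfrak{v}$, with $\mathfrak{v}$ the $9$-dimensional orthogonal complement of $\mathfrak{so}(3,1)$ under the Killing form; $\mathfrak{v}_u$ is $\mathfrak{v}$ with this action. Cohomology is twisted (equivalently group) cohomology; $H^*(x;\cdot)$, $H^*(l;\cdot)$ are the cohomologies of the cyclic groups $\langle x\rangle,\langle l\rangle$; $\mathrm{res}_x,\mathrm{res}_l$ are restrictions. $H^0(T^2;\mathfrak{v}_u)$ is the subspace of $\mathfrak{v}$ fixed by $x$ and $l$. Slope: suppose $\mathrm{res}_x:H^1(M;\mathfrak{v}_u)\to H^1(x;\mathfrak{v}_u)$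 and $\mathrm{res}_l:H^1(M;\mathfrak{v}_u)\to H^1(l;\mathfrak{v}_u)$ are isomorphisms between one-dimensional spaces. Then $\mathfrak{v}_u=\ker(1-x)\oplus\mathrm{im}(1-x)$ and similarly for $l$, which identifies $H^1(x;\mathfrak{v}_u)\cong\mathfrak{v}_u/\mathrm{im}(1-x)\cong\mathfrak{v}_u^x$ (class of $f$ corresponding to $f(x)$) and $H^1(l;\mathfrak{v}_u)\cong\mathfrak{v}_u^l$; moreover $\mathfrak{v}_u^x=\mathfrak{v}_u^l$ is a line spanned by some $a_u$. For a generator $z_u$ of $H^1(M;\mathfrak{v}_u)$ write $\mathrm{res}_x(z_u)=c_{1u}a_u$, $\mathrm{res}_l(z_u)=c_{2u}a_u$; the slope is $s_u=c_{1u}/c_{2u}\ne0$. A closed hyperbolic $3$-manifold $N$ with holonomy $\rho:\pi_1(N)\to\mathrm{PSO}(3,1)$ is infinitesimally projectively rigid if $H^1(\pi_1(N);\mathfrak{sl}(4,\mathbb{R})_{\mathrm{Ad}\rho})=0$. *)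

theory Defs
  imports "HOL-Analysis.Analysis" "HOL-Algebra.Elementary_Groups" "HOL-Algebra.Module"
begin

section \<open>Group presentations\<close>

text \<open>A letter \<open>(g, True)\<close> stands for the generator \<open>g\<close>, and \<open>(g, False)\<close> for its inverse.\<close>

type_synonym 'g word = "('g \<times> bool) list"

definition inv_word :: "'g word \<Rightarrow> 'g word" where
  "inv_word w = rev (map (\<lambda>(g, e). (g, \<not> e)) w)"

definition pow_word :: "'g word \<Rightarrow> int \<Rightarrow> 'g word" where
  "pow_word w n = (if 0 \<le> n then concat (replicate (nat n) w)
                   else concat (replicate (nat (- n)) (inv_word w)))"

inductive pres_eq :: "'g word set \<Rightarrow> 'g word \<Rightarrow> 'g word \<Rightarrow> bool" for R where
  refl: "pres_eq R w w"
| sym: "pres_eq R u w \<Longrightarrow> pres_eq R w u"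
| trans: "pres_eq R u v \<Longrightarrow> pres_eq R v w \<Longrightarrow> pres_eq R u w"
| append: "pres_eq R u u' \<Longrightarrow> pres_eq R w w' \<Longrightarrow> pres_eq R (u @ w) (u' @ w')"
| cancel: "pres_eq R [(g, e), (g, \<not> e)] []"
| relator: "r \<in> R \<Longrightarrow> pres_eq R r []"

definition word_class :: "'g word set \<Rightarrow> 'g word \<Rightarrow> 'g word set" where
  "word_class R w = {w'. pres_eq R w w'}"

definition presented_group :: "'g word set \<Rightarrow> 'g word set monoid" where
  "presented_group R =
     \<lparr>carrier = range (word_class R),
      mult = (\<lambda>A B. \<Union>u\<in>A. \<Union>w\<in>B. word_class R (u @ w)),
      one = word_class R []\<rparr>"

text \<open>The Fox derivative of a word, an element of the integral group ring of the free group,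
  is given as its list of signed terms.\<close>

fun fox_deriv :: "'g \<Rightarrow> 'g word \<Rightarrow> (int \<times> 'g word) list" where
  "fox_deriv c [] = []"
| "fox_deriv c ((g, e) # w) =
     (if g = c then (if e then [(1, [])] else [(- 1, [(g, e)])]) else [])
     @ map (\<lambda>(s, r). (s, (g, e) # r)) (fox_deriv c w)"


section \<open>The figure-eight knot group and its Dehn fillings\<close>

datatype gen = GX | GY

definition word_x :: "gen word" where "word_x = [(GX, True)]"
definition word_y :: "gen word" where "word_y = [(GY, True)]"

definition word_a :: "gen word" where
  "word_a = word_x @ inv_word word_y @ inv_word word_x @ word_y"

definition word_b :: "gen word" where
  "word_b = word_x @ inv_word word_y"

definition word_l :: "gen word" where
  "word_l = inv_word word_b @ inv_word word_a @ word_b @ word_a"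

definition word_w :: "gen word" where
  "word_w = word_a @ word_x @ inv_word word_a @ inv_word word_y"

definition rel_M :: "gen word set" where
  "rel_M = {word_w}"

definition pi1_M :: "gen word set monoid" where
  "pi1_M = presented_group rel_M"

definition elem_x :: "gen word set" where "elem_x = word_class rel_M word_x"
definition elem_l :: "gen word set" where "elem_l = word_class rel_M word_l"

definition cyc_x :: "gen word set monoid" where
  "cyc_x = subgroup_generated pi1_M {elem_x}"

definition cyc_l :: "gen word set monoid" where
  "cyc_l = subgroup_generated pi1_M {elem_l}"

definition pi1_T2 :: "gen word set monoid" where
  "pi1_T2 = subgroup_generated pi1_M {elem_x, elem_l}"

text \<open>Gluing in a solid torus whose meridian is \<open>x\<^sup>pl\<^sup>q\<close> adds this relator, by van Kampen's theorem.\<close>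

definition pi1_filling :: "int \<Rightarrow> int \<Rightarrow> gen word set monoid" where
  "pi1_filling p q =
     presented_group (rel_M \<union> {pow_word word_x p @ pow_word word_l q})"

text \<open>In \<open>pi1_M\<close>, i.e. modulo the relation \<open>ax = ya\<close>, the terms of the Fox derivative of
  \<open>word_w\<close> with respect to \<open>y\<close> are those of
  \<open>- xy\<^sup>-\<^sup>1 - yxy\<^sup>-\<^sup>1x\<^sup>-\<^sup>1 - 1 + yxy\<^sup>-\<^sup>1 + xy\<^sup>-\<^sup>1x\<^sup>-\<^sup>1\<close>:\<close>

lemma pres_eq_word_class: "word_class R u = word_class R w" if "pres_eq R u w"
  using that unfolding word_class_def by (blast intro: pres_eq.sym pres_eq.trans)

lemma pres_eq_cancel_mid:
  "pres_eq R (u @ [(g, e), (g, \<not> e)] @ w) (u @ w)"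
proof -
  have "pres_eq R ([(g, e), (g, \<not> e)] @ w) ([] @ w)"
    by (intro pres_eq.append pres_eq.cancel pres_eq.refl)
  then show ?thesis using pres_eq.append[OF pres_eq.refl] by fastforce
qed

lemma fox_deriv_word_w:
  "map (\<lambda>(s, r). (s, word_class rel_M r)) (fox_deriv GY word_w) =
   map (\<lambda>(s, r). (s, word_class rel_M r))
    [(- 1, word_x @ inv_word word_y),
     (1, word_x @ inv_word word_y @ inv_word word_x),
     (- 1, word_y @ word_x @ inv_word word_y @ inv_word word_x),
     (1, word_y @ word_x @ inv_word word_y),
     (- 1, [])]"
proof -
  let ?x = "(GX, True)" and ?X = "(GX, False)" and ?y = "(GY, True)" and ?Y = "(GY, False)"
  let ?w = "[?x, ?Y, ?X, ?y, ?x, ?Y, ?x, ?y, ?X, ?Y]"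
  have w: "word_w = ?w"
    by (simp add: word_w_def word_a_def word_x_def word_y_def inv_word_def)
  have rel: "pres_eq rel_M ?w []"
    using pres_eq.relator[of word_w rel_M] by (simp add: rel_M_def w)
  have c: "pres_eq rel_M (u @ [(g, e), (g, \<not> e)] @ z) (u @ z)" for u g e z
    by (rule pres_eq_cancel_mid)
  have t: "pres_eq rel_M (?w @ z) z" for z
    using pres_eq.append[OF rel pres_eq.refl[of _ z]] by simp
  define v where "v = [?y, ?x, ?Y, ?X]"
  have "pres_eq rel_M (?w @ v) v" by (rule t)
  moreover have "pres_eq rel_M (?w @ v) [?x, ?Y, ?X, ?y, ?x, ?Y]"
  proof -
    have "pres_eq rel_M (?w @ v) [?x, ?Y, ?X, ?y, ?x, ?Y, ?x, ?y, ?X, ?x, ?Y, ?X]"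
      using c[of "[?x, ?Y, ?X, ?y, ?x, ?Y, ?x, ?y, ?X]" GY False "[?x, ?Y, ?X]"]
      by (simp add: v_def)
    moreover have "pres_eq rel_M [?x, ?Y, ?X, ?y, ?x, ?Y, ?x, ?y, ?X, ?x, ?Y, ?X]
        [?x, ?Y, ?X, ?y, ?x, ?Y, ?x, ?y, ?Y, ?X]"
      using c[of "[?x, ?Y, ?X, ?y, ?x, ?Y, ?x, ?y]" GX False "[?Y, ?X]"] by simp
    moreover have "pres_eq rel_M [?x, ?Y, ?X, ?y, ?x, ?Y, ?x, ?y, ?Y, ?X]
        [?x, ?Y, ?X, ?y, ?x, ?Y, ?x, ?X]"
      using c[of "[?x, ?Y, ?X, ?y, ?x, ?Y, ?x]" GY True "[?X]"] by simp
    moreover have "pres_eq rel_M [?x, ?Y, ?X, ?y, ?x, ?Y, ?x, ?X] [?x, ?Y, ?X, ?y, ?x, ?Y]"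
      using c[of "[?x, ?Y, ?X, ?y, ?x, ?Y]" GX True "[]"] by simp
    ultimately show ?thesis by (blast intro: pres_eq.trans)
  qed
  ultimately have 3: "pres_eq rel_M [?x, ?Y, ?X, ?y, ?x, ?Y] v"
    by (blast intro: pres_eq.sym pres_eq.trans)
  have "pres_eq rel_M ([?x, ?Y, ?X, ?y, ?x, ?Y] @ [?x]) (v @ [?x])"
    by (intro pres_eq.append 3 pres_eq.refl)
  moreover have "pres_eq rel_M (v @ [?x]) [?y, ?x, ?Y]"
    using c[of "[?y, ?x, ?Y]" GX False "[]"] by (simp add: v_def)
  ultimately have 4: "pres_eq rel_M [?x, ?Y, ?X, ?y, ?x, ?Y, ?x] [?y, ?x, ?Y]"
    by (auto intro: pres_eq.trans)
  show ?thesis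
    using pres_eq_word_class[OF 3] pres_eq_word_class[OF 4] pres_eq_word_class[OF rel]
    by (simp add: w v_def word_x_def word_y_def inv_word_def)
qed


section \<open>Group cohomology with real coefficients\<close>

definition H0 :: "('g, 'r) monoid_scheme \<Rightarrow> ('g \<Rightarrow> 'v \<Rightarrow> 'v) \<Rightarrow> 'v set \<Rightarrow> 'v set" where
  "H0 G \<alpha> V = {m \<in> V. \<forall>g \<in> carrier G. \<alpha> g m = m}"

definition Z1 :: "('g, 'r) monoid_scheme \<Rightarrow> ('g \<Rightarrow> 'v \<Rightarrow> 'v) \<Rightarrow> 'v::real_vector set
    \<Rightarrow> ('g \<Rightarrow> 'v) set" where
  "Z1 G \<alpha> V = {f \<in> carrier G \<rightarrow>\<^sub>E V.
     \<forall>g \<in> carrier G. \<forall>h \<in> carrier G. f (g \<otimes>\<^bsub>G\<^esub> h) = f g + \<alpha> g (f h)}"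

definition H1_class :: "('g, 'r) monoid_scheme \<Rightarrow> ('g \<Rightarrow> 'v \<Rightarrow> 'v) \<Rightarrow> 'v::real_vector set
    \<Rightarrow> ('g \<Rightarrow> 'v) \<Rightarrow> ('g \<Rightarrow> 'v) set" where
  "H1_class G \<alpha> V f =
     {f' \<in> Z1 G \<alpha> V. \<exists>m \<in> V. \<forall>g \<in> carrier G. f' g = f g + (\<alpha> g m - m)}"

text \<open>\<open>H\<^sup>1\<close> as a real vector space of cohomology classes. The fields \<open>mult\<close> and \<open>one\<close> are
  inherited by the record type of modules from that of rings and are irrelevant.\<close>

definition H1 :: "('g, 'r) monoid_scheme \<Rightarrow> ('g \<Rightarrow> 'v \<Rightarrow> 'v) \<Rightarrow> 'v::real_vector set
    \<Rightarrow> (real, ('g \<Rightarrow> 'v) set) module" where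
  "H1 G \<alpha> V =
     \<lparr>carrier = H1_class G \<alpha> V ` Z1 G \<alpha> V,
      mult = (\<lambda>_ _. undefined),
      one = undefined,
      zero = H1_class G \<alpha> V (\<lambda>g\<in>carrier G. 0),
      add = (\<lambda>C D. \<Union>f\<in>C. \<Union>h\<in>D. H1_class G \<alpha> V (\<lambda>g\<in>carrier G. f g + h g)),
      smult = (\<lambda>r C. \<Union>f\<in>C. H1_class G \<alpha> V (\<lambda>g\<in>carrier G. r *\<^sub>R f g))\<rparr>"

definition has_dim :: "(real, 'c, 'r) module_scheme \<Rightarrow> nat \<Rightarrow> bool" where
  "has_dim M n \<longleftrightarrow>
     (\<exists>B. B \<subseteq> carrier M \<and> finite B \<and> card B = n \<and>
       (\<forall>C \<in> carrier M. \<exists>!c. c \<in> B \<rightarrow>\<^sub>E UNIV \<and> C = (\<Oplus>\<^bsub>M\<^esub>b\<in>B. c b \<odot>\<^bsub>M\<^esub> b)))"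

definition linear_iso ::
  "('c \<Rightarrow> 'd) \<Rightarrow> (real, 'c, 'r) module_scheme \<Rightarrow> (real, 'd, 's) module_scheme \<Rightarrow> bool" where
  "linear_iso \<phi> M N \<longleftrightarrow> bij_betw \<phi> (carrier M) (carrier N) \<and>
     (\<forall>C \<in> carrier M. \<forall>D \<in> carrier M. \<phi> (C \<oplus>\<^bsub>M\<^esub> D) = \<phi> C \<oplus>\<^bsub>N\<^esub> \<phi> D) \<and>
     (\<forall>r. \<forall>C \<in> carrier M. \<phi> (r \<odot>\<^bsub>M\<^esub> C) = r \<odot>\<^bsub>N\<^esub> \<phi> C)"

text \<open>The map \<open>H\<^sup>1(G; V) \<rightarrow> H\<^sup>1(H; V)\<close> induced by restricting cocycles to a subgroup \<open>H\<close>;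
  it does not mention \<open>G\<close>.\<close>

definition res :: "('g, 'r) monoid_scheme \<Rightarrow> ('g \<Rightarrow> 'v \<Rightarrow> 'v) \<Rightarrow> 'v::real_vector set
    \<Rightarrow> ('g \<Rightarrow> 'v) set \<Rightarrow> ('g \<Rightarrow> 'v) set" where
  "res H \<alpha> V C = (\<Union>f\<in>C. H1_class H \<alpha> V (restrict f (carrier H)))"


section \<open>Lie algebras\<close>

definition sl4 :: "(real^4^4) set" where
  "sl4 = {X. trace X = 0}"

definition lorentz_form :: "real^4^4" where
  "lorentz_form = (\<chi> i j. if i = j then (if i = 4 then - 1 else 1) else 0)"

definition so31 :: "(real^4^4) set" where
  "so31 = {X. transpose X ** lorentz_form + lorentz_form ** X = 0}"

definition ad :: "real^4^4 \<Rightarrow> real^4^4 \<Rightarrow> real^4^4" where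
  "ad X Y = X ** Y - Y ** X"

text \<open>The trace of \<open>ad X \<circ> ad Y\<close> is taken over all \<open>4 \<times> 4\<close> matrices. On the complement
  of \<open>sl4\<close>, which consists of the scalar matrices, \<open>ad Y\<close> vanishes, so this is the trace over
  \<open>sl4\<close>.\<close>

definition killing :: "real^4^4 \<Rightarrow> real^4^4 \<Rightarrow> real" where
  "killing X Y = (\<Sum>E\<in>Basis. ad X (ad Y E) \<bullet> E)"

definition frak_v :: "(real^4^4) set" where
  "frak_v = {X \<in> sl4. \<forall>Y \<in> so31. killing X Y = 0}"

definition Ad :: "('g \<Rightarrow> real^4^4) \<Rightarrow> 'g \<Rightarrow> real^4^4 \<Rightarrow> real^4^4" where
  "Ad \<rho> g X = \<rho> g ** X ** matrix_inv (\<rho> g)"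

definition infinitesimally_projectively_rigid ::
  "('g, 'r) monoid_scheme \<Rightarrow> ('g \<Rightarrow> real^4^4) \<Rightarrow> bool" where
  "infinitesimally_projectively_rigid G \<rho> \<longleftrightarrow>
     carrier (H1 G (Ad \<rho>) sl4) = {\<zero>\<^bsub>H1 G (Ad \<rho>) sl4\<^esub>}"


section \<open>The representations\<close>

text \<open>The isomorphism of \<open>PSL(2, C)\<close> with the identity component of \<open>PSO(3,1)\<close>: \<open>A\<close> acts by
  \<open>H \<mapsto> A H A\<^sup>*\<close> on Hermitian matrices, on which \<open>- det\<close> is the form with matrix
  \<open>lorentz_form\<close>. As \<open>A\<close> and \<open>- A\<close> act alike, elements of \<open>PSL(2, C)\<close> are given by lifts.\<close>

definition hermitian :: "real^4 \<Rightarrow> complex^2^2" where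
  "hermitian s = vector [vector [complex_of_real (s $ 4 + s $ 3), Complex (s $ 1) (s $ 2)],
                         vector [Complex (s $ 1) (- (s $ 2)), complex_of_real (s $ 4 - s $ 3)]]"

definition hermitian_coords :: "complex^2^2 \<Rightarrow> real^4" where
  "hermitian_coords H = vector [Re (H $ 1 $ 2), Im (H $ 1 $ 2),
     (Re (H $ 1 $ 1) - Re (H $ 2 $ 2)) / 2, (Re (H $ 1 $ 1) + Re (H $ 2 $ 2)) / 2]"

definition spinor_map :: "complex^2^2 \<Rightarrow> real^4^4" where
  "spinor_map A = matrix (\<lambda>s. hermitian_coords (A ** hermitian s ** (\<chi> i j. cnj (A $ j $ i))))"

fun eval_word :: "('g \<Rightarrow> complex^2^2) \<Rightarrow> 'g word \<Rightarrow> complex^2^2" where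
  "eval_word \<rho> [] = mat 1"
| "eval_word \<rho> ((g, e) # w) = (if e then \<rho> g else matrix_inv (\<rho> g)) ** eval_word \<rho> w"

text \<open>Here \<open>k\<^sup>1\<^sup>/\<^sup>2 = exp (u / 2)\<close>, and \<open>\<zeta>\<close> is the value of \<open>z\<^sub>2\<close>.\<close>

fun rho_gen :: "complex \<Rightarrow> complex \<Rightarrow> gen \<Rightarrow> complex^2^2" where
  "rho_gen u \<zeta> GX = vector [vector [exp (- u / 2), - exp (- u / 2)], vector [0, exp (u / 2)]]"
| "rho_gen u \<zeta> GY = vector [vector [exp (u / 2), 0], vector [- \<zeta> * exp (- u / 2), exp (- u / 2)]]"

text \<open>The representation induced on a quotient of the free group, whose elements are
  classes of words all having the same image in \<open>PSO(3,1)\<close>.\<close>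

definition rho :: "complex \<Rightarrow> complex \<Rightarrow> gen word set \<Rightarrow> real^4^4" where
  "rho u \<zeta> C = the_elem ((\<lambda>w. spinor_map (eval_word (rho_gen u \<zeta>) w)) ` C)"

definition fox_dwdy :: "complex \<Rightarrow> complex \<Rightarrow> real^4^4 \<Rightarrow> real^4^4" where
  "fox_dwdy u \<zeta> X =
     (\<Sum>(s, r)\<leftarrow>fox_deriv GY word_w. of_int s *\<^sub>R Ad (rho u \<zeta>) (word_class rel_M r) X)"

text \<open>\<open>H\<^sup>1(\<langle>g\<rangle>; v) \<cong> v\<^sup>g\<close> sends the class of a cocycle \<open>f\<close> with \<open>f(g)\<close> fixed
  by \<open>g\<close> to \<open>f(g)\<close>.\<close>

definition represents_fixed ::
  "('g, 'r) monoid_scheme \<Rightarrow> ('g \<Rightarrow> 'v \<Rightarrow> 'v) \<Rightarrow> 'v::real_vector set \<Rightarrow> 'g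
    \<Rightarrow> ('g \<Rightarrow> 'v) set \<Rightarrow> 'v \<Rightarrow> bool" where
  "represents_fixed H \<alpha> V g C m \<longleftrightarrow>
     m \<in> V \<and> \<alpha> g m = m \<and> (\<exists>f \<in> Z1 H \<alpha> V. f g = m \<and> C = H1_class H \<alpha> V f)"

text \<open>The line spanned by \<open>a\<close> is the space \<open>H\<^sup>0(T\<^sup>2; v)\<close> of vectors fixed by both \<open>x\<close> and
  \<open>l\<close>. It equals \<open>v\<^sup>x\<close> and \<open>v\<^sup>l\<close> whenever these are lines.
  If \<open>v\<^sup>x\<close> is a line, the ratio is still meaningful at exceptional parameters, e.g. those where
  the eigenvalue ratio \<open>exp v\<close> of \<open>l\<close> is a negative real, at which \<open>v\<^sup>l\<close> has dimension 3.\<close>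

definition slope :: "complex \<Rightarrow> complex \<Rightarrow> real" where
  "slope u \<zeta> = (THE s. \<exists>C a c1 c2.
     C \<in> carrier (H1 pi1_M (Ad (rho u \<zeta>)) frak_v) \<and>
     carrier (H1 pi1_M (Ad (rho u \<zeta>)) frak_v)
       = range (\<lambda>r. r \<odot>\<^bsub>H1 pi1_M (Ad (rho u \<zeta>)) frak_v\<^esub> C) \<and>
     a \<noteq> 0 \<and> H0 pi1_T2 (Ad (rho u \<zeta>)) frak_v = span {a} \<and>
     represents_fixed cyc_x (Ad (rho u \<zeta>)) frak_v elem_x
       (res cyc_x (Ad (rho u \<zeta>)) frak_v C) (c1 *\<^sub>R a) \<and>
     represents_fixed cyc_l (Ad (rho u \<zeta>)) frak_v elem_l
       (res cyc_l (Ad (rho u \<zeta>)) frak_v C) (c2 *\<^sub>R a) \<and>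
     c2 \<noteq> 0 \<and> s = c1 / c2)"


section \<open>Smooth maps and hyperbolic Dehn filling space\<close>

primrec C_times :: "nat \<Rightarrow> 'a::real_normed_vector set \<Rightarrow> ('a \<Rightarrow> 'b::real_normed_vector) \<Rightarrow> bool"
  where
  "C_times 0 S f \<longleftrightarrow> continuous_on S f"
| "C_times (Suc n) S f \<longleftrightarrow> (\<forall>s\<in>S. f differentiable (at s)) \<and>
     (\<forall>d. C_times n S (\<lambda>s. frechet_derivative f (at s) d))"

text \<open>Only used for open \<open>S\<close>.\<close>

definition smooth_on :: "'a::real_normed_vector set \<Rightarrow> ('a \<Rightarrow> 'b::real_normed_vector) \<Rightarrow> bool" where
  "smooth_on S f \<longleftrightarrow> (\<forall>n. C_times n S f)"

definition diffeomorphism ::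
  "'a::real_normed_vector set \<Rightarrow> 'b::real_normed_vector set \<Rightarrow> ('a \<Rightarrow> 'b) \<Rightarrow> bool" where
  "diffeomorphism S T f \<longleftrightarrow> open S \<and> open T \<and> bij_betw f S T \<and>
     smooth_on S f \<and> smooth_on T (inv_into S f)"

definition filling_eq :: "complex \<Rightarrow> complex \<Rightarrow> real \<times> real \<Rightarrow> bool" where
  "filling_eq u v pq \<longleftrightarrow>
     complex_of_real (fst pq) * u + complex_of_real (snd pq) * v = 2 * of_real pi * \<i>"

definition filling_coeffs :: "(complex \<Rightarrow> complex) \<Rightarrow> complex \<Rightarrow> real \<times> real" where
  "filling_coeffs v u = (THE pq. filling_eq u (v u) pq)"

text \<open>The functions \<open>z1\<close>, \<open>z2\<close> and \<open>v\<close> give the shapes and the logarithm of the holonomy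
  of the longitude at the parameter \<open>u\<close>; continuity and the values at 0 fix the branches
  of \<open>u = Log k\<close> and \<open>v\<close>.
  The map \<open>u \<mapsto> (p, q)\<close> extended by \<open>0 \<mapsto> \<infinity>\<close> is required to be a homeomorphism onto a
  neighbourhood of \<open>\<infinity>\<close> in the one-point compactification of the plane, and a
  diffeomorphism away from 0; it is not differentiable at 0 in the chart \<open>1/(p + iq)\<close>.\<close>

definition dehn_filling_space ::
  "complex set \<Rightarrow> (complex \<Rightarrow> complex) \<Rightarrow> (complex \<Rightarrow> complex) \<Rightarrow> (complex \<Rightarrow> complex) \<Rightarrow> bool"
  where
  "dehn_filling_space U z1 z2 v \<longleftrightarrow>
     open U \<and> connected U \<and> 0 \<in> U \<and>
     continuous_on U z1 \<and> continuous_on U z2 \<and> continuous_on U v \<and>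
     z1 0 = exp (\<i> * of_real pi / 3) \<and> z2 0 = exp (\<i> * of_real pi / 3) \<and> v 0 = 0 \<and>
     (\<forall>u\<in>U. 0 < Im (z1 u) \<and> 0 < Im (z2 u) \<and>
        2 * Ln (z1 u) + Ln (1 / (1 - z1 u)) + Ln (z2 u) + 2 * Ln (1 - 1 / z2 u)
          = 2 * of_real pi * \<i> \<and>
        Ln (1 / (1 - z1 u)) + 2 * Ln (1 - 1 / z1 u) + Ln (z2 u) + 2 * Ln (1 / (1 - z2 u))
          = 2 * of_real pi * \<i> \<and>
        exp u = z1 u * (1 - z2 u) \<and>
        exp (v u / 2) = - (1 - z2 u)\<^sup>2 / z2 u) \<and>
     (\<forall>u \<in> U - {0}. \<exists>!pq. filling_eq u (v u) pq) \<and>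
     diffeomorphism (U - {0}) (filling_coeffs v ` (U - {0})) (filling_coeffs v) \<and>
     (\<exists>r. \<forall>pq. r < norm pq \<longrightarrow> pq \<in> filling_coeffs v ` (U - {0})) \<and>
     filterlim (filling_coeffs v) at_infinity (at 0) \<and>
     filterlim (inv_into (U - {0}) (filling_coeffs v)) (at 0) at_infinity"

end

theory Submission
  imports Defs
begin

text \<open>Write \<open>k = exp u\<close>. The hypothesis on the invariants of \<open>x\<close> excludes \<open>k = 1\<close>, where \<open>x\<close> is parabolic and
  has more invariants (\<open>parabolic_dim_neq_1\<close>). For \<open>k \<noteq> 1\<close>, let \<open>h\<close> be the traceless matrix that commutes
  with \<open>x\<close>. As a representation of \<open>SL(2,C)\<close>, \<open>frak_v\<close> is the tensor product of \<open>sl(2,C)\<close> with its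
  conjugate, and the peripheral subgroup fixes \<open>a = h \<otimes> h\<^sup>*\<close>, called \<open>fixv\<close> below. It is not isotropic
  for the Killing form, so \<open>frak_v\<close> is the direct sum of the line of \<open>a\<close> and the image of \<open>x - 1\<close>. It
  depends on \<open>u\<close> only through polynomials in the real and imaginary parts of \<open>k\<close>, hence smoothly.

  A cocycle \<open>z\<close> with \<open>z(x) = a\<close> exists if \<open>\<partial>w/\<partial>x a\<close> lies in the image of \<open>\<partial>w/\<partial>y\<close>. By hypothesis this
  image has codimension one, so it suffices to find a nonzero functional that vanishes on the images of
  both Fox derivatives. Duality provides it: in the free group, the commutator of \<open>l\<close> and \<open>x\<close> is a product
  of a conjugate of \<open>w\<close> and a conjugate of \<open>w\<^sup>-\<^sup>1\<close> (\<open>torus_relation\<close>), and pairing the value of a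
  derivation on this commutator with \<open>a\<close> gives zero. The functional is nonzero because \<open>y\<close> does not
  fix \<open>a\<close> (\<open>act_y_fixv\<close>). Every other cocycle is a multiple of \<open>z\<close> up to coboundaries, because the
  kernel of \<open>\<partial>w/\<partial>y\<close> consists of the values at \<open>y\<close> of coboundaries that vanish on \<open>x\<close>
  (\<open>H1_generator_M\<close>). Commutation of \<open>x\<close> and \<open>l\<close> gives \<open>z(l) = t a\<close>. The two dimension hypotheses persist
  at nearby parameters, because the kernels in question contain continuous families of nonzero vectors and
  can only shrink (\<open>exists_regular_neighbourhood\<close>).

  On the filling relator \<open>x\<^sup>p l\<^sup>q\<close>, the cocycle \<open>z\<close> takes the value \<open>(p + q t) a\<close>, which is nonzero exactly
  if the slope \<open>1 / t\<close> differs from \<open>- q / p\<close>. So only coboundaries survive in the filled manifold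
  (\<open>H1_filling_frak_v\<close>).

  Projective rigidity also needs the vanishing of cohomology with values in \<open>so(3,1)\<close>, which is \<open>sl(2,C)\<close>.
  There, a cocycle is, up to a coboundary, the velocity of a deformation of the matrices of \<open>x\<close> and \<open>y\<close> that
  is tangent to the zero set of the Riley polynomial. If it vanishes on \<open>x\<^sup>p l\<^sup>q\<close>, then the derivative of
  \<open>p u + q v\<close> in its direction, with \<open>p\<close> and \<open>q\<close> held fixed, is zero (\<open>H1_filling_so31\<close>). But
  differentiating \<open>p u + q v = 2 \<pi> i\<close> shows that this derivative is nonzero in every nonzero direction,
  as the filling coefficients are local coordinates (\<open>filling_slope_nonzero\<close>).\<close>

section \<open>Words, presented groups and Fox calculus\<close>

lemma inv_word_simps [simp]:
  "inv_word [] = []"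
  "inv_word ((g, e) # w) = inv_word w @ [(g, \<not> e)]"
  "inv_word (u @ w) = inv_word w @ inv_word u"
  by (auto simp: inv_word_def)

lemma inv_word_inv_word [simp]: "inv_word (inv_word w) = w"
  by (induction w) auto

lemma pres_eq_inv_word_right: "pres_eq R (w @ inv_word w) []"
proof (induction w)
  case (Cons l w)
  obtain g e where l: "l = (g, e)" by fastforce
  have "pres_eq R ([(g, e)] @ (w @ inv_word w) @ [(g, \<not> e)]) ([(g, e)] @ [] @ [(g, \<not> e)])"
    by (intro pres_eq.append pres_eq.refl Cons.IH)
  then have "pres_eq R ((l # w) @ inv_word (l # w)) [(g, e), (g, \<not> e)]" by (simp add: l)
  then show ?case by (rule pres_eq.trans[OF _ pres_eq.cancel])
qed (simp add: pres_eq.refl)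

lemma pres_eq_inv_word_left: "pres_eq R (inv_word w @ w) []"
  using pres_eq_inv_word_right[of R "inv_word w"] by simp

lemma word_class_eq_iff: "word_class R u = word_class R w \<longleftrightarrow> pres_eq R u w"
  using pres_eq_word_class[of R u w] pres_eq.refl[of R w]
  by (auto simp: word_class_def set_eq_iff)

lemma presented_group_simps [simp]:
  "carrier (presented_group R) = range (word_class R)"
  "\<one>\<^bsub>presented_group R\<^esub> = word_class R []"
  by (simp_all add: presented_group_def)

lemma mult_word_class [simp]:
  "word_class R u \<otimes>\<^bsub>presented_group R\<^esub> word_class R w = word_class R (u @ w)"
proof -
  have "word_class R (u' @ w') = word_class R (u @ w)"
    if "u' \<in> word_class R u" "w' \<in> word_class R w" for u' w'
    using pres_eq.append[of R u u' w w'] pres_eq_word_class[of R "u @ w"] that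
    by (simp add: word_class_def)
  moreover have "u \<in> word_class R u" "w \<in> word_class R w"
    by (simp_all add: word_class_def pres_eq.refl)
  ultimately have "(\<Union>u'\<in>word_class R u. \<Union>w'\<in>word_class R w. word_class R (u' @ w')) = word_class R (u @ w)"
    by blast
  then show ?thesis by (simp add: presented_group_def)
qed

lemma group_presented_group: "group (presented_group R)"
proof (rule groupI)
  fix A assume "A \<in> carrier (presented_group R)"
  then obtain w where "A = word_class R w" by auto
  then show "\<exists>B\<in>carrier (presented_group R). B \<otimes>\<^bsub>presented_group R\<^esub> A = \<one>\<^bsub>presented_group R\<^esub>"
    by (intro bexI[of _ "word_class R (inv_word w)"])
      (auto simp: word_class_eq_iff pres_eq_inv_word_left)
qed auto

text \<open>Free reduction decides equality in the free group, so an identity between words that holds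
  in every group can be verified by computation.\<close>

fun reduced_Cons :: "'g \<times> bool \<Rightarrow> 'g word \<Rightarrow> 'g word" where
  "reduced_Cons l [] = [l]"
| "reduced_Cons (g, e) ((h, d) # w) = (if h = g \<and> d \<noteq> e then w else (g, e) # (h, d) # w)"

fun reduce :: "'g word \<Rightarrow> 'g word" where
  "reduce [] = []"
| "reduce (l # w) = reduced_Cons l (reduce w)"

lemma pres_eq_reduced_Cons: "pres_eq R (l # w) (reduced_Cons l w)"
proof (induction l w rule: reduced_Cons.induct)
  case (2 g e h d w)
  show ?case
    using pres_eq_cancel_mid[of R "[]" g e w] by (auto intro: pres_eq.refl)
qed (simp add: pres_eq.refl)

lemma pres_eq_reduce: "pres_eq R w (reduce w)"
proof (induction w)
  case (Cons l w)
  have "pres_eq R ([l] @ w) ([l] @ reduce w)"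
    by (intro pres_eq.append pres_eq.refl Cons.IH)
  then have "pres_eq R (l # w) (l # reduce w)" by simp
  then show ?case using pres_eq_reduced_Cons[of R l "reduce w"] by (auto intro: pres_eq.trans)
qed (simp add: pres_eq.refl)

lemma pres_eq_if_reduce_eq: "reduce u = reduce w \<Longrightarrow> pres_eq R u w"
  by (metis pres_eq_reduce pres_eq.sym pres_eq.trans)

text \<open>Derivations (crossed homomorphisms) of a free group are freely determined by their values
  \<open>X g\<close> on the generators. The value on an inverse letter is forced by \<open>g g\<^sup>-\<^sup>1 = 1\<close>.\<close>

fun word_deriv :: "('g word \<Rightarrow> 'v \<Rightarrow> 'v) \<Rightarrow> ('g \<Rightarrow> 'v::real_vector) \<Rightarrow> 'g word \<Rightarrow> 'v" where
  "word_deriv \<alpha> X [] = 0"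
| "word_deriv \<alpha> X ((g, e) # w) =
     (if e then X g else - \<alpha> [(g, e)] (X g)) + \<alpha> [(g, e)] (word_deriv \<alpha> X w)"

locale word_action =
  fixes \<alpha> :: "'g word \<Rightarrow> 'v::real_vector \<Rightarrow> 'v"
  assumes linear: "linear (\<alpha> w)"
    and Nil [simp]: "\<alpha> [] m = m"
    and append [simp]: "\<alpha> (u @ w) m = \<alpha> u (\<alpha> w m)"
    and cancel [simp]: "\<alpha> [(g, e)] (\<alpha> [(g, \<not> e)] m) = m"
begin

lemmas add = linear_add[OF linear]
lemmas diff = linear_diff[OF linear]
lemmas neg = linear_neg[OF linear]
lemmas scale = linear_scale[OF linear]
lemmas zero [simp] = linear_0[OF linear]

lemma cancel_gen [simp]:
  "\<alpha> [(g, True)] (\<alpha> [(g, False)] m) = m" "\<alpha> [(g, False)] (\<alpha> [(g, True)] m) = m"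
  using cancel[of g True m] cancel[of g False m] by simp_all

lemma Cons_action: "\<alpha> ((g, e) # w) m = \<alpha> [(g, e)] (\<alpha> w m)"
  using append[of "[(g, e)]" w m] by simp

lemma inv_right [simp]: "\<alpha> w (\<alpha> (inv_word w) m) = m"
proof (induction w arbitrary: m)
  case (Cons l w)
  obtain g e where l: "l = (g, e)" by fastforce
  show ?case using Cons.IH by (simp add: l Cons_action[of g e w])
qed simp

lemma inv_left [simp]: "\<alpha> (inv_word w) (\<alpha> w m) = m"
  using inv_right[of "inv_word w" m] by simp

lemma word_deriv_append:
  "word_deriv \<alpha> X (u @ w) = word_deriv \<alpha> X u + \<alpha> u (word_deriv \<alpha> X w)"
proof (induction u)
  case (Cons l u)
  obtain g e where l: "l = (g, e)" by fastforce
  show ?case using Cons.IH by (simp add: l add Cons_action[of g e u])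
qed simp

lemma word_deriv_inv_word: "word_deriv \<alpha> X (inv_word w) = - \<alpha> (inv_word w) (word_deriv \<alpha> X w)"
proof (induction w)
  case (Cons l w)
  obtain g e where l: "l = (g, e)" by fastforce
  show ?case
    using Cons.IH by (cases e) (simp_all add: l word_deriv_append add neg diff)
qed simp

text \<open>Actions and derivations that do not see the relators descend to the presented group.\<close>

lemma pres_eq_imp_action_eq:
  assumes "pres_eq R u w" and "\<And>r m. r \<in> R \<Longrightarrow> \<alpha> r m = m"
  shows "\<alpha> u m = \<alpha> w m"
  using assms(1)
proof (induction arbitrary: m rule: pres_eq.induct)
  case (cancel g e)
  then show ?case using append[of "[(g, e)]" "[(g, \<not> e)]"] by simp
qed (auto simp: assms(2))

lemma pres_eq_imp_word_deriv_eq: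
  assumes "pres_eq R u w" and "\<And>r m. r \<in> R \<Longrightarrow> \<alpha> r m = m"
    and "\<And>r. r \<in> R \<Longrightarrow> word_deriv \<alpha> X r = 0"
  shows "word_deriv \<alpha> X u = word_deriv \<alpha> X w"
  using assms(1)
proof (induction rule: pres_eq.induct)
  case (append u u' w w')
  then show ?case
    using pres_eq_imp_action_eq[OF append.hyps(1) assms(2)] by (simp add: word_deriv_append)
qed (auto simp: assms(3) neg)

lemma derivation_eq_word_deriv:
  assumes "\<And>u w. F (u @ w) = F u + \<alpha> u (F w)"
    and "\<And>g e. F [(g, e), (g, \<not> e)] = 0"
  shows "F w = word_deriv \<alpha> (\<lambda>g. F [(g, True)]) w"
proof -
  have F0: "F [] = 0" using assms(1)[of "[]" "[]"] by simp
  have F1: "F [(g, False)] = - \<alpha> [(g, False)] (F [(g, True)])" for g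
  proof -
    have "F [(g, False)] + \<alpha> [(g, False)] (F [(g, True)]) = 0"
      using assms(1)[of "[(g, False)]" "[(g, True)]"] assms(2)[of g False] by simp
    then show ?thesis by (simp add: eq_neg_iff_add_eq_0)
  qed
  show ?thesis
  proof (induction w)
    case (Cons l w)
    obtain g e where l: "l = (g, e)" by fastforce
    have "F (l # w) = F [(g, e)] + \<alpha> [(g, e)] (F w)"
      using assms(1)[of "[(g, e)]" w] by (simp add: l)
    then show ?case using Cons.IH F1[of g] by (cases e) (simp_all add: l)
  qed (simp add: F0)
qed

lemma word_deriv_add: "word_deriv \<alpha> (\<lambda>g. X g + Y g) w = word_deriv \<alpha> X w + word_deriv \<alpha> Y w"
proof (induction w)
  case (Cons l w)
  then show ?case by (cases l) (simp add: add algebra_simps)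
qed simp

lemma word_deriv_scale: "word_deriv \<alpha> (\<lambda>g. r *\<^sub>R X g) w = r *\<^sub>R word_deriv \<alpha> X w"
proof (induction w)
  case (Cons l w)
  then show ?case by (cases l) (simp add: scale algebra_simps)
qed simp

lemma word_deriv_coboundary: "word_deriv \<alpha> (\<lambda>g. \<alpha> [(g, True)] m - m) w = \<alpha> w m - m"
proof (induction w)
  case (Cons l w)
  obtain g e where l: "l = (g, e)" by fastforce
  show ?case using Cons.IH by (cases e) (simp_all add: l diff Cons_action[of g _ w])
qed simp

text \<open>On powers of an element that fixes its value, a derivation is a homomorphism. This gives the
  value of a cocycle on the relator of a filling.\<close>

lemma fixed_pow_word:
  assumes "\<alpha> w m = m"
  shows "\<alpha> (pow_word w n) m = m"
proof -
  have "\<alpha> (concat (replicate k v)) m = m" if "\<alpha> v m = m" for v k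
    by (induction k) (simp_all add: that)
  moreover have "\<alpha> (inv_word w) m = m" using inv_left[of w m] assms by simp
  ultimately show ?thesis using assms by (simp add: pow_word_def)
qed

lemma word_deriv_pow_word:
  assumes "\<alpha> w (word_deriv \<alpha> X w) = word_deriv \<alpha> X w"
  shows "word_deriv \<alpha> X (pow_word w n) = of_int n *\<^sub>R word_deriv \<alpha> X w"
proof -
  have *: "word_deriv \<alpha> X (concat (replicate k v)) = real k *\<^sub>R word_deriv \<alpha> X v"
    if "\<alpha> v (word_deriv \<alpha> X v) = word_deriv \<alpha> X v" for v k
    by (induction k) (simp_all add: word_deriv_append scale that algebra_simps)
  have i: "\<alpha> (inv_word w) (word_deriv \<alpha> X w) = word_deriv \<alpha> X w"
    using inv_left[of w "word_deriv \<alpha> X w"] assms by simp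
  have "word_deriv \<alpha> X (inv_word w) = - word_deriv \<alpha> X w"
    by (simp add: word_deriv_inv_word i)
  then show ?thesis
    using *[OF assms, of "nat n"] *[of "inv_word w" "nat (- n)"] i by (auto simp: pow_word_def neg)
qed

text \<open>The fundamental formula of Fox calculus, for a two-generator group.\<close>

lemma word_deriv_eq_fox:
  assumes "UNIV = {c, d}" and "c \<noteq> d"
  shows "word_deriv \<alpha> X w =
    (\<Sum>(s, r)\<leftarrow>fox_deriv c w. of_int s *\<^sub>R \<alpha> r (X c)) + (\<Sum>(s, r)\<leftarrow>fox_deriv d w. of_int s *\<^sub>R \<alpha> r (X d))"
proof (induction w)
  case (Cons l w)
  obtain g e where l: "l = (g, e)" by fastforce
  have pull: "\<alpha> [(g, e)] (\<Sum>(s, r)\<leftarrow>T. of_int s *\<^sub>R \<alpha> r m) =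
      (\<Sum>(s, r)\<leftarrow>map (\<lambda>(s, r). (s, (g, e) # r)) T. of_int s *\<^sub>R \<alpha> r m)" for T m
  proof (induction T)
    case (Cons t T)
    obtain s r where "t = (s, r)" by fastforce
    then show ?case using Cons.IH by (simp add: add scale Cons_action[of g e r])
  qed simp
  have "g = c \<or> g = d" using assms(1) by blast
  then show ?case
    using Cons.IH assms(2) by (auto simp: l add pull)
qed simp

end

section \<open>First cohomology of groups\<close>

locale group_rep = group G for G (structure) +
  fixes \<alpha> :: "'a \<Rightarrow> 'v::real_vector \<Rightarrow> 'v" and V :: "'v set"
  assumes linear: "g \<in> carrier G \<Longrightarrow> linear (\<alpha> g)"
    and subspace: "subspace V"
    and one [simp]: "\<alpha> \<one> m = m"
    and mult: "g \<in> carrier G \<Longrightarrow> h \<in> carrier G \<Longrightarrow> \<alpha> (g \<otimes> h) m = \<alpha> g (\<alpha> h m)"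
    and closed: "g \<in> carrier G \<Longrightarrow> m \<in> V \<Longrightarrow> \<alpha> g m \<in> V"
begin

lemma add: "g \<in> carrier G \<Longrightarrow> \<alpha> g (m + n) = \<alpha> g m + \<alpha> g n"
  and diff: "g \<in> carrier G \<Longrightarrow> \<alpha> g (m - n) = \<alpha> g m - \<alpha> g n"
  and scale: "g \<in> carrier G \<Longrightarrow> \<alpha> g (r *\<^sub>R m) = r *\<^sub>R \<alpha> g m"
  and zero: "g \<in> carrier G \<Longrightarrow> \<alpha> g 0 = 0"
  using linear by (simp_all add: linear_add linear_diff linear_scale linear_0)

lemma Z1_iff: "f \<in> Z1 G \<alpha> V \<longleftrightarrow> f \<in> extensional (carrier G) \<and> (\<forall>g\<in>carrier G. f g \<in> V) \<and>
    (\<forall>g \<in> carrier G. \<forall>h \<in> carrier G. f (g \<otimes> h) = f g + \<alpha> g (f h))"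
  by (auto simp: Z1_def PiE_def)

lemma Z1_closed: "f \<in> Z1 G \<alpha> V \<Longrightarrow> g \<in> carrier G \<Longrightarrow> f g \<in> V"
  and Z1_mult: "f \<in> Z1 G \<alpha> V \<Longrightarrow> g \<in> carrier G \<Longrightarrow> h \<in> carrier G \<Longrightarrow> f (g \<otimes> h) = f g + \<alpha> g (f h)"
  by (auto simp: Z1_iff)

lemma Z1_one: "f \<in> Z1 G \<alpha> V \<Longrightarrow> f \<one> = 0"
  using Z1_mult[of f \<one> \<one>] by simp

lemma Z1_inv: "f \<in> Z1 G \<alpha> V \<Longrightarrow> g \<in> carrier G \<Longrightarrow> f (inv g) = - \<alpha> (inv g) (f g)"
  using Z1_mult[of f "inv g" g] Z1_one[of f] by (simp add: eq_neg_iff_add_eq_0)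

lemma Z1_add: "f \<in> Z1 G \<alpha> V \<Longrightarrow> h \<in> Z1 G \<alpha> V \<Longrightarrow> (\<lambda>g\<in>carrier G. f g + h g) \<in> Z1 G \<alpha> V"
  by (auto simp: Z1_iff add subspace_add[OF subspace])

lemma Z1_scale: "f \<in> Z1 G \<alpha> V \<Longrightarrow> (\<lambda>g\<in>carrier G. r *\<^sub>R f g) \<in> Z1 G \<alpha> V"
  by (auto simp: Z1_iff scale subspace_scale[OF subspace] scaleR_add_right)

lemma Z1_coboundary: "m \<in> V \<Longrightarrow> (\<lambda>g\<in>carrier G. \<alpha> g m - m) \<in> Z1 G \<alpha> V"
  by (auto simp: Z1_iff diff mult closed subspace_diff[OF subspace])

lemma Z1_zero: "(\<lambda>g\<in>carrier G. 0) \<in> Z1 G \<alpha> V"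
  by (auto simp: Z1_iff zero subspace_0[OF subspace])

lemma H1_class_eqI:
  assumes "f \<in> Z1 G \<alpha> V" "f' \<in> Z1 G \<alpha> V"
    and m: "m \<in> V" "\<And>g. g \<in> carrier G \<Longrightarrow> f' g = f g + (\<alpha> g m - m)"
  shows "H1_class G \<alpha> V f = H1_class G \<alpha> V f'"
proof -
  have "(\<exists>n\<in>V. \<forall>g\<in>carrier G. h g = f g + (\<alpha> g n - n)) \<longleftrightarrow>
      (\<exists>n\<in>V. \<forall>g\<in>carrier G. h g = f' g + (\<alpha> g n - n))" for h
  proof
    assume "\<exists>n\<in>V. \<forall>g\<in>carrier G. h g = f g + (\<alpha> g n - n)"
    then obtain n where "n \<in> V" "\<forall>g\<in>carrier G. h g = f g + (\<alpha> g n - n)" by blast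
    then show "\<exists>n\<in>V. \<forall>g\<in>carrier G. h g = f' g + (\<alpha> g n - n)"
      using m by (intro bexI[of _ "n - m"]) (auto simp: diff subspace_diff[OF subspace])
  next
    assume "\<exists>n\<in>V. \<forall>g\<in>carrier G. h g = f' g + (\<alpha> g n - n)"
    then obtain n where "n \<in> V" "\<forall>g\<in>carrier G. h g = f' g + (\<alpha> g n - n)" by blast
    then show "\<exists>n\<in>V. \<forall>g\<in>carrier G. h g = f g + (\<alpha> g n - n)"
      using m by (intro bexI[of _ "n + m"]) (auto simp: add subspace_add[OF subspace])
  qed
  then show ?thesis by (simp add: H1_class_def)
qed

lemma mem_H1_class: "f \<in> Z1 G \<alpha> V \<Longrightarrow> f \<in> H1_class G \<alpha> V f"
  using subspace_0[OF subspace] by (auto simp: H1_class_def zero intro!: bexI[of _ 0])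

lemma H1_class_eq_iff:
  assumes "f \<in> Z1 G \<alpha> V" "f' \<in> Z1 G \<alpha> V"
  shows "H1_class G \<alpha> V f = H1_class G \<alpha> V f' \<longleftrightarrow>
    (\<exists>m\<in>V. \<forall>g\<in>carrier G. f' g = f g + (\<alpha> g m - m))"
proof
  assume "H1_class G \<alpha> V f = H1_class G \<alpha> V f'"
  then show "\<exists>m\<in>V. \<forall>g\<in>carrier G. f' g = f g + (\<alpha> g m - m)"
    using mem_H1_class[OF assms(2)] unfolding H1_class_def by blast
qed (meson H1_class_eqI assms)

lemma H1_class_cases:
  assumes "f' \<in> H1_class G \<alpha> V f"
  obtains m where "m \<in> V" "f' \<in> Z1 G \<alpha> V" "\<And>g. g \<in> carrier G \<Longrightarrow> f' g = f g + (\<alpha> g m - m)"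
  using assms by (auto simp: H1_class_def)

lemma carrier_H1: "carrier (H1 G \<alpha> V) = H1_class G \<alpha> V ` Z1 G \<alpha> V"
  and zero_H1: "\<zero>\<^bsub>H1 G \<alpha> V\<^esub> = H1_class G \<alpha> V (\<lambda>g\<in>carrier G. 0)"
  by (simp_all add: H1_def)

lemma add_H1:
  assumes "f \<in> Z1 G \<alpha> V" "h \<in> Z1 G \<alpha> V"
  shows "H1_class G \<alpha> V f \<oplus>\<^bsub>H1 G \<alpha> V\<^esub> H1_class G \<alpha> V h = H1_class G \<alpha> V (\<lambda>g\<in>carrier G. f g + h g)"
proof -
  have "H1_class G \<alpha> V (\<lambda>g\<in>carrier G. f' g + h' g) = H1_class G \<alpha> V (\<lambda>g\<in>carrier G. f g + h g)"
    if "f' \<in> H1_class G \<alpha> V f" "h' \<in> H1_class G \<alpha> V h" for f' h'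
  proof -
    obtain m where m: "m \<in> V" "f' \<in> Z1 G \<alpha> V" "\<And>g. g \<in> carrier G \<Longrightarrow> f' g = f g + (\<alpha> g m - m)"
      using H1_class_cases \<open>f' \<in> _\<close> by blast
    obtain n where n: "n \<in> V" "h' \<in> Z1 G \<alpha> V" "\<And>g. g \<in> carrier G \<Longrightarrow> h' g = h g + (\<alpha> g n - n)"
      using H1_class_cases \<open>h' \<in> _\<close> by blast
    show ?thesis
      using m n assms by (intro H1_class_eqI[symmetric, of _ _ "m + n"] Z1_add)
        (auto simp: add subspace_add[OF subspace])
  qed
  then have "(\<Union>f'\<in>H1_class G \<alpha> V f. \<Union>h'\<in>H1_class G \<alpha> V h. H1_class G \<alpha> V (\<lambda>g\<in>carrier G. f' g + h' g)) =
      H1_class G \<alpha> V (\<lambda>g\<in>carrier G. f g + h g)"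
    using mem_H1_class[OF assms(1)] mem_H1_class[OF assms(2)] by blast
  then show ?thesis by (simp add: H1_def)
qed

lemma smult_H1:
  assumes "f \<in> Z1 G \<alpha> V"
  shows "r \<odot>\<^bsub>H1 G \<alpha> V\<^esub> H1_class G \<alpha> V f = H1_class G \<alpha> V (\<lambda>g\<in>carrier G. r *\<^sub>R f g)"
proof -
  have "H1_class G \<alpha> V (\<lambda>g\<in>carrier G. r *\<^sub>R f' g) = H1_class G \<alpha> V (\<lambda>g\<in>carrier G. r *\<^sub>R f g)"
    if f': "f' \<in> H1_class G \<alpha> V f" for f'
  proof -
    obtain m where m: "m \<in> V" "f' \<in> Z1 G \<alpha> V" "\<And>g. g \<in> carrier G \<Longrightarrow> f' g = f g + (\<alpha> g m - m)"
      using H1_class_cases f' by blast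
    show ?thesis
      using m assms by (intro H1_class_eqI[symmetric, of _ _ "r *\<^sub>R m"] Z1_scale)
        (auto simp: scale subspace_scale[OF subspace] scaleR_add_right scaleR_diff_right)
  qed
  then have "(\<Union>f'\<in>H1_class G \<alpha> V f. H1_class G \<alpha> V (\<lambda>g\<in>carrier G. r *\<^sub>R f' g)) =
      H1_class G \<alpha> V (\<lambda>g\<in>carrier G. r *\<^sub>R f g)"
    using mem_H1_class[OF assms(1)] by blast
  then show ?thesis by (simp add: H1_def)
qed

text \<open>This makes \<open>finsum\<close> over a singleton in \<open>H\<^sup>1\<close> behave as expected, which is what dimension
  one in terms of \<open>has_dim\<close> needs.\<close>

lemma abelian_monoid_H1: "abelian_monoid (H1 G \<alpha> V)"
proof (rule abelian_monoidI)
  fix C D E assume "C \<in> carrier (H1 G \<alpha> V)" "D \<in> carrier (H1 G \<alpha> V)" "E \<in> carrier (H1 G \<alpha> V)"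
  then obtain f h k where f: "f \<in> Z1 G \<alpha> V" "C = H1_class G \<alpha> V f"
    and h: "h \<in> Z1 G \<alpha> V" "D = H1_class G \<alpha> V h" and k: "k \<in> Z1 G \<alpha> V" "E = H1_class G \<alpha> V k"
    by (auto simp: carrier_H1)
  show "C \<oplus>\<^bsub>H1 G \<alpha> V\<^esub> D \<in> carrier (H1 G \<alpha> V)"
    using f h by (auto simp: add_H1 carrier_H1 Z1_add)
  have "(\<lambda>g\<in>carrier G. (\<lambda>g\<in>carrier G. f g + h g) g + k g) = (\<lambda>g\<in>carrier G. f g + (\<lambda>g\<in>carrier G. h g + k g) g)"
    by (auto simp: add.assoc)
  then show "(C \<oplus>\<^bsub>H1 G \<alpha> V\<^esub> D) \<oplus>\<^bsub>H1 G \<alpha> V\<^esub> E = C \<oplus>\<^bsub>H1 G \<alpha> V\<^esub> (D \<oplus>\<^bsub>H1 G \<alpha> V\<^esub> E)"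
    using f h k by (simp add: add_H1 Z1_add)
next
  fix C D assume "C \<in> carrier (H1 G \<alpha> V)" "D \<in> carrier (H1 G \<alpha> V)"
  then show "C \<oplus>\<^bsub>H1 G \<alpha> V\<^esub> D = D \<oplus>\<^bsub>H1 G \<alpha> V\<^esub> C"
    by (auto simp: carrier_H1 add_H1 add.commute)
next
  fix C assume "C \<in> carrier (H1 G \<alpha> V)"
  then obtain f where f: "f \<in> Z1 G \<alpha> V" "C = H1_class G \<alpha> V f" by (auto simp: carrier_H1)
  have "(\<lambda>g\<in>carrier G. (\<lambda>g\<in>carrier G. 0) g + f g) = f"
    using f by (auto simp: Z1_iff extensional_def)
  then show "\<zero>\<^bsub>H1 G \<alpha> V\<^esub> \<oplus>\<^bsub>H1 G \<alpha> V\<^esub> C = C"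
    using f by (simp add: zero_H1 add_H1 Z1_zero)
qed (auto simp: carrier_H1 zero_H1 Z1_zero)

lemma H1_trivialI:
  assumes "\<And>f. f \<in> Z1 G \<alpha> V \<Longrightarrow> \<exists>m\<in>V. \<forall>g\<in>carrier G. f g = \<alpha> g m - m"
  shows "carrier (H1 G \<alpha> V) = {\<zero>\<^bsub>H1 G \<alpha> V\<^esub>}"
proof -
  have "H1_class G \<alpha> V (\<lambda>g\<in>carrier G. 0) = H1_class G \<alpha> V f" if "f \<in> Z1 G \<alpha> V" for f
    using assms[OF that] by (subst H1_class_eq_iff[OF Z1_zero that]) simp
  then show ?thesis
    using Z1_zero unfolding carrier_H1 zero_H1 by blast
qed

text \<open>Cocycles are determined by their values on generators. In particular, the restriction of a
  cocycle to a cyclic subgroup is known once its value on the generator is.\<close>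

lemma Z1_eq_on_generated:
  assumes f: "f \<in> Z1 G \<alpha> V" and h: "h \<in> Z1 G \<alpha> V"
    and S: "S \<subseteq> carrier G" "\<And>s. s \<in> S \<Longrightarrow> f s = h s"
    and g: "g \<in> carrier (subgroup_generated G S)"
  shows "f g = h g"
proof -
  have sub: "generate G S \<subseteq> carrier G" by (simp add: S(1) generate_incl)
  have "g \<in> generate G S"
    using g S(1) by (simp add: carrier_subgroup_generated Int_absorb1)
  then show ?thesis
  proof (induction rule: generate.induct)
    case (inv s)
    then show ?case using S Z1_inv[OF f] Z1_inv[OF h] by auto
  next
    case (eng g1 g2)
    then show ?case using Z1_mult[OF f] Z1_mult[OF h] sub by (simp add: subset_iff)
  qed (auto simp: S Z1_one f h)
qed

lemma fixed_on_generated: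
  assumes "m \<in> V" and S: "S \<subseteq> carrier G" "\<And>s. s \<in> S \<Longrightarrow> \<alpha> s m = m"
    and g: "g \<in> carrier (subgroup_generated G S)"
  shows "\<alpha> g m = m"
proof -
  have "(\<lambda>g\<in>carrier G. \<alpha> g m - m) g = (\<lambda>g\<in>carrier G. 0) g"
    by (rule Z1_eq_on_generated[OF Z1_coboundary[OF assms(1)] Z1_zero S(1) _ g]) (use S in auto)
  moreover have "g \<in> carrier G" using carrier_subgroup_generated_subset g by blast
  ultimately show ?thesis by simp
qed

lemma group_rep_subgroup_generated: "group_rep (subgroup_generated G S) \<alpha> V"
proof -
  have "g \<in> carrier G" if "g \<in> carrier (subgroup_generated G S)" for g
    using carrier_subgroup_generated_subset that by blast
  then show ?thesis
    by (intro group_rep.intro group_rep_axioms.intro)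
      (auto simp: linear subspace mult closed)
qed

lemma Z1_restrict:
  assumes "f \<in> Z1 G \<alpha> V"
  shows "restrict f (carrier (subgroup_generated G S)) \<in> Z1 (subgroup_generated G S) \<alpha> V"
proof -
  interpret H: group_rep "subgroup_generated G S" \<alpha> V by (rule group_rep_subgroup_generated)
  have "g \<in> carrier G" if "g \<in> carrier (subgroup_generated G S)" for g
    using carrier_subgroup_generated_subset that by blast
  then show ?thesis using assms H.m_closed by (auto simp: H.Z1_iff Z1_iff)
qed

lemma H0_subgroup_generated:
  assumes "S \<subseteq> carrier G"
  shows "H0 (subgroup_generated G S) \<alpha> V = {m \<in> V. \<forall>s\<in>S. \<alpha> s m = m}"
  using fixed_on_generated[OF _ assms] subgroup_generated_subset_carrier_subset[OF assms]
  by (auto simp: H0_def)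

lemma res_H1_class:
  assumes f: "f \<in> Z1 G \<alpha> V"
  shows "res (subgroup_generated G S) \<alpha> V (H1_class G \<alpha> V f) =
    H1_class (subgroup_generated G S) \<alpha> V (restrict f (carrier (subgroup_generated G S)))"
proof -
  interpret H: group_rep "subgroup_generated G S" \<alpha> V by (rule group_rep_subgroup_generated)
  have sub: "g \<in> carrier G" if "g \<in> carrier (subgroup_generated G S)" for g
    using carrier_subgroup_generated_subset that by blast
  have "H1_class (subgroup_generated G S) \<alpha> V (restrict f' (carrier (subgroup_generated G S))) =
      H1_class (subgroup_generated G S) \<alpha> V (restrict f (carrier (subgroup_generated G S)))"
    if f': "f' \<in> H1_class G \<alpha> V f" for f'
  proof -
    obtain m where "m \<in> V" "f' \<in> Z1 G \<alpha> V" "\<And>g. g \<in> carrier G \<Longrightarrow> f' g = f g + (\<alpha> g m - m)"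
      using H1_class_cases f' by blast
    then show ?thesis
      by (intro H.H1_class_eqI[symmetric, of _ _ m] Z1_restrict f) (auto simp: sub)
  qed
  then show ?thesis using mem_H1_class[OF f] unfolding res_def by blast
qed

text \<open>That \<open>H\<^sup>1\<close> is a line is used in the form of a cocycle that is unique up to scaling and
  coboundaries, so that computations take place with cocycles and not with classes.\<close>

definition H1_generator :: "('a \<Rightarrow> 'v) \<Rightarrow> bool" where
  "H1_generator z \<longleftrightarrow> z \<in> Z1 G \<alpha> V \<and>
    (\<forall>f\<in>Z1 G \<alpha> V. \<exists>r. \<exists>m\<in>V. \<forall>g\<in>carrier G. f g = r *\<^sub>R z g + (\<alpha> g m - m)) \<and>
    \<not> (\<exists>m\<in>V. \<forall>g\<in>carrier G. z g = \<alpha> g m - m)"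

lemma H1_generator_carrier:
  assumes "H1_generator z"
  shows "carrier (H1 G \<alpha> V) = range (\<lambda>r. r \<odot>\<^bsub>H1 G \<alpha> V\<^esub> H1_class G \<alpha> V z)"
proof -
  have z: "z \<in> Z1 G \<alpha> V" using assms by (simp add: H1_generator_def)
  have "\<exists>r. H1_class G \<alpha> V f = H1_class G \<alpha> V (\<lambda>g\<in>carrier G. r *\<^sub>R z g)" if f: "f \<in> Z1 G \<alpha> V" for f
  proof -
    obtain r m where "m \<in> V" "\<forall>g\<in>carrier G. f g = r *\<^sub>R z g + (\<alpha> g m - m)"
      using assms f unfolding H1_generator_def by blast
    then have "H1_class G \<alpha> V (\<lambda>g\<in>carrier G. r *\<^sub>R z g) = H1_class G \<alpha> V f"
      by (intro H1_class_eqI[of _ _ m] Z1_scale z f) auto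
    then show ?thesis by metis
  qed
  then show ?thesis
    using z Z1_scale[OF z] unfolding carrier_H1 smult_H1[OF z] by fast
qed

lemma H1_generator_inj:
  assumes "H1_generator z"
    and "r \<odot>\<^bsub>H1 G \<alpha> V\<^esub> H1_class G \<alpha> V z = s \<odot>\<^bsub>H1 G \<alpha> V\<^esub> H1_class G \<alpha> V z"
  shows "r = s"
proof (rule ccontr)
  assume "r \<noteq> s"
  have z: "z \<in> Z1 G \<alpha> V" using assms by (simp add: H1_generator_def)
  obtain m where m: "m \<in> V" "\<And>g. g \<in> carrier G \<Longrightarrow> s *\<^sub>R z g = r *\<^sub>R z g + (\<alpha> g m - m)"
    using assms(2) z Z1_scale[OF z] by (auto simp: smult_H1 H1_class_eq_iff)
  have "z g = \<alpha> g (inverse (s - r) *\<^sub>R m) - inverse (s - r) *\<^sub>R m" if g: "g \<in> carrier G" for g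
  proof -
    have "z g = inverse (s - r) *\<^sub>R ((s - r) *\<^sub>R z g)" using \<open>r \<noteq> s\<close> by simp
    also have "(s - r) *\<^sub>R z g = \<alpha> g m - m" using m(2)[OF g] by (simp add: algebra_simps)
    finally show ?thesis by (simp add: scale g scaleR_diff_right)
  qed
  then show False
    using assms(1) subspace_scale[OF subspace m(1)] unfolding H1_generator_def by blast
qed

lemma H1_generator_smult_eqD:
  assumes "H1_generator z" and "C \<in> carrier (H1 G \<alpha> V)"
  obtains r where "C = H1_class G \<alpha> V (\<lambda>g\<in>carrier G. r *\<^sub>R z g)"
  using assms H1_generator_carrier[OF assms(1)] smult_H1[of z] by (auto simp: H1_generator_def)

lemma finsum_singleton_H1:
  assumes "C \<in> carrier (H1 G \<alpha> V)"
  shows "(\<Oplus>\<^bsub>H1 G \<alpha> V\<^esub>b\<in>{C}. c b \<odot>\<^bsub>H1 G \<alpha> V\<^esub> b) = c C \<odot>\<^bsub>H1 G \<alpha> V\<^esub> C"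
proof -
  interpret A: abelian_monoid "H1 G \<alpha> V" by (rule abelian_monoid_H1)
  have "c C \<odot>\<^bsub>H1 G \<alpha> V\<^esub> C \<in> carrier (H1 G \<alpha> V)"
    using assms Z1_scale by (auto simp: carrier_H1 smult_H1)
  then show ?thesis by (subst A.finsum_insert) auto
qed

lemma has_dim_1_if_H1_generator:
  assumes "H1_generator z"
  shows "has_dim (H1 G \<alpha> V) 1"
  unfolding has_dim_def
proof (intro exI[of _ "{H1_class G \<alpha> V z}"] conjI ballI)
  have z: "H1_class G \<alpha> V z \<in> carrier (H1 G \<alpha> V)"
    using assms by (auto simp: H1_generator_def carrier_H1)
  then show "{H1_class G \<alpha> V z} \<subseteq> carrier (H1 G \<alpha> V)" by simp
  fix C assume "C \<in> carrier (H1 G \<alpha> V)"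
  then obtain r where r: "C = r \<odot>\<^bsub>H1 G \<alpha> V\<^esub> H1_class G \<alpha> V z"
    using H1_generator_carrier[OF assms] by auto
  show "\<exists>!c. c \<in> {H1_class G \<alpha> V z} \<rightarrow>\<^sub>E UNIV \<and>
      C = (\<Oplus>\<^bsub>H1 G \<alpha> V\<^esub>b\<in>{H1_class G \<alpha> V z}. c b \<odot>\<^bsub>H1 G \<alpha> V\<^esub> b)"
  proof (rule ex1I[of _ "\<lambda>b\<in>{H1_class G \<alpha> V z}. r"])
    fix c assume "c \<in> {H1_class G \<alpha> V z} \<rightarrow>\<^sub>E (UNIV :: real set) \<and>
      C = (\<Oplus>\<^bsub>H1 G \<alpha> V\<^esub>b\<in>{H1_class G \<alpha> V z}. c b \<odot>\<^bsub>H1 G \<alpha> V\<^esub> b)"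
    then show "c = (\<lambda>b\<in>{H1_class G \<alpha> V z}. r)"
      using H1_generator_inj[OF assms] r
      by (auto simp: finsum_singleton_H1[OF z] PiE_def extensional_def fun_eq_iff)
  qed (simp add: finsum_singleton_H1[OF z] r)
qed auto

lemma H1_generator_if_has_dim_1:
  assumes "has_dim (H1 G \<alpha> V) 1" and z: "z \<in> Z1 G \<alpha> V"
    and z': "\<not> (\<exists>m\<in>V. \<forall>g\<in>carrier G. z g = \<alpha> g m - m)"
  shows "H1_generator z"
proof -
  from assms(1)[unfolded has_dim_def]
  obtain B where B: "B \<subseteq> carrier (H1 G \<alpha> V)" "card B = 1"
    and ex: "\<forall>C\<in>carrier (H1 G \<alpha> V). \<exists>!c. c \<in> B \<rightarrow>\<^sub>E UNIV \<and>
      C = (\<Oplus>\<^bsub>H1 G \<alpha> V\<^esub>b\<in>B. c b \<odot>\<^bsub>H1 G \<alpha> V\<^esub> b)"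
    by (elim exE conjE) (rule that)
  obtain b where b: "B = {b}" using B(2) card_1_singletonE by blast
  obtain e where e: "e \<in> Z1 G \<alpha> V" "b = H1_class G \<alpha> V e" using B(1) b by (auto simp: carrier_H1)
  have *: "\<exists>r. \<exists>m\<in>V. \<forall>g\<in>carrier G. f g = r *\<^sub>R e g + (\<alpha> g m - m)" if f: "f \<in> Z1 G \<alpha> V" for f
  proof -
    have "b \<in> carrier (H1 G \<alpha> V)" using B b by auto
    have "H1_class G \<alpha> V f \<in> carrier (H1 G \<alpha> V)" using f by (simp add: carrier_H1)
    from bspec[OF ex this] obtain c where "H1_class G \<alpha> V f = (\<Oplus>\<^bsub>H1 G \<alpha> V\<^esub>b\<in>B. c b \<odot>\<^bsub>H1 G \<alpha> V\<^esub> b)"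
      by (elim ex1E conjE) (rule that)
    then obtain r where "H1_class G \<alpha> V f = r \<odot>\<^bsub>H1 G \<alpha> V\<^esub> b"
      using \<open>b \<in> carrier (H1 G \<alpha> V)\<close> unfolding b finsum_singleton_H1[OF \<open>b \<in> carrier (H1 G \<alpha> V)\<close>] by blast
    then have "H1_class G \<alpha> V (\<lambda>g\<in>carrier G. r *\<^sub>R e g) = H1_class G \<alpha> V f"
      using e by (simp add: smult_H1)
    then obtain m where "m \<in> V" "\<forall>g\<in>carrier G. f g = (\<lambda>g\<in>carrier G. r *\<^sub>R e g) g + (\<alpha> g m - m)"
      using f Z1_scale[OF e(1)] H1_class_eq_iff by blast
    then show ?thesis by (intro exI[of _ r] bexI[of _ m]) auto
  qed
  obtain s n where n: "n \<in> V" "\<And>g. g \<in> carrier G \<Longrightarrow> z g = s *\<^sub>R e g + (\<alpha> g n - n)" using *[OF z] by blast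
  have "s \<noteq> 0" using n z' by auto
  have "\<exists>r. \<exists>m\<in>V. \<forall>g\<in>carrier G. f g = r *\<^sub>R z g + (\<alpha> g m - m)" if f: "f \<in> Z1 G \<alpha> V" for f
  proof -
    obtain r m where m: "m \<in> V" "\<And>g. g \<in> carrier G \<Longrightarrow> f g = r *\<^sub>R e g + (\<alpha> g m - m)" using *[OF f] by blast
    have "f g = (r / s) *\<^sub>R z g + (\<alpha> g (m - (r / s) *\<^sub>R n) - (m - (r / s) *\<^sub>R n))" if g: "g \<in> carrier G" for g
    proof -
      have "r *\<^sub>R e g = (r / s) *\<^sub>R (z g - (\<alpha> g n - n))"
        using n(2)[OF g] \<open>s \<noteq> 0\<close> by simp
      then have "f g = (r / s) *\<^sub>R (z g - (\<alpha> g n - n)) + (\<alpha> g m - m)"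
        using m(2)[OF g] by simp
      then show ?thesis
        using g by (simp add: diff scale scaleR_diff_right)
    qed
    moreover have "m - (r / s) *\<^sub>R n \<in> V" by (intro subspace_diff subspace_scale subspace m n)
    ultimately show ?thesis by blast
  qed
  then show ?thesis using z z' by (auto simp: H1_generator_def)
qed

text \<open>A linear map between lines is an isomorphism if it maps a generator to a generator.\<close>

lemma linear_iso_res:
  assumes z: "H1_generator z"
    and z': "group_rep.H1_generator (subgroup_generated G S) \<alpha> V
      (restrict z (carrier (subgroup_generated G S)))"
  shows "linear_iso (res (subgroup_generated G S) \<alpha> V) (H1 G \<alpha> V) (H1 (subgroup_generated G S) \<alpha> V)"
proof -
  define H where "H = subgroup_generated G S"
  interpret H: group_rep H \<alpha> V unfolding H_def by (rule group_rep_subgroup_generated)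
  have sub: "g \<in> carrier G" if "g \<in> carrier H" for g
    using carrier_subgroup_generated_subset that unfolding H_def by blast
  have res: "res H \<alpha> V (H1_class G \<alpha> V f) = H1_class H \<alpha> V (restrict f (carrier H))" if "f \<in> Z1 G \<alpha> V" for f
    unfolding H_def by (rule res_H1_class[OF that])
  have rZ: "restrict f (carrier H) \<in> Z1 H \<alpha> V" if "f \<in> Z1 G \<alpha> V" for f
    unfolding H_def by (rule Z1_restrict[OF that])
  have zZ: "z \<in> Z1 G \<alpha> V" using z by (simp add: H1_generator_def)
  have GH: "carrier G \<inter> carrier H = carrier H" using sub by blast
  have smult: "res H \<alpha> V (r \<odot>\<^bsub>H1 G \<alpha> V\<^esub> C) = r \<odot>\<^bsub>H1 H \<alpha> V\<^esub> res H \<alpha> V C" if C: "C \<in> carrier (H1 G \<alpha> V)" for r C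
  proof -
    obtain f where f: "f \<in> Z1 G \<alpha> V" "C = H1_class G \<alpha> V f" using C by (auto simp: carrier_H1)
    show ?thesis using f by (simp add: smult_H1 H.smult_H1 res rZ Z1_scale GH sub cong: restrict_cong)
  qed
  have add: "res H \<alpha> V (C \<oplus>\<^bsub>H1 G \<alpha> V\<^esub> D) = res H \<alpha> V C \<oplus>\<^bsub>H1 H \<alpha> V\<^esub> res H \<alpha> V D"
    if "C \<in> carrier (H1 G \<alpha> V)" "D \<in> carrier (H1 G \<alpha> V)" for C D
  proof -
    obtain f h where f: "f \<in> Z1 G \<alpha> V" "C = H1_class G \<alpha> V f" and h: "h \<in> Z1 G \<alpha> V" "D = H1_class G \<alpha> V h"
      using \<open>C \<in> _\<close> \<open>D \<in> _\<close> by (auto simp: carrier_H1)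
    show ?thesis using f h by (simp add: add_H1 H.add_H1 res rZ Z1_add GH sub cong: restrict_cong)
  qed
  define Z where "Z = H1_class G \<alpha> V z"
  have Z: "Z \<in> carrier (H1 G \<alpha> V)" using zZ by (simp add: Z_def carrier_H1)
  have rz: "H.H1_generator (restrict z (carrier H))" using z' by (simp add: H_def)
  have "bij_betw (res H \<alpha> V) (carrier (H1 G \<alpha> V)) (carrier (H1 H \<alpha> V))"
    unfolding bij_betw_def
  proof
    show "inj_on (res H \<alpha> V) (carrier (H1 G \<alpha> V))"
    proof (rule inj_onI)
      fix C D assume CD: "C \<in> carrier (H1 G \<alpha> V)" "D \<in> carrier (H1 G \<alpha> V)" "res H \<alpha> V C = res H \<alpha> V D"
      then obtain r s where C: "C = r \<odot>\<^bsub>H1 G \<alpha> V\<^esub> Z" and D: "D = s \<odot>\<^bsub>H1 G \<alpha> V\<^esub> Z"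
        unfolding H1_generator_carrier[OF z] Z_def by blast
      have "res H \<alpha> V Z = H1_class H \<alpha> V (restrict z (carrier H))" by (simp add: Z_def res zZ)
      then have "r = s" using CD(3) H.H1_generator_inj[OF rz] unfolding C D smult[OF Z] by simp
      then show "C = D" by (simp add: C D)
    qed
    show "res H \<alpha> V ` carrier (H1 G \<alpha> V) = carrier (H1 H \<alpha> V)"
      using smult[OF Z] res[OF zZ]
      by (simp add: H1_generator_carrier[OF z] H.H1_generator_carrier[OF rz] image_image Z_def)
  qed
  then show ?thesis using smult add by (simp add: linear_iso_def H_def)
qed

end

section \<open>Two-by-two complex matrices and the Lorentz group\<close>

lemma matrix_inv_eqI:
  fixes A :: "'a::semiring_1 ^ 'n ^ 'n"
  assumes "A ** B = mat 1" and "B ** A = mat 1"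
  shows "matrix_inv A = B"
proof -
  have inv: "A ** matrix_inv A = mat 1 \<and> matrix_inv A ** A = mat 1"
    unfolding matrix_inv_def
    by (rule someI[of "\<lambda>C. A ** C = mat 1 \<and> C ** A = mat 1" B]) (simp add: assms)
  then have "matrix_inv A = (matrix_inv A ** A) ** B"
    by (subst matrix_mul_assoc[symmetric]) (simp only: assms(1) matrix_mul_rid)
  also have "\<dots> = B" using inv by simp
  finally show ?thesis .
qed

definition mat2 :: "'a \<Rightarrow> 'a \<Rightarrow> 'a \<Rightarrow> 'a \<Rightarrow> 'a::zero ^ 2 ^ 2" where
  "mat2 a b c d = vector [vector [a, b], vector [c, d]]"

lemma mat2_nth [simp]:
  "mat2 a b c d $ 1 $ 1 = a" "mat2 a b c d $ 1 $ 2 = b"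
  "mat2 a b c d $ 2 $ 1 = c" "mat2 a b c d $ 2 $ 2 = d"
  by (simp_all add: mat2_def)

lemma mat2_eq_iff: "A = B \<longleftrightarrow> A $ 1 $ 1 = B $ 1 $ 1 \<and> A $ 1 $ 2 = B $ 1 $ 2 \<and>
    A $ 2 $ 1 = B $ 2 $ 1 \<and> A $ 2 $ 2 = (B :: 'a ^ 2 ^ 2) $ 2 $ 2"
  by (auto simp: vec_eq_iff forall_2)

lemma mat2_cases: obtains a b c d where "A = mat2 a b c d"
  by (metis mat2_eq_iff mat2_nth)

lemma mat2_simps [simp]:
  fixes a b c d :: complex
  shows "mat2 a b c d ** mat2 a' b' c' d' =
      mat2 (a * a' + b * c') (a * b' + b * d') (c * a' + d * c') (c * b' + d * d')"
    and "mat2 a b c d + mat2 a' b' c' d' = mat2 (a + a') (b + b') (c + c') (d + d')"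
    and "mat2 a b c d - mat2 a' b' c' d' = mat2 (a - a') (b - b') (c - c') (d - d')"
    and "- mat2 a b c d = mat2 (- a) (- b) (- c) (- d)"
    and "r *\<^sub>R mat2 a b c d = mat2 (r *\<^sub>R a) (r *\<^sub>R b) (r *\<^sub>R c) (r *\<^sub>R d)"
    and "det (mat2 a b c d) = a * d - b * c"
    and "trace (mat2 a b c d) = a + d"
    and "mat2 a b c d = mat2 a' b' c' d' \<longleftrightarrow> a = a' \<and> b = b' \<and> c = c' \<and> d = d'"
  by (simp_all add: mat2_eq_iff matrix_matrix_mult_def sum_2 det_2 trace_def)

lemma mat_eq_mat2: "(mat k :: complex ^ 2 ^ 2) = mat2 k 0 0 k"
  and zero_eq_mat2: "(0 :: complex ^ 2 ^ 2) = mat2 0 0 0 0"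
  by (simp_all add: mat2_eq_iff mat_def)

lemma matrix_inv_mat2: "a * d - b * c = 1 \<Longrightarrow> matrix_inv (mat2 a b c d) = mat2 d (- b) (- c) (a :: complex)"
  by (rule matrix_inv_eqI) (auto simp: mat_eq_mat2 algebra_simps)

lemma SL2_inv:
  fixes A :: "complex ^ 2 ^ 2"
  assumes "det A = 1"
  shows "A ** matrix_inv A = mat 1" "matrix_inv A ** A = mat 1" "det (matrix_inv A) = 1"
proof -
  obtain a b c d where A: "A = mat2 a b c d" using mat2_cases by blast
  have "a * d - b * c = 1" using assms by (simp add: A)
  then show "A ** matrix_inv A = mat 1" "matrix_inv A ** A = mat 1" "det (matrix_inv A) = 1"
    by (auto simp: A matrix_inv_mat2 mat_eq_mat2 algebra_simps)
qed

definition ctranspose :: "complex ^ 'n ^ 'm \<Rightarrow> complex ^ 'm ^ 'n" where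
  "ctranspose A = (\<chi> i j. cnj (A $ j $ i))"

lemma ctranspose_mat2 [simp]: "ctranspose (mat2 a b c d) = mat2 (cnj a) (cnj c) (cnj b) (cnj d)"
  by (simp add: mat2_eq_iff ctranspose_def)

lemma ctranspose_mult: "ctranspose (A ** B) = ctranspose (B :: complex ^ 2 ^ 2) ** ctranspose (A :: complex ^ 2 ^ 2)"
  by (rule mat2_cases[of A], rule mat2_cases[of B]) (simp add: algebra_simps)

lemma ctranspose_ctranspose [simp]: "ctranspose (ctranspose A) = A"
  by (simp add: ctranspose_def vec_eq_iff)

lemma hermitian_eq_mat2: "hermitian s = mat2 (complex_of_real (s $ 4 + s $ 3)) (Complex (s $ 1) (s $ 2))
    (Complex (s $ 1) (- (s $ 2))) (complex_of_real (s $ 4 - s $ 3))"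
  by (simp add: hermitian_def mat2_def)

lemma hermitian_coords_nth [simp]:
  "hermitian_coords A $ 1 = Re (A $ 1 $ 2)" "hermitian_coords A $ 2 = Im (A $ 1 $ 2)"
  "hermitian_coords A $ 3 = (Re (A $ 1 $ 1) - Re (A $ 2 $ 2)) / 2"
  "hermitian_coords A $ 4 = (Re (A $ 1 $ 1) + Re (A $ 2 $ 2)) / 2"
  by (simp_all add: hermitian_coords_def vector_def)

lemma hermitian_coords_hermitian [simp]: "hermitian_coords (hermitian s) = s"
  by (simp add: vec_eq_iff forall_4 hermitian_eq_mat2)

lemma ctranspose_hermitian [simp]: "ctranspose (hermitian s) = hermitian s"
  by (simp add: hermitian_eq_mat2 complex_eq_iff)

lemma hermitian_hermitian_coords:
  assumes "ctranspose A = A"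
  shows "hermitian (hermitian_coords A) = A"
proof -
  obtain a b c d where A: "A = mat2 a b c d" using mat2_cases by blast
  have "cnj a = a" "cnj d = d" "c = cnj b" using assms by (simp_all add: A)
  then have "Im a = 0" "Im d = 0" "c = cnj b" by (simp_all add: complex_eq_iff)
  then show ?thesis
    by (simp add: A hermitian_eq_mat2 complex_eq_iff add_divide_distrib diff_divide_distrib)
qed

lemma linear_hermitian: "linear hermitian"
  by (rule linearI) (simp_all add: hermitian_eq_mat2 complex_eq_iff distrib_left right_diff_distrib)

lemma linear_hermitian_coords: "linear hermitian_coords"
  by (rule linearI) (simp_all add: vec_eq_iff forall_4 field_simps)

lemma linear_mult_left: "linear (\<lambda>X. A ** (X :: 'a::real_algebra_1 ^ 'n ^ 'm))"
  and linear_mult_right: "linear (\<lambda>X. (X :: 'a::real_algebra_1 ^ 'n ^ 'm) ** B)"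
  by (rule linearI; simp add: vec_eq_iff matrix_matrix_mult_def algebra_simps sum.distrib scaleR_sum_right)+

lemmas matrix_linear =
  linear_add[OF linear_mult_left] linear_add[OF linear_mult_right]
  linear_diff[OF linear_mult_left] linear_diff[OF linear_mult_right]
  linear_neg[OF linear_mult_left] linear_neg[OF linear_mult_right]
  linear_scale[OF linear_mult_left] linear_scale[OF linear_mult_right]
  linear_0[OF linear_mult_left] linear_0[OF linear_mult_right]

lemma spinor_map_works:
  "spinor_map A *v s = hermitian_coords (A ** hermitian s ** ctranspose A)"
proof -
  have "linear (\<lambda>s. hermitian_coords (A ** hermitian s ** ctranspose A))"
    using linear_compose[OF linear_compose[OF linear_compose[OF linear_hermitian linear_mult_left[of A]]
        linear_mult_right[of "ctranspose A"]] linear_hermitian_coords] by (simp add: o_def)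
  then show ?thesis
    unfolding spinor_map_def ctranspose_def[symmetric]
    by (intro matrix_works) (simp add: linear_matrix_vector_mul_eq)
qed

lemma hermitian_spinor_map: "hermitian (spinor_map A *v s) = A ** hermitian s ** ctranspose A"
  unfolding spinor_map_works
  by (rule hermitian_hermitian_coords) (simp add: ctranspose_mult matrix_mul_assoc)

lemma hermitian_inject: "hermitian s = hermitian t \<Longrightarrow> s = t"
  by (metis hermitian_coords_hermitian)

lemma spinor_map_mult: "spinor_map (A ** B) = spinor_map A ** spinor_map B"
  unfolding matrix_eq
  by (intro allI hermitian_inject)
    (simp add: matrix_vector_mul_assoc[symmetric] hermitian_spinor_map ctranspose_mult matrix_mul_assoc)

lemma spinor_map_scalar: "spinor_map (mat k) = mat ((cmod k)\<^sup>2)"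
  unfolding matrix_eq
proof
  fix s
  have "mat k ** hermitian s ** ctranspose (mat k) = hermitian ((cmod k)\<^sup>2 *\<^sub>R s)"
    using complex_norm_square[of k]
    by (simp add: mat_eq_mat2 hermitian_eq_mat2 complex_eq_iff algebra_simps cmod_power2 power2_eq_square)
  then have "spinor_map (mat k) *v s = (cmod k)\<^sup>2 *\<^sub>R s"
    by (simp add: spinor_map_works)
  also have "\<dots> = mat ((cmod k)\<^sup>2) *v s"
    by (simp add: vec_eq_iff matrix_vector_mult_def mat_def if_distrib[where f = "\<lambda>c. c * _"] sum.delta cong: if_cong)
  finally show "spinor_map (mat k) *v s = mat ((cmod k)\<^sup>2) *v s" .
qed

lemma spinor_map_one [simp]: "spinor_map (mat 1) = mat 1"
  using spinor_map_scalar[of 1] by simp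

lemma spinor_map_uminus [simp]: "spinor_map (- A) = spinor_map A"
  unfolding matrix_eq
  by (rule mat2_cases[of A]) (auto simp: spinor_map_works hermitian_eq_mat2 algebra_simps)

text \<open>The Hermitian matrices span all complex matrices, so \<open>H \<mapsto> A H A\<^sup>*\<close> determines the tensor
  product of \<open>A\<close> with its conjugate, and thereby \<open>A\<close> up to a phase.\<close>

lemma spinor_map_eqD:
  assumes "spinor_map A = spinor_map B"
  shows "A $ i $ j * cnj (A $ k $ l) = B $ i $ j * cnj (B $ k $ l)"
proof -
  have eq: "A ** hermitian s ** ctranspose A = B ** hermitian s ** ctranspose B" for s
    by (metis assms hermitian_spinor_map)
  obtain a b c d where A: "A = mat2 a b c d" using mat2_cases by blast
  obtain a' b' c' d' where B: "B = mat2 a' b' c' d'" using mat2_cases by blast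
  have H: "hermitian (vector [0, 0, 1, 1]) = mat2 2 0 0 0" "hermitian (vector [0, 0, -1, 1]) = mat2 0 0 0 2"
    "hermitian (vector [1, 0, 0, 0]) = mat2 0 1 1 0" "hermitian (vector [0, 1, 0, 0]) = mat2 0 \<i> (- \<i>) 0"
    by (auto simp: hermitian_eq_mat2 vector_def complex_eq_iff)
  have 1: "a * cnj a = a' * cnj a'" "a * cnj c = a' * cnj c'" "c * cnj a = c' * cnj a'" "c * cnj c = c' * cnj c'"
    using eq[of "vector [0, 0, 1, 1]"] by (simp_all add: A B H)
  have 2: "b * cnj b = b' * cnj b'" "b * cnj d = b' * cnj d'" "d * cnj b = d' * cnj b'" "d * cnj d = d' * cnj d'"
    using eq[of "vector [0, 0, -1, 1]"] by (simp_all add: A B H)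
  have 3: "b * cnj a + a * cnj b = b' * cnj a' + a' * cnj b'" "b * cnj c + a * cnj d = b' * cnj c' + a' * cnj d'"
    "d * cnj a + c * cnj b = d' * cnj a' + c' * cnj b'" "d * cnj c + c * cnj d = d' * cnj c' + c' * cnj d'"
    using eq[of "vector [1, 0, 0, 0]"] by (simp_all add: A B H)
  have "\<i> * (a * cnj b - b * cnj a) = \<i> * (a' * cnj b' - b' * cnj a')"
    "\<i> * (a * cnj d - b * cnj c) = \<i> * (a' * cnj d' - b' * cnj c')"
    "\<i> * (c * cnj b - d * cnj a) = \<i> * (c' * cnj b' - d' * cnj a')"
    "\<i> * (c * cnj d - d * cnj c) = \<i> * (c' * cnj d' - d' * cnj c')"
    using eq[of "vector [0, 1, 0, 0]"] by (simp_all add: A B H algebra_simps)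
  then have 4: "a * cnj b - b * cnj a = a' * cnj b' - b' * cnj a'"
    "a * cnj d - b * cnj c = a' * cnj d' - b' * cnj c'"
    "c * cnj b - d * cnj a = c' * cnj b' - d' * cnj a'"
    "c * cnj d - d * cnj c = c' * cnj d' - d' * cnj c'"
    by simp_all
  have half: "p = p' \<and> q = q'" if "p + q = p' + q'" "q - p = q' - p'" for p q p' q' :: complex
    using arg_cong2[OF that, of "(+)"] arg_cong2[OF that, of "(-)"] by simp
  have "i = 1 \<or> i = 2" "j = 1 \<or> j = 2" "k = 1 \<or> k = 2" "l = 1 \<or> l = 2" using exhaust_2 by auto
  then show ?thesis
    using 1 2 half[OF 3(1) 4(1)] half[OF 3(2) 4(2)] half[OF 3(3) 4(3)] half[OF 3(4) 4(4)]
    by (elim disjE) (simp_all add: A B)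
qed

definition lorentz_transpose :: "real ^ 4 ^ 4 \<Rightarrow> real ^ 4 ^ 4" where
  "lorentz_transpose X = lorentz_form ** transpose X ** lorentz_form"

lemma lorentz_form_mult [simp]: "lorentz_form ** lorentz_form = mat 1"
  by (auto simp: vec_eq_iff forall_4 lorentz_form_def matrix_matrix_mult_def sum_4 mat_def)

lemma lorentz_form_mult' [simp]: "X ** lorentz_form ** lorentz_form = X"
  by (metis lorentz_form_mult matrix_mul_assoc matrix_mul_rid)

lemma transpose_lorentz_form [simp]: "transpose lorentz_form = lorentz_form"
  by (auto simp: vec_eq_iff lorentz_form_def transpose_def)

lemma linear_transpose: "linear (transpose :: real ^ 'n ^ 'm \<Rightarrow> _)"
  by (rule linearI) (simp_all add: vec_eq_iff transpose_def)

lemma linear_lorentz_transpose: "linear lorentz_transpose"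
  using linear_compose[OF linear_compose[OF linear_transpose linear_mult_left] linear_mult_right, of lorentz_form lorentz_form]
  by (simp add: o_def lorentz_transpose_def[abs_def])

lemma lorentz_transpose_mult: "lorentz_transpose (X ** Y) = lorentz_transpose Y ** lorentz_transpose X"
  by (simp add: lorentz_transpose_def matrix_transpose_mul matrix_mul_assoc)

lemma lorentz_transpose_lorentz_transpose [simp]: "lorentz_transpose (lorentz_transpose X) = X"
  by (simp add: lorentz_transpose_def matrix_transpose_mul matrix_mul_assoc)

lemma trace_lorentz_transpose: "trace (lorentz_transpose X) = trace X"
proof -
  have "trace (lorentz_transpose X) = trace (lorentz_form ** (lorentz_form ** transpose X))"
    unfolding lorentz_transpose_def by (rule trace_mul_sym)
  then show ?thesis
    by (simp add: matrix_mul_assoc transpose_def trace_def)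
qed

lemma spinor_map_nth:
  "spinor_map A $ i $ j = hermitian_coords (A ** hermitian (axis j 1) ** ctranspose A) $ i"
  using spinor_map_works[of A "axis j 1"] by (metis matrix_vector_mult_basis column_def vec_lambda_beta)

lemma hermitian_axis [simp]:
  "hermitian (axis 1 1) = mat2 0 1 1 0" "hermitian (axis 2 1) = mat2 0 \<i> (- \<i>) 0"
  "hermitian (axis 3 1) = mat2 1 0 0 (- 1)" "hermitian (axis 4 1) = mat2 1 0 0 1"
  by (simp_all add: hermitian_eq_mat2 axis_def complex_eq_iff)

lemma lorentz_transpose_nth: "lorentz_transpose X $ i $ j =
    (if i = 4 then - 1 else 1) * (if j = 4 then - 1 else 1) * X $ j $ i"
proof -
  have "lorentz_transpose X $ i $ j = (\<Sum>k\<in>UNIV. (\<Sum>l\<in>UNIV. lorentz_form $ i $ l * X $ k $ l) * lorentz_form $ k $ j)"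
    by (simp add: lorentz_transpose_def matrix_matrix_mult_def transpose_def)
  also have "\<dots> = (if i = 4 then - 1 else 1) * (if j = 4 then - 1 else 1) * X $ j $ i"
    using exhaust_4[of i] exhaust_4[of j] by (auto simp: sum_4 lorentz_form_def)
  finally show ?thesis .
qed

text \<open>The Lorentz form is \<open>- det\<close>, and the adjugate is the adjoint with respect to the determinant.
  For \<open>det A = 1\<close> the lemma says that the spinor map takes values in the Lorentz group.\<close>

lemma lorentz_transpose_spinor_map:
  "lorentz_transpose (spinor_map (mat2 a b c d)) = spinor_map (mat2 d (- b) (- c) a)"
  by (simp add: vec_eq_iff forall_4 lorentz_transpose_nth spinor_map_nth algebra_simps
      add_divide_distrib diff_divide_distrib)

text \<open>The complexification of the spinor representation is the tensor product of the standard
  representation with its conjugate, hence the product of traces.\<close>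

lemma trace_spinor_map: "trace (spinor_map A) = (cmod (trace A))\<^sup>2"
proof -
  obtain a b c d where A: "A = mat2 a b c d" using mat2_cases by blast
  have "trace (spinor_map A) = (Re a + Re d)\<^sup>2 + (Im a + Im d)\<^sup>2"
    by (simp add: trace_def sum_4 spinor_map_nth A power2_eq_square algebra_simps
        add_divide_distrib diff_divide_distrib)
  then show ?thesis
    by (simp add: A cmod_power2)
qed

section \<open>The Lie algebra of PGL(4,R) as a module over the Lorentz group\<close>

lemma sum_Basis_matrix:
  "(\<Sum>E\<in>Basis. f E) = (\<Sum>i\<in>UNIV. \<Sum>j\<in>UNIV. f (axis i (axis j (1::real)) :: real ^ 'n ^ 'm))"
proof -
  let ?e = "\<lambda>(i, j). axis i (axis j (1::real)) :: real ^ 'n ^ 'm"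
  have "inj ?e" by (auto intro!: injI simp: axis_eq_axis)
  moreover have "(Basis :: (real ^ 'n ^ 'm) set) = range ?e" by (auto simp: Basis_vec_def)
  ultimately have "sum f Basis = (\<Sum>p\<in>UNIV. f (?e p))" by (rule sum.reindex_cong) simp
  also have "\<dots> = (\<Sum>(i, j)\<in>UNIV \<times> UNIV. f (axis i (axis j 1)))"
    by (intro sum.cong) auto
  finally show ?thesis by (simp only: sum.cartesian_product)
qed

lemma matrix_mult_axis_mult:
  fixes A B :: "real ^ 'n ^ 'n"
  shows "(A ** axis i (axis j 1) ** B) $ k $ l = A $ k $ i * B $ j $ l"
proof -
  have "(A ** axis i (axis j 1)) $ k $ m = (if m = j then A $ k $ i else 0)" for m
  proof -
    have "(A ** axis i (axis j 1)) $ k $ m = (\<Sum>n\<in>UNIV. A $ k $ n * (if n = i then if m = j then 1 else 0 else 0))"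
      by (auto simp: matrix_matrix_mult_def axis_def intro!: sum.cong sum.neutral)
    also have "\<dots> = (\<Sum>n\<in>UNIV. if n = i then A $ k $ n * (if m = j then 1 else 0) else 0)"
      by (intro sum.cong) auto
    finally show ?thesis by simp
  qed
  then show ?thesis
    by (simp add: matrix_matrix_mult_def[of _ B] if_distrib[where f = "\<lambda>c. c * _"] sum.delta cong: if_cong)
qed

text \<open>This is the usual expression \<open>2n tr(XY)\<close> of the Killing form of \<open>sl(n)\<close>, here for
  \<open>n = 4\<close>, with a correction that extends it to scalar matrices.\<close>

lemma killing_eq: "killing X Y = 8 * trace (X ** Y) - 2 * trace X * trace Y"
proof -
  have diag: "(mat 1 :: real ^ 4 ^ 4) $ i $ i = 1" for i by (simp add: mat_def)
  have "ad X (ad Y E) = X ** Y ** E ** mat 1 - X ** E ** Y - Y ** E ** X + mat 1 ** E ** (Y ** X)" for E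
    by (simp add: ad_def matrix_linear matrix_mul_assoc)
  moreover have "(A ** axis i (axis j 1)) $ i $ j = A $ i $ i" "(axis i (axis j 1) ** A) $ i $ j = A $ j $ j"
    for A :: "real ^ 4 ^ 4" and i j
    using matrix_mult_axis_mult[of A i j "mat 1" i j] matrix_mult_axis_mult[of "mat 1" i j A i j]
    by (simp_all add: diag)
  ultimately have "ad X (ad Y (axis i (axis j 1))) \<bullet> axis i (axis j 1) =
      (X ** Y) $ i $ i - X $ i $ i * Y $ j $ j - Y $ i $ i * X $ j $ j + (Y ** X) $ j $ j" for i j
    by (simp add: inner_axis matrix_mult_axis_mult)
  then have "killing X Y = 4 * trace (X ** Y) - trace X * trace Y - trace Y * trace X + 4 * trace (Y ** X)"
    by (simp add: killing_def sum_Basis_matrix sum.distrib sum_subtractf trace_def sum_product)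
      (simp flip: sum_distrib_left)
  then show ?thesis using trace_mul_sym[of Y X] by simp
qed

lemma trace_mult_transpose: "trace (X ** transpose Y) = X \<bullet> (Y :: real ^ 'n ^ 'm)"
  by (simp add: trace_def matrix_matrix_mult_def transpose_def inner_vec_def)

lemma trace_add: "trace (A + B) = trace A + trace (B :: real ^ 'n ^ 'n)"
  and trace_diff: "trace (A - B) = trace A - trace (B :: real ^ 'n ^ 'n)"
  and trace_scaleR: "trace (r *\<^sub>R A) = r * trace (A :: real ^ 'n ^ 'n)"
  and trace_uminus: "trace (- A) = - trace (A :: real ^ 'n ^ 'n)"
  by (simp_all add: trace_def sum.distrib sum_subtractf sum_distrib_left sum_negf)

lemma trace_zero: "trace (0 :: real ^ 'n ^ 'n) = 0"
  by (simp add: trace_def)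

lemma so31_iff: "X \<in> so31 \<longleftrightarrow> lorentz_transpose X = - X"
proof -
  have "Z = 0 \<longleftrightarrow> lorentz_form ** Z = 0" for Z :: "real ^ 4 ^ 4"
  proof
    assume "lorentz_form ** Z = 0"
    then have "lorentz_form ** (lorentz_form ** Z) = 0" by (simp add: matrix_linear)
    then show "Z = 0" by (simp add: matrix_mul_assoc)
  qed (simp add: matrix_linear)
  then have "transpose X ** lorentz_form + lorentz_form ** X = 0 \<longleftrightarrow>
      lorentz_form ** (transpose X ** lorentz_form + lorentz_form ** X) = 0" .
  also have "lorentz_form ** (transpose X ** lorentz_form + lorentz_form ** X) = lorentz_transpose X + X"
    by (simp add: lorentz_transpose_def matrix_linear matrix_mul_assoc)
  finally show ?thesis by (simp add: so31_def eq_neg_iff_add_eq_0)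
qed

text \<open>For the Lorentz form, \<open>so(3,1)\<close> consists of the skew-adjoint matrices. They are orthogonal to
  the self-adjoint ones, and the trace form is nondegenerate on them, because transposition
  preserves them; so their complement consists of the traceless self-adjoint matrices.\<close>

lemma frak_v_iff: "X \<in> frak_v \<longleftrightarrow> trace X = 0 \<and> lorentz_transpose X = X"
proof -
  have *: "trace (S ** Y) = 0" if "lorentz_transpose S = S" "lorentz_transpose Y = - Y" for S Y
  proof -
    have "trace (S ** Y) = trace (lorentz_transpose (S ** Y))" by (simp add: trace_lorentz_transpose)
    also have "\<dots> = - trace (Y ** S)"
      by (simp add: lorentz_transpose_mult that trace_uminus matrix_linear)
    finally show ?thesis using trace_mul_sym[of S Y] by simp
  qed
  note lt = linear_add[OF linear_lorentz_transpose] linear_diff[OF linear_lorentz_transpose]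
    linear_scale[OF linear_lorentz_transpose] linear_neg[OF linear_lorentz_transpose]
  have "lorentz_transpose X = X" if X: "X \<in> frak_v"
  proof -
    define S where "S = X + lorentz_transpose X"
    define K where "K = X - lorentz_transpose X"
    have S: "lorentz_transpose S = S" and K: "lorentz_transpose K = - K" by (simp_all add: S_def K_def lt)
    have tK: "lorentz_transpose (transpose K) = - transpose K"
    proof -
      have "transpose (lorentz_transpose K) = - transpose K"
        unfolding K by (simp add: transpose_def vec_eq_iff)
      then show ?thesis by (simp add: lorentz_transpose_def matrix_transpose_mul matrix_mul_assoc)
    qed
    have "trace X = 0" using X by (simp add: frak_v_def sl4_def)
    then have X0: "trace (X ** transpose K) = 0"
      using X tK by (simp add: frak_v_def so31_iff killing_eq)
    have "2 *\<^sub>R X = S + K" by (simp add: S_def K_def scaleR_2)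
    then have "2 * trace (X ** transpose K) = trace (S ** transpose K) + trace (K ** transpose K)"
      by (metis linear_add[OF linear_mult_right] linear_scale[OF linear_mult_right] trace_add trace_scaleR)
    then have "K \<bullet> K = 0" using X0 *[OF S tK] by (simp add: trace_mult_transpose)
    then show ?thesis by (simp add: K_def)
  qed
  then show ?thesis
    using * by (auto simp: frak_v_def sl4_def so31_iff killing_eq)
qed

lemma subspace_so31: "subspace so31" and subspace_frak_v: "subspace frak_v" and subspace_sl4: "subspace sl4"
  by (auto simp: subspace_def so31_iff frak_v_iff sl4_def trace_add trace_scaleR
      linear_add[OF linear_lorentz_transpose] linear_scale[OF linear_lorentz_transpose]
      linear_0[OF linear_lorentz_transpose] trace_zero)

lemma sl4_decompose:
  assumes "X \<in> sl4"
  shows "(1 / 2) *\<^sub>R (X + lorentz_transpose X) \<in> frak_v" "(1 / 2) *\<^sub>R (X - lorentz_transpose X) \<in> so31"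
  using assms by (auto simp: frak_v_iff so31_iff sl4_def trace_add trace_scaleR trace_lorentz_transpose
      linear_add[OF linear_lorentz_transpose] linear_scale[OF linear_lorentz_transpose]
      linear_diff[OF linear_lorentz_transpose] scaleR_diff_right)

lemma so31_subset_sl4: "so31 \<subseteq> sl4"
proof
  fix X assume "X \<in> so31"
  then have "trace X = - trace X" by (metis so31_iff trace_lorentz_transpose trace_uminus)
  then show "X \<in> sl4" by (simp add: sl4_def)
qed

lemma frak_v_subset_sl4: "frak_v \<subseteq> sl4"
  by (auto simp: frak_v_def)

text \<open>Since \<open>tr (X Y\<^sup>T)\<close> is the Euclidean inner product, invariance under transposition makes the
  Killing form nondegenerate on \<open>frak_v\<close>.\<close>

lemma transpose_in_frak_v: "X \<in> frak_v \<Longrightarrow> transpose X \<in> frak_v"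
proof -
  assume X: "X \<in> frak_v"
  then have "transpose (lorentz_transpose X) = transpose X" by (simp add: frak_v_iff)
  then have "lorentz_transpose (transpose X) = transpose X"
    by (simp add: lorentz_transpose_def matrix_transpose_mul matrix_mul_assoc)
  moreover have "trace (transpose X) = trace X" by (simp add: trace_def transpose_def)
  ultimately show ?thesis using X by (simp add: frak_v_iff)
qed

subsection \<open>The adjoint action of SL(2,C)\<close>

definition spin_Ad :: "complex ^ 2 ^ 2 \<Rightarrow> real ^ 4 ^ 4 \<Rightarrow> real ^ 4 ^ 4" where
  "spin_Ad A X = spinor_map A ** X ** spinor_map (matrix_inv A)"

lemma matrix_inv_spinor_map:
  assumes "det A = 1"
  shows "matrix_inv (spinor_map A) = spinor_map (matrix_inv A)"
  using SL2_inv[OF assms] by (intro matrix_inv_eqI) (simp_all flip: spinor_map_mult)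

lemma lorentz_transpose_spinor:
  assumes "det A = 1"
  shows "lorentz_transpose (spinor_map A) = spinor_map (matrix_inv A)"
proof -
  obtain a b c d where A: "A = mat2 a b c d" using mat2_cases by blast
  show ?thesis using assms by (simp add: A matrix_inv_mat2 lorentz_transpose_spinor_map)
qed

lemma linear_spin_Ad: "linear (spin_Ad A)"
  using linear_compose[OF linear_mult_left[of "spinor_map A"] linear_mult_right[of "spinor_map (matrix_inv A)"]]
  by (simp add: o_def spin_Ad_def[abs_def])

lemma spin_Ad_zero [simp]: "spin_Ad A 0 = 0"
  by (rule linear_0[OF linear_spin_Ad])

lemma spin_Ad_mult:
  assumes "det A = 1" "det B = 1"
  shows "spin_Ad (A ** B) X = spin_Ad A (spin_Ad B X)"
proof -
  have "matrix_inv (A ** B) = matrix_inv B ** matrix_inv A"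
    using SL2_inv[OF assms(1)] SL2_inv[OF assms(2)]
    by (intro matrix_inv_eqI) (metis matrix_mul_assoc matrix_mul_rid)+
  then show ?thesis by (simp add: spin_Ad_def spinor_map_mult matrix_mul_assoc)
qed

lemma matrix_inv_one [simp]: "matrix_inv (mat 1 :: 'a::semiring_1 ^ 'n ^ 'n) = mat 1"
  by (rule matrix_inv_eqI) simp_all

lemma spin_Ad_one [simp]: "spin_Ad (mat 1) X = X"
  by (simp add: spin_Ad_def)

lemma spin_Ad_matrix_mult:
  assumes "det A = 1"
  shows "spin_Ad A (X ** Y) = spin_Ad A X ** spin_Ad A Y"
proof -
  have "spinor_map (matrix_inv A) ** spinor_map A = mat 1"
    using SL2_inv[OF assms] by (simp flip: spinor_map_mult)
  then have "spinor_map (matrix_inv A) ** (spinor_map A ** Z) = Z" for Z :: "real ^ 4 ^ 4"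
    by (simp add: matrix_mul_assoc)
  then show ?thesis by (simp add: spin_Ad_def flip: matrix_mul_assoc)
qed

lemma trace_spin_Ad:
  assumes "det A = 1"
  shows "trace (spin_Ad A X) = trace X"
proof -
  have "spinor_map (matrix_inv A) ** spinor_map A = mat 1"
    using SL2_inv[OF assms] by (simp flip: spinor_map_mult)
  moreover have "trace (spin_Ad A X) = trace (spinor_map (matrix_inv A) ** (spinor_map A ** X))"
    unfolding spin_Ad_def by (rule trace_mul_sym)
  ultimately show ?thesis by (simp add: matrix_mul_assoc)
qed

lemma lorentz_transpose_spin_Ad:
  assumes "det A = 1"
  shows "lorentz_transpose (spin_Ad A X) = spin_Ad A (lorentz_transpose X)"
proof -
  have "lorentz_transpose (spinor_map (matrix_inv A)) = spinor_map A"
    by (metis assms lorentz_transpose_lorentz_transpose lorentz_transpose_spinor)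
  then show ?thesis
    by (simp add: spin_Ad_def lorentz_transpose_mult lorentz_transpose_spinor[OF assms] matrix_mul_assoc)
qed

lemma spin_Ad_closed:
  assumes "det A = 1"
  shows "X \<in> frak_v \<Longrightarrow> spin_Ad A X \<in> frak_v" "X \<in> so31 \<Longrightarrow> spin_Ad A X \<in> so31"
    "X \<in> sl4 \<Longrightarrow> spin_Ad A X \<in> sl4"
  using assms by (auto simp: frak_v_iff so31_iff sl4_def lorentz_transpose_spin_Ad trace_spin_Ad
      linear_neg[OF linear_spin_Ad])

text \<open>The space \<open>frak_v\<close> is the tensor product of \<open>sl(2,C)\<close> with its complex conjugate, so a
  traceless \<open>h\<close> gives the element \<open>h \<otimes> h\<^sup>*\<close> of it. This turns questions on the action on these
  elements into computations with two-by-two matrices.\<close>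

lemma spinor_map_in_frak_v: "trace h = 0 \<Longrightarrow> spinor_map h \<in> frak_v"
proof -
  assume "trace h = 0"
  obtain a b c d where h: "h = mat2 a b c d" using mat2_cases by blast
  have "d = - a" using \<open>trace h = 0\<close> by (simp add: h eq_neg_iff_add_eq_0 add.commute)
  then have "lorentz_transpose (spinor_map h) = spinor_map (- h)"
    by (simp add: h lorentz_transpose_spinor_map)
  then show ?thesis using \<open>trace h = 0\<close> by (simp add: frak_v_iff trace_spinor_map)
qed

lemma spin_Ad_spinor_map: "spin_Ad A (spinor_map h) = spinor_map (A ** h ** matrix_inv A)"
  by (simp add: spin_Ad_def spinor_map_mult)

text \<open>The differential of the spinor map at the identity, an isomorphism of \<open>sl(2,C)\<close> onto
  \<open>so(3,1)\<close>, and its inverse.\<close>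

definition spinor_deriv :: "complex ^ 2 ^ 2 \<Rightarrow> real ^ 4 ^ 4" where
  "spinor_deriv X = matrix (\<lambda>s. hermitian_coords (X ** hermitian s + hermitian s ** ctranspose X))"

definition sl2_of_so31 :: "real ^ 4 ^ 4 \<Rightarrow> complex ^ 2 ^ 2" where
  "sl2_of_so31 Z =
    (let a = Complex (Z $ 3 $ 4 / 2) (- Z $ 1 $ 2 / 2)
     in mat2 a (Complex ((Z $ 1 $ 4 - Z $ 1 $ 3) / 2) ((Z $ 2 $ 4 - Z $ 2 $ 3) / 2))
          (Complex ((Z $ 1 $ 4 + Z $ 1 $ 3) / 2) (- (Z $ 2 $ 3 + Z $ 2 $ 4) / 2)) (- a))"

lemma spinor_deriv_works:
  "spinor_deriv X *v s = hermitian_coords (X ** hermitian s + hermitian s ** ctranspose X)"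
proof -
  have "linear (\<lambda>s. hermitian_coords (X ** hermitian s + hermitian s ** ctranspose X))"
    using linear_compose[OF linear_compose_add[OF linear_compose[OF linear_hermitian linear_mult_left[of X]]
        linear_compose[OF linear_hermitian linear_mult_right[of "ctranspose X"]]] linear_hermitian_coords]
    by (simp add: o_def)
  then show ?thesis
    unfolding spinor_deriv_def by (intro matrix_works) (simp add: linear_matrix_vector_mul_eq)
qed

lemma spinor_deriv_nth: "spinor_deriv X $ i $ j =
    hermitian_coords (X ** hermitian (axis j 1) + hermitian (axis j 1) ** ctranspose X) $ i"
  using spinor_deriv_works[of X "axis j 1"] by (metis matrix_vector_mult_basis column_def vec_lambda_beta)

lemma ctranspose_add: "ctranspose (A + B) = ctranspose A + ctranspose B"
  by (simp add: ctranspose_def vec_eq_iff)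

lemma hermitian_spinor_deriv:
  "hermitian (spinor_deriv X *v s) = X ** hermitian s + hermitian s ** ctranspose X"
  unfolding spinor_deriv_works
  by (rule hermitian_hermitian_coords) (simp add: ctranspose_add ctranspose_mult add.commute)

lemma spin_Ad_spinor_deriv:
  assumes "det A = 1"
  shows "spin_Ad A (spinor_deriv X) = spinor_deriv (A ** X ** matrix_inv A)"
  unfolding matrix_eq
proof (intro allI hermitian_inject)
  fix s
  define B where "B = matrix_inv A"
  have AB: "A ** B = mat 1" "B ** A = mat 1" using SL2_inv[OF assms] by (simp_all add: B_def)
  have BA: "ctranspose B ** ctranspose A = mat 1"
    using arg_cong[OF AB(1), of ctranspose] by (simp add: ctranspose_mult mat_eq_mat2)
  have "hermitian (spin_Ad A (spinor_deriv X) *v s) =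
      A ** (X ** (B ** hermitian s ** ctranspose B) + (B ** hermitian s ** ctranspose B) ** ctranspose X) ** ctranspose A"
    by (simp add: spin_Ad_def B_def hermitian_spinor_map hermitian_spinor_deriv flip: matrix_vector_mul_assoc)
  also have "\<dots> = A ** X ** B ** hermitian s ** (ctranspose B ** ctranspose A) +
      (A ** B) ** hermitian s ** ctranspose (A ** X ** B)"
    by (simp add: matrix_linear matrix_mul_assoc ctranspose_mult)
  also have "\<dots> = hermitian (spinor_deriv (A ** X ** B) *v s)"
    by (simp add: AB BA hermitian_spinor_deriv)
  finally show "hermitian (spin_Ad A (spinor_deriv X) *v s) = hermitian (spinor_deriv (A ** X ** matrix_inv A) *v s)"
    by (simp add: B_def)
qed

lemma sl2_of_so31_spinor_deriv: "trace X = 0 \<Longrightarrow> sl2_of_so31 (spinor_deriv X) = X"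
proof -
  assume "trace X = 0"
  obtain a b c d where X: "X = mat2 a b c d" using mat2_cases by blast
  have "d = - a" using \<open>trace X = 0\<close> by (simp add: X eq_neg_iff_add_eq_0 add.commute)
  then show ?thesis
    by (simp add: X sl2_of_so31_def Let_def spinor_deriv_nth complex_eq_iff)
qed

lemma spinor_deriv_sl2_of_so31: "Z \<in> so31 \<Longrightarrow> spinor_deriv (sl2_of_so31 Z) = Z"
proof -
  assume "Z \<in> so31"
  then have "lorentz_transpose Z $ i $ j = - Z $ i $ j" for i j by (simp add: so31_iff)
  then have Z: "Z $ 1 $ 1 = 0" "Z $ 2 $ 2 = 0" "Z $ 3 $ 3 = 0" "Z $ 4 $ 4 = 0"
    "Z $ 2 $ 1 = - Z $ 1 $ 2" "Z $ 3 $ 1 = - Z $ 1 $ 3" "Z $ 3 $ 2 = - Z $ 2 $ 3"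
    "Z $ 4 $ 1 = Z $ 1 $ 4" "Z $ 4 $ 2 = Z $ 2 $ 4" "Z $ 4 $ 3 = Z $ 3 $ 4"
  proof -
    note * = \<open>\<And>j i. lorentz_transpose Z $ i $ j = - Z $ i $ j\<close>[unfolded lorentz_transpose_nth]
    show "Z $ 1 $ 1 = 0" "Z $ 2 $ 2 = 0" "Z $ 3 $ 3 = 0" "Z $ 4 $ 4 = 0"
      "Z $ 2 $ 1 = - Z $ 1 $ 2" "Z $ 3 $ 1 = - Z $ 1 $ 3" "Z $ 3 $ 2 = - Z $ 2 $ 3"
      "Z $ 4 $ 1 = Z $ 1 $ 4" "Z $ 4 $ 2 = Z $ 2 $ 4" "Z $ 4 $ 3 = Z $ 3 $ 4"
      using *[of 1 1] *[of 2 2] *[of 3 3] *[of 4 4] *[of 1 2] *[of 1 3] *[of 2 3] *[of 1 4] *[of 2 4] *[of 3 4]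
      by simp_all
  qed
  show ?thesis
    by (simp add: vec_eq_iff forall_4 sl2_of_so31_def Let_def spinor_deriv_nth Z field_simps)
qed

lemma trace_sl2_of_so31 [simp]: "trace (sl2_of_so31 Z) = 0"
  by (simp add: sl2_of_so31_def Let_def)

lemma sl2_of_so31_add: "sl2_of_so31 (Z + Z') = sl2_of_so31 Z + sl2_of_so31 Z'"
  by (simp add: sl2_of_so31_def Let_def complex_eq_iff field_simps)

lemma spinor_deriv_diff: "spinor_deriv (X - Y) = spinor_deriv X - spinor_deriv Y"
proof -
  obtain a b c d where X: "X = mat2 a b c d" using mat2_cases by blast
  obtain a' b' c' d' where Y: "Y = mat2 a' b' c' d'" using mat2_cases by blast
  show ?thesis
    by (simp add: X Y vec_eq_iff forall_4 spinor_deriv_nth add_divide_distrib diff_divide_distrib)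
qed

lemma spinor_deriv_in_so31: "trace X = 0 \<Longrightarrow> spinor_deriv X \<in> so31"
proof -
  assume "trace X = 0"
  obtain a b c d where X: "X = mat2 a b c d" using mat2_cases by blast
  have "d = - a" using \<open>trace X = 0\<close> by (simp add: X eq_neg_iff_add_eq_0 add.commute)
  then show ?thesis
    by (simp add: X so31_iff vec_eq_iff forall_4 lorentz_transpose_nth spinor_deriv_nth
        add_divide_distrib diff_divide_distrib)
qed

text \<open>Equivariance turns cocycles with values in \<open>so(3,1)\<close> into cocycles with values in \<open>sl(2,C)\<close>.\<close>

lemma sl2_of_so31_spin_Ad:
  assumes "det A = 1" "Z \<in> so31"
  shows "sl2_of_so31 (spin_Ad A Z) = A ** sl2_of_so31 Z ** matrix_inv A"
proof -
  have "trace (A ** sl2_of_so31 Z ** matrix_inv A) = 0"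
    using SL2_inv[OF assms(1)] trace_mul_sym[of "A ** sl2_of_so31 Z" "matrix_inv A"]
    by (simp add: matrix_mul_assoc)
  then show ?thesis
    by (metis assms spin_Ad_spinor_deriv spinor_deriv_sl2_of_so31 sl2_of_so31_spinor_deriv)
qed

section \<open>The representations of the figure-eight knot group\<close>

lemma eval_word_append: "eval_word \<rho> (u @ w) = eval_word \<rho> u ** eval_word \<rho> w"
  by (induction \<rho> u rule: eval_word.induct) (simp_all add: matrix_mul_assoc)

lemma det_eval_word: "(\<And>g. det (\<rho> g) = 1) \<Longrightarrow> det (eval_word \<rho> w) = 1"
  by (induction \<rho> w rule: eval_word.induct) (auto simp: det_mul SL2_inv)

lemma eval_word_inv_word:
  assumes "\<And>g. det (\<rho> g) = 1"
  shows "eval_word \<rho> (inv_word w) = matrix_inv (eval_word \<rho> w)"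
proof -
  have *: "eval_word \<rho> w ** eval_word \<rho> (inv_word w) = mat 1" for w
  proof (induction w)
    case (Cons l w)
    obtain g e where l: "l = (g, e)" by fastforce
    have "eval_word \<rho> (l # w) ** eval_word \<rho> (inv_word (l # w)) =
        eval_word \<rho> [l] ** (eval_word \<rho> w ** eval_word \<rho> (inv_word w)) ** eval_word \<rho> [(g, \<not> e)]"
      using eval_word_append[of \<rho> "[l]" w] by (simp only: l inv_word_simps eval_word_append append_Cons append_Nil matrix_mul_assoc)
    then show ?case using Cons.IH SL2_inv[OF assms, of g] by (simp add: l)
  qed simp
  show ?thesis
    using *[of w] *[of "inv_word w"] by (simp add: matrix_inv_eqI)
qed

text \<open>Freeing the eigenvalue \<open>m = exp(u/2)\<close> and its inverse \<open>n\<close> from \<open>u\<close> makes the entries of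
  all matrices polynomial.\<close>

fun fig8_gen :: "complex \<Rightarrow> complex \<Rightarrow> complex \<Rightarrow> gen \<Rightarrow> complex ^ 2 ^ 2" where
  "fig8_gen m n \<zeta> GX = mat2 n (- n) 0 m"
| "fig8_gen m n \<zeta> GY = mat2 m 0 (- \<zeta> * n) n"

lemma rho_gen_eq_fig8_gen: "rho_gen u \<zeta> = fig8_gen (exp (u / 2)) (exp (- u / 2)) \<zeta>"
proof
  fix g
  show "rho_gen u \<zeta> g = fig8_gen (exp (u / 2)) (exp (- u / 2)) \<zeta> g"
    by (cases g) (simp_all add: mat2_def)
qed

text \<open>The Riley polynomial of the figure-eight knot: it vanishes where the matrices above satisfy
  the relation of the knot group. Here \<open>k = m\<^sup>2\<close>.\<close>

definition riley :: "complex \<Rightarrow> complex \<Rightarrow> complex" where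
  "riley k \<zeta> = \<zeta>\<^sup>2 + (k - 1 - k\<^sup>2) * \<zeta> + k\<^sup>2"

context
  fixes m n \<zeta> :: complex
  assumes mn: "m * n = 1"
begin

lemma det_fig8_gen: "det (fig8_gen m n \<zeta> g) = 1"
  using mn by (cases g) (simp_all add: mult.commute)

lemma fig8_word_b:
  "eval_word (fig8_gen m n \<zeta>) word_b = mat2 (n\<^sup>2 * (1 - \<zeta>)) (- 1) \<zeta> (m\<^sup>2)"
proof -
  have "eval_word (fig8_gen m n \<zeta>) word_b = mat2 n (- n) 0 m ** mat2 n 0 (\<zeta> * n) m"
    using mn by (simp add: word_b_def word_x_def word_y_def inv_word_def matrix_inv_mat2 mult.commute)
  also have "\<dots> = mat2 (n\<^sup>2 * (1 - \<zeta>)) (- 1) \<zeta> (m\<^sup>2)"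
    using mn by (simp add: power2_eq_square algebra_simps)
  finally show ?thesis .
qed

lemma cancel_mn: "m * (n * c) = c"
  using mn by (metis mult.assoc mult_1)

lemmas mn_simps = mn cancel_mn algebra_simps eval_nat_numeral

lemma fig8_word_a:
  "eval_word (fig8_gen m n \<zeta>) word_a =
    mat2 (1 - \<zeta> - n ^ 4 * \<zeta> + n ^ 4 * \<zeta> ^ 2 + n ^ 2 * \<zeta>) (n ^ 4 - n ^ 4 * \<zeta> - n ^ 2)
      (m ^ 2 * \<zeta> - n ^ 2 * \<zeta> ^ 2 - \<zeta>) (n ^ 2 * \<zeta> + 1)"
proof -
  have "word_a = word_b @ [(GX, False), (GY, True)]"
    by (simp add: word_a_def word_b_def word_x_def word_y_def inv_word_def)
  then have "eval_word (fig8_gen m n \<zeta>) word_a =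
      eval_word (fig8_gen m n \<zeta>) word_b ** eval_word (fig8_gen m n \<zeta>) [(GX, False), (GY, True)]"
    by (metis eval_word_append)
  also have "\<dots> = mat2 (n\<^sup>2 * (1 - \<zeta>)) (- 1) \<zeta> (m\<^sup>2) ** (mat2 m n 0 n ** mat2 m 0 (- \<zeta> * n) n)"
    using mn by (simp add: fig8_word_b matrix_inv_mat2 mult.commute)
  also have "\<dots> = mat2 (1 - \<zeta> - n ^ 4 * \<zeta> + n ^ 4 * \<zeta> ^ 2 + n ^ 2 * \<zeta>) (n ^ 4 - n ^ 4 * \<zeta> - n ^ 2)
      (m ^ 2 * \<zeta> - n ^ 2 * \<zeta> ^ 2 - \<zeta>) (n ^ 2 * \<zeta> + 1)"
    by (simp add: mn_simps)
  finally show ?thesis .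
qed

text \<open>The cofactors of the Riley polynomial come from polynomial division in \<open>\<zeta>\<close>, modulo \<open>m n = 1\<close>.
  They are needed explicitly, because rigidity of the hyperbolic structure is proved by
  differentiating these identities at zeros of the Riley polynomial.\<close>

lemma fig8_relation:
  "eval_word (fig8_gen m n \<zeta>) (word_a @ word_x) - eval_word (fig8_gen m n \<zeta>) (word_y @ word_a) =
    mat2 (riley (m\<^sup>2) \<zeta> * (n ^ 5 - n ^ 3)) (riley (m\<^sup>2) \<zeta> * (- (n ^ 5)))
      (riley (m\<^sup>2) \<zeta> * (n ^ 5 * \<zeta>)) (riley (m\<^sup>2) \<zeta> * (n ^ 3 - n ^ 5))"
  unfolding eval_word_append fig8_word_a riley_def word_x_def word_y_def
  by (simp add: mn_simps)

lemma fig8_longitude: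
  shows fig8_longitude_11: "(1 - \<zeta>)\<^sup>2 * eval_word (fig8_gen m n \<zeta>) word_l $ 1 $ 1 =
    \<zeta> + riley (m\<^sup>2) \<zeta> * (n ^ 6 * \<zeta> ^ 3 + n ^ 4 * \<zeta> ^ 3 + n\<^sup>2 * \<zeta>\<^sup>2 - 2 * n ^ 6 * \<zeta>\<^sup>2 - \<zeta>\<^sup>2 + n ^ 6 * \<zeta>
      - 2 * n ^ 4 * \<zeta> + \<zeta> - 2 * n\<^sup>2 * \<zeta> + n ^ 4)" (is "_ = ?r1")
  and fig8_longitude_21: "eval_word (fig8_gen m n \<zeta>) word_l $ 2 $ 1 = riley (m\<^sup>2) \<zeta> *
    (n ^ 8 * \<zeta> - n ^ 8 * \<zeta>\<^sup>2 - n ^ 6 * \<zeta>\<^sup>2 - n ^ 4 * \<zeta> - n ^ 6 * \<zeta> + n\<^sup>2 * \<zeta>)" (is "_ = ?r2")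
proof -
  let ?E = "eval_word (fig8_gen m n \<zeta>)"
  have det: "det (?E w) = 1" for w by (rule det_eval_word) (rule det_fig8_gen)
  have inv: "?E (inv_word w) = matrix_inv (?E w)" for w
    by (rule eval_word_inv_word) (rule det_fig8_gen)
  have b: "?E (inv_word word_b) = mat2 (m ^ 2) 1 (- \<zeta>) (n ^ 2 * (1 - \<zeta>))"
    using det[of word_b] by (simp add: inv fig8_word_b matrix_inv_mat2)
  have a: "?E (inv_word word_a) = mat2 (n ^ 2 * \<zeta> + 1) (- (n ^ 4 - n ^ 4 * \<zeta> - n ^ 2))
      (- (m ^ 2 * \<zeta> - n ^ 2 * \<zeta> ^ 2 - \<zeta>)) (1 - \<zeta> - n ^ 4 * \<zeta> + n ^ 4 * \<zeta> ^ 2 + n ^ 2 * \<zeta>)"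
    using det[of word_a] unfolding inv fig8_word_a by (subst matrix_inv_mat2) simp_all
  have BA: "?E (inv_word word_b) ** ?E (inv_word word_a) =
    mat2 (n ^ 2 * \<zeta> ^ 2 + 2 * \<zeta> + m ^ 2 - m ^ 2 * \<zeta>)
      (- (n ^ 4 * \<zeta>) + n ^ 4 * \<zeta> ^ 2 - n ^ 2 + 2 * n ^ 2 * \<zeta> + 2 - \<zeta>)
      (n ^ 4 * \<zeta> ^ 2 - n ^ 4 * \<zeta> ^ 3 + n ^ 2 * \<zeta> - 2 * n ^ 2 * \<zeta> ^ 2 - 2 * \<zeta> + \<zeta> ^ 2)
      (- (n ^ 6 * \<zeta>) + 2 * n ^ 6 * \<zeta> ^ 2 - n ^ 6 * \<zeta> ^ 3 + 2 * n ^ 4 * \<zeta> - 2 * n ^ 4 * \<zeta> ^ 2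
        + n ^ 2 - 3 * n ^ 2 * \<zeta> + n ^ 2 * \<zeta> ^ 2)"
    unfolding a b by (simp add: mn_simps)
  have ba: "?E word_b ** ?E word_a =
    mat2 (- (n ^ 6 * \<zeta>) + 2 * n ^ 6 * \<zeta> ^ 2 - n ^ 6 * \<zeta> ^ 3 + n ^ 4 * \<zeta> - n ^ 4 * \<zeta> ^ 2
        + n ^ 2 - 2 * n ^ 2 * \<zeta> + 2 * n ^ 2 * \<zeta> ^ 2 + \<zeta> - m ^ 2 * \<zeta>)
      (n ^ 6 - 2 * n ^ 6 * \<zeta> + n ^ 6 * \<zeta> ^ 2 - n ^ 4 + n ^ 4 * \<zeta> - n ^ 2 * \<zeta> - 1)
      (- (n ^ 4 * \<zeta> ^ 2) + n ^ 4 * \<zeta> ^ 3 + n ^ 2 * \<zeta> ^ 2 + \<zeta> - 2 * \<zeta> ^ 2 - m ^ 2 * \<zeta> + m ^ 4 * \<zeta>)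
      (n ^ 4 * \<zeta> - n ^ 4 * \<zeta> ^ 2 - n ^ 2 * \<zeta> + \<zeta> + m ^ 2)"
    unfolding fig8_word_a fig8_word_b by (simp add: mn_simps)
  have l: "?E word_l = (?E (inv_word word_b) ** ?E (inv_word word_a)) ** (?E word_b ** ?E word_a)"
    by (simp add: word_l_def eval_word_append matrix_mul_assoc)
  have l11: "?E word_l $ 1 $ 1 = - (n ^ 6 * \<zeta> ^ 2) + n ^ 6 * \<zeta> ^ 3 - n ^ 4 * \<zeta> + 2 * n ^ 4 * \<zeta> ^ 2 + n ^ 4 * \<zeta> ^ 3 + 2 * n ^ 2 * \<zeta> + n ^ 2 * \<zeta> ^ 2 + 1 - 2 * \<zeta> ^ 2 - 2 * m ^ 2 * \<zeta> + m ^ 4 * \<zeta>"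
    unfolding l BA ba by (simp add: mn_simps)
  have l21: "?E word_l $ 2 $ 1 = - (n ^ 8 * \<zeta> ^ 2) + 2 * n ^ 8 * \<zeta> ^ 3 - n ^ 8 * \<zeta> ^ 4 + 2 * n ^ 6 * \<zeta> ^ 2 - n ^ 6 * \<zeta> ^ 3 - n ^ 6 * \<zeta> ^ 4 + n ^ 4 * \<zeta> - 2 * n ^ 4 * \<zeta> ^ 2 - n ^ 4 * \<zeta> ^ 3 - n ^ 2 * \<zeta> - 2 * n ^ 2 * \<zeta> ^ 2 + 2 * n ^ 2 * \<zeta> ^ 3 - \<zeta> + 2 * \<zeta> ^ 2 + m ^ 2 * \<zeta> - m ^ 2 * \<zeta> ^ 2"
    unfolding l BA ba by (simp add: mn_simps)
  show "(1 - \<zeta>)\<^sup>2 * ?E word_l $ 1 $ 1 = ?r1"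
    unfolding l11 riley_def by (simp add: mn_simps)
  show "?E word_l $ 2 $ 1 = ?r2"
    unfolding l21 riley_def by (simp add: mn_simps)
qed

end

lemmas fig8_words = word_w_def word_l_def word_a_def word_b_def word_x_def word_y_def

text \<open>The torus relation, which expresses that meridian and longitude commute, is a product of a
  conjugate of the relator and a conjugate of its inverse. In homological terms, it is the image of
  the fundamental class of the boundary torus in the presentation complex.\<close>

lemma torus_relation:
  "pres_eq R (word_l @ word_x @ inv_word word_l @ inv_word word_x)
    ((inv_word word_b @ inv_word word_a @ word_b) @ word_w @ inv_word (inv_word word_b @ inv_word word_a @ word_b) @
     (inv_word word_b @ inv_word word_a) @ inv_word word_w @ inv_word (inv_word word_b @ inv_word word_a))"
  by (rule pres_eq_if_reduce_eq) (simp add: fig8_words)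

text \<open>Evaluating a derivation on both sides of the torus relation compares its value on the relator
  with its values on the peripheral elements. This is a cochain form of duality between the knot
  complement and its boundary.\<close>

lemma torus_derivation:
  fixes \<beta> :: "gen word \<Rightarrow> 'b::real_vector \<Rightarrow> 'b"
  assumes "word_action \<beta>" and w: "\<And>m. \<beta> word_w m = m"
  shows "\<beta> (inv_word word_b @ inv_word word_a @ word_b) (word_deriv \<beta> X word_w)
      - \<beta> (inv_word word_b @ inv_word word_a) (word_deriv \<beta> X word_w) =
    (word_deriv \<beta> X word_l - \<beta> word_x (word_deriv \<beta> X word_l))
      + (\<beta> word_l (word_deriv \<beta> X word_x) - word_deriv \<beta> X word_x)"
    (is "\<beta> ?g _ - \<beta> ?h _ = _")
    and "\<beta> word_l (\<beta> word_x m) = \<beta> word_x (\<beta> word_l m)"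
proof -
  interpret B: word_action \<beta> by fact
  let ?F = "word_deriv \<beta> X"
  let ?c = "word_l @ word_x @ inv_word word_l @ inv_word word_x"
  let ?r = "?g @ word_w @ inv_word ?g @ ?h @ inv_word word_w @ inv_word ?h"
  have w': "\<beta> (inv_word word_w) m = m" for m using B.inv_left[of word_w m] w by simp
  have inv: "\<beta> u (\<beta> (inv_word u) m) = m" for u m by (rule B.inv_right)
  have r: "\<beta> ?r m = m" for m
    using inv[of ?g] inv[of ?h] by (simp only: B.append w w')
  have c: "\<beta> ?c m = m" for m
    using B.pres_eq_imp_action_eq[OF torus_relation[of "{}"]] r by simp
  have cl: "\<beta> word_l (\<beta> word_x m) = \<beta> word_x (\<beta> word_l m)" for m
    using c[of "\<beta> word_x (\<beta> word_l m)"] by (simp only: B.append B.inv_left)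
  then show "\<beta> word_l (\<beta> word_x m) = \<beta> word_x (\<beta> word_l m)" .
  have "?F ?c = ?F ?r"
    using B.pres_eq_imp_word_deriv_eq[OF torus_relation[of "{}"]] by simp
  moreover have "?F ?r = \<beta> ?g (?F word_w) - \<beta> ?h (?F word_w)"
  proof -
    have "?F (u @ word_w @ inv_word u @ v) = \<beta> u (?F word_w) + ?F v" for u v
      by (simp add: B.word_deriv_append B.word_deriv_inv_word B.add B.diff B.neg w)
    moreover have "?F (u @ inv_word word_w @ inv_word u) = - \<beta> u (?F word_w)" for u
      by (simp add: B.word_deriv_append B.word_deriv_inv_word B.add B.diff B.neg w')
    ultimately show ?thesis by (metis diff_conv_add_uminus)
  qed
  moreover have "?F ?c = (?F word_l - \<beta> word_x (?F word_l)) + (\<beta> word_l (?F word_x) - ?F word_x)"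
  proof -
    have "?F ?c = ?F word_l + \<beta> word_l (?F word_x + \<beta> word_x (- \<beta> (inv_word word_l) (?F word_l)
        + \<beta> (inv_word word_l) (- \<beta> (inv_word word_x) (?F word_x))))"
      by (simp add: B.word_deriv_append B.word_deriv_inv_word)
    also have "\<dots> = ?F word_l + \<beta> word_l (?F word_x) - \<beta> word_x (?F word_l) - ?F word_x"
      by (simp add: B.add B.diff B.neg cl)
    finally show ?thesis by simp
  qed
  ultimately show "\<beta> ?g (?F word_w) - \<beta> ?h (?F word_w) =
      (?F word_l - \<beta> word_x (?F word_l)) + (\<beta> word_l (?F word_x) - ?F word_x)" by simp
qed

lemma eval_word_cancel:
  assumes "\<And>g. det (\<rho> g) = 1"
  shows "eval_word \<rho> [(g, e)] ** eval_word \<rho> [(g, \<not> e)] = mat 1"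
  using SL2_inv[OF assms] by simp

lemma word_action_spin_Ad:
  assumes det: "\<And>g. det (\<rho> g) = 1"
  shows "word_action (\<lambda>w. spin_Ad (eval_word \<rho> w))"
proof (rule word_action.intro)
  have d: "det (eval_word \<rho> w) = 1" for w by (rule det_eval_word) (rule det)
  show "linear (spin_Ad (eval_word \<rho> w))" for w by (rule linear_spin_Ad)
  show "spin_Ad (eval_word \<rho> []) m = m" for m by simp
  show "spin_Ad (eval_word \<rho> (u @ w)) m = spin_Ad (eval_word \<rho> u) (spin_Ad (eval_word \<rho> w) m)" for u w m
    by (simp add: eval_word_append spin_Ad_mult d)
  show "spin_Ad (eval_word \<rho> [(g, e)]) (spin_Ad (eval_word \<rho> [(g, \<not> e)]) m) = m" for g e m
    using eval_word_cancel[of \<rho> g e, OF det] spin_Ad_mult[OF d d, of "[(g, e)]" "[(g, \<not> e)]" m]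
    by (metis spin_Ad_one)
qed

definition conj2 :: "complex ^ 2 ^ 2 \<Rightarrow> complex ^ 2 ^ 2 \<Rightarrow> complex ^ 2 ^ 2" where
  "conj2 A X = A ** X ** matrix_inv A"

lemma matrix_inv_mult:
  fixes A B :: "complex ^ 2 ^ 2"
  assumes "det A = 1" "det B = 1"
  shows "matrix_inv (A ** B) = matrix_inv B ** matrix_inv A"
  using SL2_inv[OF assms(1)] SL2_inv[OF assms(2)]
  by (intro matrix_inv_eqI) (metis matrix_mul_assoc matrix_mul_rid)+

lemma word_action_conj2:
  assumes det: "\<And>g. det (\<rho> g) = 1"
  shows "word_action (\<lambda>w. conj2 (eval_word \<rho> w))"
proof (rule word_action.intro)
  have d: "det (eval_word \<rho> w) = 1" for w by (rule det_eval_word) (rule det)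
  show "linear (conj2 (eval_word \<rho> w))" for w
    by (rule linearI) (simp_all add: conj2_def matrix_linear)
  show "conj2 (eval_word \<rho> []) m = m" for m by (simp add: conj2_def)
  have m: "conj2 (eval_word \<rho> (u @ w)) m = conj2 (eval_word \<rho> u) (conj2 (eval_word \<rho> w) m)" for u w m
    by (simp add: eval_word_append conj2_def matrix_inv_mult d matrix_mul_assoc)
  then show "conj2 (eval_word \<rho> (u @ w)) m = conj2 (eval_word \<rho> u) (conj2 (eval_word \<rho> w) m)" for u w m .
  show "conj2 (eval_word \<rho> [(g, e)]) (conj2 (eval_word \<rho> [(g, \<not> e)]) m) = m" for g e m
    using eval_word_cancel[of \<rho> g e, OF det] m[of "[(g, e)]" "[(g, \<not> e)]" m]
    by (simp only: eval_word_append) (simp add: conj2_def)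
qed

lemma det_rho_gen: "det (rho_gen u \<zeta> g) = 1"
  unfolding rho_gen_eq_fig8_gen by (rule det_fig8_gen) (simp flip: exp_add)

section \<open>Cocycles of the figure-eight knot group and its fillings\<close>

text \<open>Relators are only asked to act trivially on the Lorentz space: the relator of a filling may lift
  to \<open>- 1\<close> in \<open>SL(2,C)\<close>.\<close>

locale fig8_rep =
  fixes u \<zeta> :: complex and R :: "gen word set"
  assumes relators: "\<And>r. r \<in> R \<Longrightarrow> spinor_map (eval_word (rho_gen u \<zeta>) r) = mat 1"
begin

abbreviation E :: "gen word \<Rightarrow> complex ^ 2 ^ 2" where "E \<equiv> eval_word (rho_gen u \<zeta>)"
abbreviation act :: "gen word \<Rightarrow> real ^ 4 ^ 4 \<Rightarrow> real ^ 4 ^ 4" where "act w \<equiv> spin_Ad (E w)"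

lemma det_E: "det (E w) = 1"
  by (rule det_eval_word) (rule det_rho_gen)

sublocale act: word_action act
  by (rule word_action_spin_Ad) (rule det_rho_gen)

lemma act_relator: "r \<in> R \<Longrightarrow> act r m = m"
proof -
  assume "r \<in> R"
  then have "spinor_map (E r) = mat 1" by (rule relators)
  moreover from this have "spinor_map (matrix_inv (E r)) = mat 1"
    using matrix_inv_spinor_map[OF det_E, of r] by simp
  ultimately show ?thesis by (simp add: spin_Ad_def)
qed

lemma pres_eq_imp_spinor_eq: "pres_eq R v w \<Longrightarrow> spinor_map (E v) = spinor_map (E w)"
proof (induction rule: pres_eq.induct)
  case (cancel g e)
  have "E [(g, e), (g, \<not> e)] = E [(g, e)] ** E [(g, \<not> e)]"
    using eval_word_append[of _ "[(g, e)]"] by simp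
  then show ?case using eval_word_cancel[of "rho_gen u \<zeta>", OF det_rho_gen] by simp
qed (auto simp: relators eval_word_append spinor_map_mult)

lemma rho_word_class: "rho u \<zeta> (word_class R w) = spinor_map (E w)"
proof -
  have "(\<lambda>w. spinor_map (E w)) ` word_class R w = {spinor_map (E w)}"
  proof -
    have "spinor_map (E v) = spinor_map (E w)" if "v \<in> word_class R w" for v
      using that pres_eq_imp_spinor_eq[of w v] by (simp add: word_class_def)
    moreover have "w \<in> word_class R w" by (simp add: word_class_def pres_eq.refl)
    ultimately show ?thesis by blast
  qed
  then show ?thesis by (simp add: rho_def)
qed

lemma Ad_word_class: "Ad (rho u \<zeta>) (word_class R w) X = act w X"
  by (simp add: Ad_def spin_Ad_def rho_word_class matrix_inv_spinor_map det_E)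

definition invariant :: "(real ^ 4 ^ 4) set \<Rightarrow> bool" where
  "invariant V \<longleftrightarrow> subspace V \<and> (\<forall>A X. det A = 1 \<longrightarrow> X \<in> V \<longrightarrow> spin_Ad A X \<in> V)"

lemma invariant_frak_v: "invariant frak_v" and invariant_so31: "invariant so31"
  and invariant_sl4: "invariant sl4"
  by (auto simp: invariant_def subspace_frak_v subspace_so31 subspace_sl4 spin_Ad_closed)

lemma group_rep: "invariant V \<Longrightarrow> group_rep (presented_group R) (Ad (rho u \<zeta>)) V"
proof (intro group_rep.intro group_rep_axioms.intro group_presented_group)
  assume V: "invariant V"
  then show "subspace V" by (simp add: invariant_def)
  have Ad: "Ad (rho u \<zeta>) (word_class R w) = act w" for w using Ad_word_class by blast
  show "linear (Ad (rho u \<zeta>) g)" if "g \<in> carrier (presented_group R)" for g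
    using that by (auto simp: Ad act.linear)
  show "Ad (rho u \<zeta>) \<one>\<^bsub>presented_group R\<^esub> m = m" for m
    using Ad_word_class[of "[]"] by simp
  show "Ad (rho u \<zeta>) (g \<otimes>\<^bsub>presented_group R\<^esub> h) m = Ad (rho u \<zeta>) g (Ad (rho u \<zeta>) h m)"
    if "g \<in> carrier (presented_group R)" "h \<in> carrier (presented_group R)" for g h m
    using that by (auto simp: Ad)
  show "Ad (rho u \<zeta>) g m \<in> V" if "g \<in> carrier (presented_group R)" "m \<in> V" for g m
    using that V det_E by (auto simp: Ad invariant_def)
qed

text \<open>Cocycles of the presented group are the derivations of the free group that vanish on the
  relators.\<close>

lemma Z1_word_class:
  assumes V: "invariant V" and f: "f \<in> Z1 (presented_group R) (Ad (rho u \<zeta>)) V"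
  shows "f (word_class R w) = word_deriv act (\<lambda>g. f (word_class R [(g, True)])) w"
proof -
  interpret group_rep "presented_group R" "Ad (rho u \<zeta>)" V by (rule group_rep[OF V])
  have m: "f (word_class R (v @ w)) = f (word_class R v) + act v (f (word_class R w))" for v w
    using Z1_mult[OF f, of "word_class R v" "word_class R w"] by (simp add: Ad_word_class)
  have "f (word_class R [(g, e), (g, \<not> e)]) = 0" for g e
  proof -
    have "word_class R [(g, e), (g, \<not> e)] = word_class R []"
      unfolding word_class_eq_iff by (rule pres_eq.cancel)
    then show ?thesis using Z1_one[OF f] by simp
  qed
  then show ?thesis
    using act.derivation_eq_word_deriv[of "\<lambda>w. f (word_class R w)" w] m by blast
qed

lemma Z1_from_word_deriv:
  assumes V: "invariant V" and X: "\<And>g. X g \<in> V"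
    and rel: "\<And>r. r \<in> R \<Longrightarrow> word_deriv act X r = 0"
  obtains f where "f \<in> Z1 (presented_group R) (Ad (rho u \<zeta>)) V"
    and "\<And>w. f (word_class R w) = word_deriv act X w"
proof
  interpret group_rep "presented_group R" "Ad (rho u \<zeta>)" V by (rule group_rep[OF V])
  define f where "f = (\<lambda>C\<in>carrier (presented_group R). word_deriv act X (SOME w. w \<in> C))"
  have closed: "word_deriv act X w \<in> V" for w
  proof (induction w)
    case (Cons l w)
    obtain g e where l: "l = (g, e)" by fastforce
    have "act [(g, e)] m \<in> V" if "m \<in> V" for m
      using that V det_E[of "[(g, e)]"] unfolding invariant_def by blast
    then show ?case
      using Cons.IH X subspace_add[OF subspace] subspace_diff[OF subspace] by (auto simp: l)
  qed (simp add: subspace_0[OF subspace])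
  show *: "f (word_class R w) = word_deriv act X w" for w
  proof -
    have "(SOME w'. w' \<in> word_class R w) \<in> word_class R w"
      by (rule someI[of _ w]) (simp add: word_class_def pres_eq.refl)
    then have "pres_eq R w (SOME w'. w' \<in> word_class R w)" by (simp add: word_class_def)
    then show ?thesis
      using act.pres_eq_imp_word_deriv_eq[of R w] act_relator rel by (simp add: f_def)
  qed
  show "f \<in> Z1 (presented_group R) (Ad (rho u \<zeta>)) V"
    unfolding Z1_iff
  proof (intro conjI ballI)
    show "f \<in> extensional (carrier (presented_group R))" by (simp add: f_def)
    show "f g \<in> V" if "g \<in> carrier (presented_group R)" for g
      using that * closed by auto
    show "f (g \<otimes>\<^bsub>presented_group R\<^esub> h) = f g + Ad (rho u \<zeta>) g (f h)"
      if "g \<in> carrier (presented_group R)" "h \<in> carrier (presented_group R)" for g h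
      using that * by (auto simp: act.word_deriv_append Ad_word_class)
  qed
qed

lemma Z1_coboundary_iff:
  assumes V: "invariant V" and f: "f \<in> Z1 (presented_group R) (Ad (rho u \<zeta>)) V" and "m \<in> V"
    and x: "f (word_class R word_x) = act word_x m - m" and y: "f (word_class R word_y) = act word_y m - m"
    and g: "g \<in> carrier (presented_group R)"
  shows "f g = Ad (rho u \<zeta>) g m - m"
proof -
  obtain w where w: "g = word_class R w" using g by auto
  have gen: "f (word_class R [(h, True)]) = act [(h, True)] m - m" for h
    using x y by (cases h) (simp_all add: word_x_def word_y_def)
  have "f g = word_deriv act (\<lambda>h. act [(h, True)] m - m) w"
    by (simp only: w Z1_word_class[OF V f, of w] gen)
  then show ?thesis by (simp only: act.word_deriv_coboundary w Ad_word_class)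
qed

end

section \<open>Kernels and images of codimension one\<close>

lemma span_singleton_eq_if_dim_1:
  fixes S :: "'a::euclidean_space set"
  assumes "subspace S" "dim S = 1" "a \<in> S" "a \<noteq> 0"
  shows "S = span {a}"
proof -
  have "span {a} = S"
    using assms by (intro subspace_dim_equal) (auto simp: span_minimal dim_insert)
  then show ?thesis by simp
qed

text \<open>A linear endomorphism of \<open>V\<close> with a kernel of dimension one has an image of codimension
  one, so any nonzero functional that vanishes on the image cuts it out.\<close>

lemma image_eq_orthogonal_complement:
  fixes L :: "'a::euclidean_space \<Rightarrow> 'a"
  assumes V: "subspace V" and L: "linear L" "\<And>X. X \<in> V \<Longrightarrow> L X \<in> V"
    and ker: "\<And>X. X \<in> V \<Longrightarrow> L X = 0 \<Longrightarrow> X \<in> span {b}" and b: "b \<in> V" "b \<noteq> 0"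
    and C: "C \<in> V" "C \<noteq> 0" "\<And>X. X \<in> V \<Longrightarrow> C \<bullet> L X = 0"
    and Z: "Z \<in> V" "C \<bullet> Z = 0"
  obtains Y where "Y \<in> V" "L Y = Z"
proof -
  define W where "W a = {y \<in> V. a \<bullet> y = 0}" for a
  have dim: "dim (W a) + 1 = dim V" if "a \<in> V" "a \<noteq> 0" for a
  proof -
    have "W a = {y \<in> V. \<forall>x\<in>span {a}. orthogonal x y}"
      by (auto simp: W_def span_singleton orthogonal_def)
    moreover have "span {a} \<subseteq> V" using that V by (simp add: span_minimal)
    ultimately show ?thesis
      using dim_subspace_orthogonal_to_vectors[of "span {a}" V] that V by (simp add: dim_insert)
  qed
  have sub: "subspace (W a)" for a
    using V by (auto simp: W_def subspace_def inner_add_right)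
  have inj: "inj_on L (W b)"
  proof (rule linear_injective_on_subspace_0[THEN iffD2, OF L(1) sub], intro ballI impI)
    fix X assume X: "X \<in> W b" "L X = 0"
    then have "X \<in> span {b}" using ker by (simp add: W_def)
    then obtain c where "X = c *\<^sub>R b" by (auto simp: span_singleton)
    then show "X = 0" using X by (auto simp: W_def)
  qed
  have "dim (L ` W b) = dim (W b)"
    by (rule dim_image_eq[OF L(1)]) (simp add: inj span_eq_iff[THEN iffD2, OF sub])
  moreover have "dim (W b) = dim (W C)" using dim[OF b] dim[OF C(1,2)] by simp
  moreover have "L ` W b \<subseteq> W C" using L(2) C(3) by (auto simp: W_def)
  ultimately have "L ` W b = W C"
    using subspace_dim_equal[OF linear_subspace_image[OF L(1) sub] sub] by simp
  moreover have "Z \<in> W C" using Z by (simp add: W_def)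
  ultimately have "Z \<in> L ` W b" by (simp only:)
  then obtain Y where "Y \<in> W b" "L Y = Z" by (metis imageE)
  then show ?thesis using that[of Y] by (simp add: W_def)
qed

section \<open>The space \<open>frak_v\<close> at a hyperbolic Dehn filling parameter\<close>

lemma eval_word_w:
  assumes "riley (exp u) \<zeta> = 0"
  shows "eval_word (rho_gen u \<zeta>) word_w = mat 1"
proof -
  let ?E = "eval_word (rho_gen u \<zeta>)"
  have mn: "exp (u / 2) * exp (- u / 2) = 1" and k: "(exp (u / 2))\<^sup>2 = exp u"
    by (simp_all add: power2_eq_square flip: exp_add)
  have inv: "?E (inv_word w) = matrix_inv (?E w)" for w
    by (rule eval_word_inv_word) (rule det_rho_gen)
  have SL2: "?E w ** matrix_inv (?E w) = mat 1" for w
    by (rule SL2_inv) (rule det_eval_word, rule det_rho_gen)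
  have "?E (word_a @ word_x) - ?E (word_y @ word_a) = 0"
    unfolding rho_gen_eq_fig8_gen fig8_relation[OF mn] k assms by (simp add: zero_eq_mat2)
  then have "?E word_a ** ?E word_x = ?E word_y ** ?E word_a" by (simp add: eval_word_append)
  then have "?E word_w = ?E word_y ** (?E word_a ** matrix_inv (?E word_a)) ** matrix_inv (?E word_y)"
    by (simp add: word_w_def eval_word_append inv matrix_mul_assoc)
  then show ?thesis by (simp add: SL2)
qed

text \<open>The matrix \<open>y\<close> does not normalize the line spanned by \<open>h\<close>, the traceless part of \<open>x\<close>.\<close>

lemma fig8_y_not_fixing:
  fixes m n k \<zeta> :: complex
  assumes mn: "m * n = 1" and m2: "m * m = k" and k_neq_1: "k \<noteq> 1" and Im_pos: "0 < Im \<zeta>"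
    and eq: "spinor_map (mat2 m 0 (- \<zeta> * n) n ** mat2 (1 - k) (- 2) 0 (k - 1)) =
      spinor_map (mat2 (1 - k) (- 2) 0 (k - 1) ** mat2 m 0 (- \<zeta> * n) n)" (is "spinor_map ?A = spinor_map ?B")
  shows False
proof -
  note eq = spinor_map_eqD[OF eq]
  have k1: "k - 1 \<noteq> 0" and \<zeta>: "\<zeta> \<noteq> 0" and n: "n \<noteq> 0" using k_neq_1 Im_pos mn by auto
  have nm: "m = n * k" using mn m2 by (metis mult.assoc mult.commute mult_1)
  have yh: "?A = mat2 (m * (1 - k)) (- 2 * m) (- \<zeta> * n * (1 - k)) (2 * \<zeta> * n + n * (k - 1))"
    and hy: "?B = mat2 ((1 - k) * m + 2 * \<zeta> * n) (- 2 * n) (- (k - 1) * \<zeta> * n) ((k - 1) * n)"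
    by (simp_all add: algebra_simps)
  define c where "c = cnj (\<zeta> * n * (k - 1))"
  have c: "c \<noteq> 0" using k1 \<zeta> n by (simp add: c_def)
  have A21: "?A $ 2 $ 1 = cnj c" and B21: "?B $ 2 $ 1 = - cnj c"
    by (simp_all add: yh hy c_def algebra_simps)
  have "- 2 * m * c = - 2 * n * (- c)"
    using eq[of 1 2 2 1] unfolding A21 B21 by (simp add: yh hy)
  moreover have "(m + n) * (2 * c) = (- 2 * n * (- c)) - (- 2 * m * c)" by (simp add: algebra_simps)
  ultimately have "(m + n) * (2 * c) = 0" by (simp only: diff_self)
  then have m: "m = - n" using c by (simp add: eq_neg_iff_add_eq_0)
  have k: "k = - 1"
  proof -
    have "n * (k + 1) = n * k - (- n)" by (simp add: algebra_simps)
    also have "\<dots> = 0" using nm m by simp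
    finally have "n * (k + 1) = 0" .
    then show ?thesis using n by (simp add: eq_neg_iff_add_eq_0)
  qed
  have "(m * (1 - k)) * c = ((1 - k) * m + 2 * \<zeta> * n) * (- c)"
    using eq[of 1 1 2 1] unfolding A21 B21 by (simp add: yh hy)
  then have "(m * (1 - k) + ((1 - k) * m + 2 * \<zeta> * n)) * c = 0" by (simp add: algebra_simps)
  then have "2 * n * (\<zeta> - 2) = 0" using c by (simp add: k m algebra_simps)
  then have "\<zeta> = 2" using n by simp
  then show False using Im_pos by auto
qed

locale fig8_knot =
  fixes u \<zeta> :: complex
  assumes riley: "riley (exp u) \<zeta> = 0" and Im_pos: "0 < Im \<zeta>" and k_neq_1: "exp u \<noteq> 1"
begin

sublocale fig8_rep u \<zeta> rel_M
  by unfold_locales (simp add: rel_M_def eval_word_w[OF riley])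

abbreviation \<mu> :: complex where "\<mu> \<equiv> exp (u / 2)"
abbreviation \<nu> :: complex where "\<nu> \<equiv> exp (- u / 2)"

lemma mn: "\<mu> * \<nu> = 1" and m2: "\<mu> * \<mu> = exp u"
  by (simp_all flip: exp_add)

lemma E_x: "E word_x = mat2 \<nu> (- \<nu>) 0 \<mu>" and E_y: "E word_y = mat2 \<mu> 0 (- \<zeta> * \<nu>) \<nu>"
  by (simp_all add: rho_gen_eq_fig8_gen word_x_def word_y_def)

lemma E_inv: "E (inv_word w) = matrix_inv (E w)"
  by (rule eval_word_inv_word) (rule det_rho_gen)

lemma E_relator: "E word_w = mat 1"
  by (rule eval_word_w[OF riley])

lemma E_longitude_commute: "E word_l ** E word_x = E word_x ** E word_l"
proof -
  have conj: "E v ** matrix_inv (E v) = mat 1" "matrix_inv (E v) ** E v = mat 1" for v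
    using SL2_inv[OF det_E] by auto
  have "E v = E w" if "pres_eq {} v w" for v w
    using that
  proof (induction rule: pres_eq.induct)
    case (cancel g e)
    show ?case
      using eval_word_append[of "rho_gen u \<zeta>" "[(g, e)]" "[(g, \<not> e)]"]
        eval_word_cancel[of "rho_gen u \<zeta>", OF det_rho_gen] by (simp only: append_Cons append_Nil eval_word.simps(1))
  qed (simp_all add: eval_word_append)
  note torus = this[OF torus_relation]
  have "E (word_l @ word_x @ inv_word word_l @ inv_word word_x) = mat 1"
  proof -
    have "E (g @ word_w @ inv_word g @ g' @ inv_word word_w @ inv_word g') = mat 1" for g g'
      by (simp only: eval_word_append E_inv E_relator matrix_inv_one matrix_mul_rid matrix_mul_lid conj
          matrix_mul_assoc)
    then show ?thesis using torus by (simp only:)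
  qed
  then have "E word_l ** E word_x ** matrix_inv (E word_l) ** matrix_inv (E word_x) = mat 1"
    by (simp only: eval_word_append E_inv matrix_mul_assoc)
  then have "E word_l ** E word_x ** matrix_inv (E word_l) ** (matrix_inv (E word_x) ** E word_x) = E word_x"
    by (simp add: matrix_mul_assoc)
  then have "E word_l ** E word_x ** matrix_inv (E word_l) = E word_x" by (simp only: conj matrix_mul_rid)
  then have "E word_l ** E word_x ** (matrix_inv (E word_l) ** E word_l) = E word_x ** E word_l"
    by (simp only: matrix_mul_assoc)
  then show ?thesis by (simp add: conj)
qed

text \<open>The traceless matrix \<open>h\<close> spans the centralizer of \<open>x\<close> in \<open>sl(2,C)\<close>, so that the
  corresponding element \<open>fixv\<close> of \<open>frak_v\<close> is fixed by the peripheral subgroup.\<close>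

definition h :: "complex ^ 2 ^ 2" where "h = mat2 (1 - exp u) (- 2) 0 (exp u - 1)"
definition fixv :: "real ^ 4 ^ 4" where "fixv = spinor_map h"

lemma conj2_h:
  assumes "g ** E word_x = E word_x ** g" "det g = 1"
  shows "conj2 g h = h"
proof -
  obtain a b c d where g: "g = mat2 a b c d" using mat2_cases by blast
  have "a * \<nu> = \<nu> * a - \<nu> * c" and b: "b * \<mu> - a * \<nu> = \<nu> * b - \<nu> * d"
    using assms(1) by (simp_all add: g E_x)
  then have c: "c = 0" by simp
  have "\<mu> * (b * \<mu> - a * \<nu>) = \<mu> * (\<nu> * b - \<nu> * d)" using b by simp
  then have "b * (\<mu> * \<mu>) - (\<mu> * \<nu>) * a = (\<mu> * \<nu>) * b - (\<mu> * \<nu>) * d" by (simp add: algebra_simps)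
  then have b: "b * exp u - a = b - d" by (simp only: mn m2 mult_1)
  have "g ** h = h ** g"
    using arg_cong[OF b, of "\<lambda>z. 2 * z"] by (simp add: g h_def c algebra_simps)
  then have "conj2 g h = h ** (g ** matrix_inv g)" by (simp add: conj2_def matrix_mul_assoc)
  then show ?thesis using SL2_inv[OF assms(2)] by simp
qed

lemma act_fixv:
  assumes "E w ** E word_x = E word_x ** E w"
  shows "act w fixv = fixv"
  using conj2_h[OF assms det_E] by (simp add: fixv_def spin_Ad_spinor_map conj2_def)

lemma act_x_fixv: "act word_x fixv = fixv" and act_l_fixv: "act word_l fixv = fixv"
  by (rule act_fixv, simp add: E_longitude_commute)+

lemma fixv_in_frak_v: "fixv \<in> frak_v"
  unfolding fixv_def by (rule spinor_map_in_frak_v) (simp add: h_def)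

text \<open>The square of a traceless matrix is a scalar, which for \<open>h\<close> vanishes only if \<open>x\<close> is parabolic.\<close>

lemma trace_fixv_fixv: "trace (fixv ** fixv) \<noteq> 0"
proof -
  have "h ** h = mat ((1 - exp u)\<^sup>2)"
    by (simp add: h_def mat_eq_mat2 power2_eq_square algebra_simps)
  then have "trace (fixv ** fixv) = trace (mat ((cmod ((1 - exp u)\<^sup>2))\<^sup>2) :: real ^ 4 ^ 4)"
    by (simp add: fixv_def spinor_map_scalar flip: spinor_map_mult)
  then show ?thesis using k_neq_1 by (simp add: trace_def mat_def)
qed

lemma fixv_nonzero: "fixv \<noteq> 0"
  using trace_fixv_fixv by (auto simp: matrix_linear trace_zero)

lemma act_y_fixv: "act word_y fixv \<noteq> fixv"
proof
  assume "act word_y fixv = fixv"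
  then have "spinor_map (E word_y) ** spinor_map h ** (spinor_map (matrix_inv (E word_y)) ** spinor_map (E word_y)) =
      spinor_map h ** spinor_map (E word_y)"
    by (simp add: spin_Ad_def fixv_def matrix_mul_assoc)
  then have "spinor_map (E word_y ** h) = spinor_map (h ** E word_y)"
    using SL2_inv[OF det_E] by (simp flip: spinor_map_mult)
  from this[unfolded E_y h_def] show False
    by (rule fig8_y_not_fixing[OF mn m2 k_neq_1 Im_pos])
qed

lemma trace_act_act: "trace (act w X ** act w Y) = trace (X ** Y)"
  by (simp add: spin_Ad_matrix_mult[symmetric] trace_spin_Ad det_E)

lemma trace_fixv_act:
  assumes "act w fixv = fixv"
  shows "trace (fixv ** (act w X - X)) = 0"
  using trace_act_act[of w fixv X] by (simp add: assms matrix_linear trace_diff)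

definition fox_dwdx :: "real ^ 4 ^ 4 \<Rightarrow> real ^ 4 ^ 4" where
  "fox_dwdx X = (\<Sum>(s, r)\<leftarrow>fox_deriv GX word_w. of_int s *\<^sub>R act r X)"

lemma word_deriv_relator: "word_deriv act X word_w = fox_dwdx (X GX) + fox_dwdy u \<zeta> (X GY)"
proof -
  have "UNIV = {GX, GY}" using gen.exhaust by auto
  then show ?thesis
    using act.word_deriv_eq_fox[of GX GY X word_w] by (simp add: fox_dwdx_def fox_dwdy_def Ad_word_class)
qed

lemma fox_dwdx_eq: "fox_dwdx X = word_deriv act (\<lambda>g. case g of GX \<Rightarrow> X | GY \<Rightarrow> 0) word_w"
  and fox_dwdy_eq: "fox_dwdy u \<zeta> X = word_deriv act (\<lambda>g. case g of GX \<Rightarrow> 0 | GY \<Rightarrow> X) word_w"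
proof -
  have sum0: "(\<Sum>(s, r)\<leftarrow>T. of_int s *\<^sub>R act r 0) = 0" for T :: "(int \<times> gen word) list"
    by (induction T) auto
  show "fox_dwdx X = word_deriv act (\<lambda>g. case g of GX \<Rightarrow> X | GY \<Rightarrow> 0) word_w"
    and "fox_dwdy u \<zeta> X = word_deriv act (\<lambda>g. case g of GX \<Rightarrow> 0 | GY \<Rightarrow> X) word_w"
    using sum0 unfolding word_deriv_relator by (simp_all add: fox_dwdx_def fox_dwdy_def Ad_word_class)
qed

lemma word_deriv_closed: "(\<And>g. X g \<in> frak_v) \<Longrightarrow> word_deriv act X w \<in> frak_v"
proof (induction w)
  case (Cons l w)
  have "act w m \<in> frak_v" if "m \<in> frak_v" for w m using that spin_Ad_closed[OF det_E] by blast
  then show ?case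
    using Cons subspace_add[OF subspace_frak_v] subspace_neg[OF subspace_frak_v] by (cases l) (simp del: eval_word.simps)
qed (simp add: subspace_0[OF subspace_frak_v])

lemma linear_fox_dwdy: "linear (fox_dwdy u \<zeta>)"
proof (rule linearI)
  fix X Y :: "real ^ 4 ^ 4" and r :: real
  have "(\<lambda>g. case g of GX \<Rightarrow> 0 | GY \<Rightarrow> X + Y) = (\<lambda>g. (case g of GX \<Rightarrow> 0 | GY \<Rightarrow> X) + (case g of GX \<Rightarrow> 0 | GY \<Rightarrow> Y))"
    "(\<lambda>g. case g of GX \<Rightarrow> 0 | GY \<Rightarrow> r *\<^sub>R X) = (\<lambda>g. r *\<^sub>R (case g of GX \<Rightarrow> 0 | GY \<Rightarrow> X))"
    by (auto split: gen.split)
  then show "fox_dwdy u \<zeta> (X + Y) = fox_dwdy u \<zeta> X + fox_dwdy u \<zeta> Y"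
    and "fox_dwdy u \<zeta> (r *\<^sub>R X) = r *\<^sub>R fox_dwdy u \<zeta> X"
    by (simp_all add: fox_dwdy_eq act.word_deriv_add act.word_deriv_scale)
qed

text \<open>The coboundary of \<open>fixv\<close> vanishes on \<open>x\<close> and, like every coboundary, on the relator.\<close>

lemma fox_dwdy_coboundary: "fox_dwdy u \<zeta> (act word_y fixv - fixv) = 0"
proof -
  have "word_deriv act (\<lambda>g. act [(g, True)] fixv - fixv) word_w = 0"
    by (simp only: act.word_deriv_coboundary E_relator spin_Ad_one diff_self)
  moreover have "fox_dwdx 0 = 0"
  proof -
    have "(\<lambda>g. case g of GX \<Rightarrow> 0 | GY \<Rightarrow> 0) = (\<lambda>g. 0 :: real ^ 4 ^ 4)" by (auto split: gen.split)
    then show ?thesis using act.word_deriv_scale[of 0 "\<lambda>g. 0" word_w] by (simp add: fox_dwdx_eq)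
  qed
  ultimately show ?thesis
    using act_x_fixv by (simp add: word_deriv_relator word_x_def word_y_def)
qed

text \<open>Duality: the torus relation makes \<open>fixv\<close>, suitably translated, a functional that kills
  the image of both Fox derivatives. It is a nonzero class in second homology with twisted
  coefficients, detected on the boundary torus.\<close>

definition dual :: "real ^ 4 ^ 4" where
  "dual = act (inv_word (inv_word word_b @ inv_word word_a @ word_b)) fixv
    - act (inv_word (inv_word word_b @ inv_word word_a)) fixv"

lemma trace_dual: "trace (dual ** word_deriv act X word_w) = 0"
proof -
  let ?g = "inv_word word_b @ inv_word word_a @ word_b" and ?h = "inv_word word_b @ inv_word word_a"
  let ?F = "word_deriv act X"
  have adj: "trace (act (inv_word v) fixv ** Z) = trace (fixv ** act v Z)" for v Z
    using trace_act_act[of v "act (inv_word v) fixv" Z] by (simp only: act.inv_right)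
  have "act ?g (?F word_w) - act ?h (?F word_w) =
      (?F word_l - act word_x (?F word_l)) + (act word_l (?F word_x) - ?F word_x)"
    by (rule torus_derivation) (rule act.word_action_axioms, simp add: E_relator)
  then have "trace (fixv ** (act ?g (?F word_w) - act ?h (?F word_w))) =
      trace (fixv ** (act word_l (?F word_x) - ?F word_x)) - trace (fixv ** (act word_x (?F word_l) - ?F word_l))"
    by (simp only: matrix_linear trace_add trace_diff)
  then have "trace (fixv ** (act ?g (?F word_w) - act ?h (?F word_w))) = 0"
    by (simp only: trace_fixv_act[OF act_x_fixv] trace_fixv_act[OF act_l_fixv] diff_self)
  then show ?thesis
    by (simp only: dual_def matrix_linear trace_diff adj)
qed

text \<open>As \<open>l\<close> fixes \<open>fixv\<close>, the two translates of \<open>fixv\<close> are its images under \<open>a\<close> and \<open>a b\<close>. If they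
  agreed, then \<open>fixv\<close> would be fixed by \<open>b = x y\<^sup>-\<^sup>1\<close>, and hence by \<open>y\<close>.\<close>

lemma dual_nonzero: "dual \<noteq> 0"
proof
  assume "dual = 0"
  have "act (inv_word (inv_word word_b @ inv_word word_a @ word_b)) fixv = act (word_a @ inv_word word_l) fixv"
    by (rule act.pres_eq_imp_action_eq[of "{}"], rule pres_eq_if_reduce_eq) (simp_all add: fig8_words)
  also have "\<dots> = act word_a fixv"
    using act.inv_left[of word_l fixv] by (simp only: act.append act_l_fixv)
  finally have "act word_a fixv = act (word_a @ word_b) fixv"
    using \<open>dual = 0\<close> by (simp add: dual_def)
  then have "act word_b fixv = fixv"
    by (metis act.append act.inv_left)
  then have "act (inv_word word_y) fixv = fixv"
    unfolding word_b_def using act.inv_left[of word_x] act_x_fixv by (metis act.append)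
  then show False using act.inv_right[of word_y fixv] act_y_fixv by simp
qed

lemma dual_in_frak_v: "dual \<in> frak_v"
  unfolding dual_def by (intro subspace_diff subspace_frak_v spin_Ad_closed det_E fixv_in_frak_v)

end

lemma (in fig8_knot) fox_dwdx_zero: "fox_dwdx 0 = 0"
proof -
  have "(\<lambda>g. case g of GX \<Rightarrow> 0 | GY \<Rightarrow> 0) = (\<lambda>g. 0 :: real ^ 4 ^ 4)" by (auto split: gen.split)
  then show ?thesis using act.word_deriv_scale[of 0 "\<lambda>g. 0" word_w] by (simp add: fox_dwdx_eq)
qed

text \<open>A point at which both kernels that control the cohomology are as small as possible.\<close>

locale fig8_regular = fig8_knot +
  assumes fixed_x: "\<And>X. X \<in> frak_v \<Longrightarrow> act word_x X = X \<Longrightarrow> X \<in> span {fixv}"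
    and ker_dwdy: "\<And>X. X \<in> frak_v \<Longrightarrow> fox_dwdy u \<zeta> X = 0 \<Longrightarrow> X \<in> span {act word_y fixv - fixv}"
begin

sublocale M: group_rep pi1_M "Ad (rho u \<zeta>)" frak_v
  unfolding pi1_M_def by (rule group_rep[OF invariant_frak_v])

lemma transpose_fixv: "transpose fixv \<in> frak_v" "transpose fixv \<noteq> 0"
  using transpose_in_frak_v[OF fixv_in_frak_v] fixv_nonzero
  by (simp, metis transpose_transpose transpose_iff linear_0[OF linear_transpose])

lemma act_in_frak_v: "X \<in> frak_v \<Longrightarrow> act w X \<in> frak_v"
  using spin_Ad_closed[OF det_E] by blast

text \<open>As \<open>fixv\<close> is not isotropic, \<open>frak_v\<close> is the direct sum of its \<open>x\<close>-invariants and the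
  image of \<open>x - 1\<close>.\<close>

lemma frak_v_decompose:
  assumes X: "X \<in> frak_v"
  obtains r m where "m \<in> frak_v" "X = r *\<^sub>R fixv + (act word_x m - m)"
proof -
  define r where "r = trace (fixv ** X) / trace (fixv ** fixv)"
  have tr: "transpose fixv \<bullet> Z = trace (fixv ** Z)" for Z
    by (simp add: inner_commute trace_mul_sym[of fixv] flip: trace_mult_transpose)
  obtain m where "m \<in> frak_v" "act word_x m - m = X - r *\<^sub>R fixv"
  proof (rule image_eq_orthogonal_complement[OF subspace_frak_v, of "\<lambda>m. act word_x m - m" fixv "transpose fixv" "X - r *\<^sub>R fixv"])
    show "linear (\<lambda>m. act word_x m - m)" by (intro linear_compose_sub act.linear linear_ident)
    show "transpose fixv \<bullet> (X - r *\<^sub>R fixv) = 0"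
      using trace_fixv_fixv by (simp add: tr matrix_linear trace_diff trace_scaleR r_def)
    show "X - r *\<^sub>R fixv \<in> frak_v"
      by (intro subspace_diff subspace_scale subspace_frak_v X fixv_in_frak_v)
    show "Z \<in> span {fixv}" if "Z \<in> frak_v" "act word_x Z - Z = 0" for Z
      using fixed_x that by simp
  qed (use transpose_fixv fixv_in_frak_v fixv_nonzero act_in_frak_v in
      \<open>simp_all add: subspace_diff[OF subspace_frak_v] tr trace_fixv_act[OF act_x_fixv]\<close>)
  then show ?thesis using that[of m r] by simp
qed

lemma fixv_not_image:
  assumes "act w fixv = fixv" "r *\<^sub>R fixv = act w m - m"
  shows "r = 0"
proof -
  have "r * trace (fixv ** fixv) = trace (fixv ** (r *\<^sub>R fixv))" by (simp add: matrix_linear trace_scaleR)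
  also have "\<dots> = 0" unfolding assms(2) by (rule trace_fixv_act[OF assms(1)])
  finally show ?thesis using trace_fixv_fixv by simp
qed

text \<open>The cocycle with value \<open>fixv\<close> on the meridian exists, because the Fox derivative in the
  direction of \<open>x\<close> takes its values in the image of the Fox derivative in the direction of \<open>y\<close>.\<close>

lemma exists_cocycle:
  obtains z where "z \<in> Z1 pi1_M (Ad (rho u \<zeta>)) frak_v" "z elem_x = fixv"
proof -
  have tr: "transpose dual \<bullet> Z = trace (dual ** Z)" for Z
    by (simp add: inner_commute trace_mul_sym[of dual] flip: trace_mult_transpose)
  have dwdx: "fox_dwdx fixv \<in> frak_v" "trace (dual ** fox_dwdx X) = 0" for X
    unfolding fox_dwdx_eq
    by (rule word_deriv_closed, simp add: fixv_in_frak_v subspace_0[OF subspace_frak_v] split: gen.split)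
      (rule trace_dual)
  have dwdy: "X \<in> frak_v \<Longrightarrow> fox_dwdy u \<zeta> X \<in> frak_v" "trace (dual ** fox_dwdy u \<zeta> X) = 0" for X
    unfolding fox_dwdy_eq
    by (rule word_deriv_closed, simp add: subspace_0[OF subspace_frak_v] split: gen.split) (rule trace_dual)
  obtain Y where Y: "Y \<in> frak_v" "fox_dwdy u \<zeta> Y = - fox_dwdx fixv"
  proof (rule image_eq_orthogonal_complement[OF subspace_frak_v linear_fox_dwdy,
        of "act word_y fixv - fixv" "transpose dual" "- fox_dwdx fixv"])
    show "transpose dual \<noteq> 0"
      using dual_nonzero by (metis transpose_transpose linear_0[OF linear_transpose])
    show "transpose dual \<in> frak_v" by (rule transpose_in_frak_v[OF dual_in_frak_v])
    show "- fox_dwdx fixv \<in> frak_v" by (intro subspace_neg subspace_frak_v dwdx)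
    show "transpose dual \<bullet> - fox_dwdx fixv = 0" using dwdx by (simp add: tr matrix_linear trace_uminus)
    show "act word_y fixv - fixv \<in> frak_v"
      by (intro subspace_diff subspace_frak_v act_in_frak_v fixv_in_frak_v)
  qed (use ker_dwdy act_y_fixv dwdy tr in simp_all)
  define X where "X g = (case g of GX \<Rightarrow> fixv | GY \<Rightarrow> Y)" for g
  obtain f where f: "f \<in> Z1 (presented_group rel_M) (Ad (rho u \<zeta>)) frak_v"
    "\<And>w. f (word_class rel_M w) = word_deriv act X w"
  proof (rule Z1_from_word_deriv[OF invariant_frak_v, of X])
    show "X g \<in> frak_v" for g by (cases g) (simp_all add: X_def fixv_in_frak_v Y)
    show "word_deriv act X r = 0" if "r \<in> rel_M" for r
      using that by (simp add: rel_M_def word_deriv_relator X_def Y)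
  qed (rule that)
  then show ?thesis
    using that[of f] by (simp add: pi1_M_def elem_x_def word_x_def X_def)
qed

context
  fixes z
  assumes z: "z \<in> Z1 pi1_M (Ad (rho u \<zeta>)) frak_v" and z_x: "z elem_x = fixv"
begin

lemma z_word: "z (word_class rel_M w) = word_deriv act (\<lambda>g. z (word_class rel_M [(g, True)])) w"
  using Z1_word_class[OF invariant_frak_v, of z w] z by (simp add: pi1_M_def)

text \<open>Since \<open>x\<close> and \<open>l\<close> commute, \<open>(1 - x) z(l) = (1 - l) z(x)\<close>, which vanishes because \<open>l\<close> fixes \<open>fixv\<close>.\<close>

lemma z_longitude: obtains t where "z elem_l = t *\<^sub>R fixv"
proof -
  let ?F = "word_deriv act (\<lambda>g. z (word_class rel_M [(g, True)]))"
  have "word_class rel_M word_w = word_class rel_M []"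
    unfolding word_class_eq_iff by (rule pres_eq.relator) (simp add: rel_M_def)
  then have w: "?F word_w = 0" using M.Z1_one[OF z] z_word[of word_w] by (simp add: pi1_M_def)
  have x: "?F word_x = fixv" and l: "?F word_l = z elem_l"
    using z_word[of word_x] z_word[of word_l] z_x by (simp_all only: elem_x_def elem_l_def)
  have "z elem_l - act word_x (z elem_l) = 0"
    using torus_derivation(1)[OF act.word_action_axioms, of "\<lambda>g. z (word_class rel_M [(g, True)])"]
    by (simp only: w x l E_relator spin_Ad_one act_l_fixv act.zero diff_self add_0_right)
  moreover have "z elem_l \<in> frak_v"
    using M.Z1_closed[OF z, of elem_l] by (simp add: elem_l_def pi1_M_def)
  ultimately have "z elem_l \<in> span {fixv}" by (intro fixed_x) simp_all
  then show ?thesis using that by (auto simp: span_singleton)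
qed

lemma Ad_elem_x: "Ad (rho u \<zeta>) elem_x = act word_x" and Ad_elem_l: "Ad (rho u \<zeta>) elem_l = act word_l"
  using Ad_word_class by (auto simp: elem_x_def elem_l_def)

lemma elem_in_carrier: "elem_x \<in> carrier pi1_M" "elem_l \<in> carrier pi1_M"
  by (simp_all add: elem_x_def elem_l_def pi1_M_def)

text \<open>Subtracting a multiple of \<open>z\<close> and a coboundary from a cocycle makes it vanish on \<open>x\<close>. Its value
  on \<open>y\<close> then lies in the kernel of the Fox derivative, which accounts for the coboundary of a
  multiple of \<open>fixv\<close>.\<close>

lemma H1_generator_M: "M.H1_generator z"
  unfolding M.H1_generator_def
proof (intro conjI ballI z notI)
  assume "\<exists>m\<in>frak_v. \<forall>g\<in>carrier pi1_M. z g = Ad (rho u \<zeta>) g m - m"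
  then obtain m where "z elem_x = Ad (rho u \<zeta>) elem_x m - m"
    using elem_in_carrier by blast
  then have "1 *\<^sub>R fixv = act word_x m - m" by (simp add: z_x Ad_elem_x)
  from fixv_not_image[OF act_x_fixv this] show False by simp
next
  fix f assume f: "f \<in> Z1 pi1_M (Ad (rho u \<zeta>)) frak_v"
  obtain m r where m: "m \<in> frak_v" "f elem_x = r *\<^sub>R fixv + (act word_x m - m)"
    using frak_v_decompose[OF M.Z1_closed[OF f elem_in_carrier(1)]] by metis
  define Y where "Y g = f g - (r *\<^sub>R z g + (Ad (rho u \<zeta>) g m - m))" for g
  have word: "Y (word_class rel_M w) = word_deriv act (\<lambda>g. Y (word_class rel_M [(g, True)])) w" for w
  proof (rule act.derivation_eq_word_deriv)
    have c: "word_class rel_M w \<in> carrier pi1_M" for w by (simp add: pi1_M_def)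
    show *: "Y (word_class rel_M (v @ w)) = Y (word_class rel_M v) + act v (Y (word_class rel_M w))" for v w
      using M.Z1_mult[OF f c c, of v w] M.Z1_mult[OF z c c, of v w]
      by (simp add: Y_def pi1_M_def Ad_word_class act.add act.diff act.scale algebra_simps)
    show "Y (word_class rel_M [(g, e), (g, \<not> e)]) = 0" for g e
    proof -
      have "word_class rel_M [(g, e), (g, \<not> e)] = word_class rel_M []"
        unfolding word_class_eq_iff by (rule pres_eq.cancel)
      then show ?thesis using *[of "[]" "[]"] by simp
    qed
  qed
  have Yx: "Y elem_x = 0" using m z_x by (simp add: Y_def Ad_elem_x)
  have "word_class rel_M word_w = word_class rel_M []"
    unfolding word_class_eq_iff by (rule pres_eq.relator) (simp add: rel_M_def)
  then have "word_deriv act (\<lambda>g. Y (word_class rel_M [(g, True)])) word_w = 0"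
    using word[of word_w] word[of "[]"] by simp
  then have "fox_dwdy u \<zeta> (Y (word_class rel_M word_y)) = 0"
    using Yx by (simp add: word_deriv_relator elem_x_def word_x_def word_y_def fox_dwdx_zero)
  moreover have "Y (word_class rel_M word_y) \<in> frak_v"
    unfolding Y_def using m(1) M.Z1_closed[OF f] M.Z1_closed[OF z] M.closed
    by (intro subspace_diff subspace_add subspace_scale subspace_frak_v) (simp_all add: pi1_M_def)
  ultimately obtain s where s: "Y (word_class rel_M word_y) = s *\<^sub>R (act word_y fixv - fixv)"
    using ker_dwdy by (force simp: span_singleton)
  have gen: "Y (word_class rel_M [(g, True)]) = act [(g, True)] (s *\<^sub>R fixv) - s *\<^sub>R fixv" for g
  proof (cases g)
    case GX
    then show ?thesis using Yx act_x_fixv by (simp add: elem_x_def word_x_def linear_scale[OF linear_spin_Ad])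
  next
    case GY
    then show ?thesis using s by (simp add: word_y_def linear_scale[OF linear_spin_Ad] scaleR_diff_right)
  qed
  have "f g = r *\<^sub>R z g + (Ad (rho u \<zeta>) g (m + s *\<^sub>R fixv) - (m + s *\<^sub>R fixv))" if g: "g \<in> carrier pi1_M" for g
  proof -
    obtain w where w: "g = word_class rel_M w" using g by (auto simp: pi1_M_def)
    have "Y g = word_deriv act (\<lambda>g. act [(g, True)] (s *\<^sub>R fixv) - s *\<^sub>R fixv) w"
      using word[of w] by (simp only: w gen)
    then have "Y g = act w (s *\<^sub>R fixv) - s *\<^sub>R fixv" by (simp only: act.word_deriv_coboundary)
    then show ?thesis by (simp add: Y_def w Ad_word_class act.add algebra_simps)
  qed
  moreover have "m + s *\<^sub>R fixv \<in> frak_v"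
    by (intro subspace_add subspace_scale subspace_frak_v m(1) fixv_in_frak_v)
  ultimately show "\<exists>r. \<exists>m\<in>frak_v. \<forall>g\<in>carrier pi1_M. f g = r *\<^sub>R z g + (Ad (rho u \<zeta>) g m - m)"
    by blast
qed

lemma H0_T2: "H0 pi1_T2 (Ad (rho u \<zeta>)) frak_v = span {fixv}"
proof -
  have "H0 pi1_T2 (Ad (rho u \<zeta>)) frak_v = {m \<in> frak_v. act word_x m = m \<and> act word_l m = m}"
    unfolding pi1_T2_def using elem_in_carrier by (subst M.H0_subgroup_generated) (auto simp: Ad_elem_x Ad_elem_l)
  also have "\<dots> = span {fixv}"
    using fixed_x act_x_fixv act_l_fixv fixv_in_frak_v subspace_scale[OF subspace_frak_v]
    by (auto simp: span_singleton act.scale)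
  finally show ?thesis .
qed

text \<open>As \<open>frak_v\<close> is the sum of the multiples of \<open>fixv\<close> and the image of \<open>x - 1\<close>, a cocycle on the
  cyclic group is, up to a coboundary, determined by a multiple of \<open>fixv\<close>.\<close>

lemma H1_generator_cyc_x:
  "group_rep.H1_generator (subgroup_generated pi1_M {elem_x}) (Ad (rho u \<zeta>)) frak_v
    (restrict z (carrier (subgroup_generated pi1_M {elem_x})))"
proof -
  define H where "H = subgroup_generated pi1_M {elem_x}"
  interpret H: group_rep H "Ad (rho u \<zeta>)" frak_v
    unfolding H_def by (rule M.group_rep_subgroup_generated)
  have x: "elem_x \<in> carrier H"
    using M.subgroup_generated_subset_carrier_subset[of "{elem_x}"] elem_in_carrier by (simp add: H_def)
  have HH: "subgroup_generated H {elem_x} = H" by (simp add: H_def)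
  have zH: "restrict z (carrier H) \<in> Z1 H (Ad (rho u \<zeta>)) frak_v"
    unfolding H_def by (rule M.Z1_restrict[OF z])
  have "H.H1_generator (restrict z (carrier H))"
    unfolding H.H1_generator_def
  proof (intro conjI ballI notI zH)
    assume "\<exists>m\<in>frak_v. \<forall>g\<in>carrier H. restrict z (carrier H) g = Ad (rho u \<zeta>) g m - m"
    then obtain m where "restrict z (carrier H) elem_x = Ad (rho u \<zeta>) elem_x m - m"
      using x by blast
    then have "1 *\<^sub>R fixv = act word_x m - m" using x by (simp add: z_x Ad_elem_x)
    from fixv_not_image[OF act_x_fixv this] show False by simp
  next
    fix f assume f: "f \<in> Z1 H (Ad (rho u \<zeta>)) frak_v"
    obtain m r where m: "m \<in> frak_v" "f elem_x = r *\<^sub>R fixv + (act word_x m - m)"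
      using frak_v_decompose[OF H.Z1_closed[OF f x]] by metis
    define f' where "f' = (\<lambda>g\<in>carrier H. (\<lambda>g\<in>carrier H. r *\<^sub>R restrict z (carrier H) g) g
      + (\<lambda>g\<in>carrier H. Ad (rho u \<zeta>) g m - m) g)"
    have f': "f' \<in> Z1 H (Ad (rho u \<zeta>)) frak_v"
      unfolding f'_def by (intro H.Z1_add H.Z1_scale H.Z1_coboundary zH m(1))
    have "f g = f' g" if "g \<in> carrier H" for g
    proof (rule H.Z1_eq_on_generated[OF f f', of "{elem_x}"])
      show "f s = f' s" if "s \<in> {elem_x}" for s
        using that x m z_x by (simp add: f'_def Ad_elem_x)
    qed (use x HH that in simp_all)
    then have "\<forall>g\<in>carrier H. f g = r *\<^sub>R restrict z (carrier H) g + (Ad (rho u \<zeta>) g m - m)"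
      by (simp add: f'_def)
    then show "\<exists>r. \<exists>m\<in>frak_v. \<forall>g\<in>carrier H. f g = r *\<^sub>R restrict z (carrier H) g + (Ad (rho u \<zeta>) g m - m)"
      using m(1) by blast
  qed
  then show ?thesis by (simp add: H_def)
qed

lemma linear_iso_res_x:
  "linear_iso (res cyc_x (Ad (rho u \<zeta>)) frak_v) (H1 pi1_M (Ad (rho u \<zeta>)) frak_v) (H1 cyc_x (Ad (rho u \<zeta>)) frak_v)"
  unfolding cyc_x_def by (rule M.linear_iso_res[OF H1_generator_M H1_generator_cyc_x])

lemma linear_iso_res_l:
  assumes l: "z elem_l = t *\<^sub>R fixv" "t \<noteq> 0"
    and dim: "has_dim (H1 cyc_l (Ad (rho u \<zeta>)) frak_v) 1"
  shows "linear_iso (res cyc_l (Ad (rho u \<zeta>)) frak_v) (H1 pi1_M (Ad (rho u \<zeta>)) frak_v)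
    (H1 cyc_l (Ad (rho u \<zeta>)) frak_v)"
proof -
  interpret H: group_rep cyc_l "Ad (rho u \<zeta>)" frak_v
    unfolding cyc_l_def by (rule M.group_rep_subgroup_generated)
  have x: "elem_l \<in> carrier cyc_l"
    using M.subgroup_generated_subset_carrier_subset[of "{elem_l}"] elem_in_carrier by (simp add: cyc_l_def)
  have "H.H1_generator (restrict z (carrier cyc_l))"
  proof (rule H.H1_generator_if_has_dim_1[OF dim])
    show "restrict z (carrier cyc_l) \<in> Z1 cyc_l (Ad (rho u \<zeta>)) frak_v"
      unfolding cyc_l_def by (rule M.Z1_restrict[OF z])
    show "\<not> (\<exists>m\<in>frak_v. \<forall>g\<in>carrier cyc_l. restrict z (carrier cyc_l) g = Ad (rho u \<zeta>) g m - m)"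
    proof
      assume "\<exists>m\<in>frak_v. \<forall>g\<in>carrier cyc_l. restrict z (carrier cyc_l) g = Ad (rho u \<zeta>) g m - m"
      then obtain m where "restrict z (carrier cyc_l) elem_l = Ad (rho u \<zeta>) elem_l m - m"
        using x by blast
      then have "t *\<^sub>R fixv = act word_l m - m" using x by (simp add: l Ad_elem_l)
      from fixv_not_image[OF act_l_fixv this] show False using l by simp
    qed
  qed
  then show ?thesis
    unfolding cyc_l_def by (rule M.linear_iso_res[OF H1_generator_M])
qed

text \<open>The coefficient of \<open>fixv\<close> that represents a class on a cyclic peripheral group is unique,
  because \<open>fixv\<close> is not a coboundary there.\<close>

lemma represents_fixed_unique:
  assumes w: "word_class rel_M w \<in> carrier (subgroup_generated pi1_M {word_class rel_M w})"
    and fx: "act w fixv = fixv"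
    and rep: "represents_fixed (subgroup_generated pi1_M {word_class rel_M w}) (Ad (rho u \<zeta>)) frak_v
      (word_class rel_M w) (res (subgroup_generated pi1_M {word_class rel_M w}) (Ad (rho u \<zeta>)) frak_v
        (H1_class pi1_M (Ad (rho u \<zeta>)) frak_v (\<lambda>g\<in>carrier pi1_M. r *\<^sub>R z g))) (c *\<^sub>R fixv)"
    and val: "z (word_class rel_M w) = d *\<^sub>R fixv"
  shows "c = r * d"
proof -
  define H where "H = subgroup_generated pi1_M {word_class rel_M w}"
  interpret H: group_rep H "Ad (rho u \<zeta>)" frak_v
    unfolding H_def by (rule M.group_rep_subgroup_generated)
  define z' where "z' = restrict (\<lambda>g\<in>carrier pi1_M. r *\<^sub>R z g) (carrier H)"
  have z': "z' \<in> Z1 H (Ad (rho u \<zeta>)) frak_v"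
    unfolding z'_def H_def by (intro M.Z1_restrict M.Z1_scale z)
  obtain f where f: "f \<in> Z1 H (Ad (rho u \<zeta>)) frak_v" "f (word_class rel_M w) = c *\<^sub>R fixv"
      "H1_class H (Ad (rho u \<zeta>)) frak_v z' = H1_class H (Ad (rho u \<zeta>)) frak_v f"
    using rep unfolding represents_fixed_def z'_def H_def by (auto simp: M.res_H1_class M.Z1_scale z)
  obtain m where m: "\<forall>g\<in>carrier H. f g = z' g + (Ad (rho u \<zeta>) g m - m)"
    using f(3) H.H1_class_eq_iff[OF z' f(1)] by blast
  have wM: "word_class rel_M w \<in> carrier pi1_M" by (simp add: pi1_M_def)
  have "c *\<^sub>R fixv = r *\<^sub>R d *\<^sub>R fixv + (act w m - m)"
    using bspec[OF m, of "word_class rel_M w"] w f(2) val wM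
    by (simp add: z'_def H_def[symmetric] Ad_word_class)
  then have "(c - r * d) *\<^sub>R fixv = act w m - m" by (simp add: algebra_simps)
  from fixv_not_image[OF fx this] show ?thesis by simp
qed

lemma represents_fixed_generator:
  assumes w: "word_class rel_M w \<in> carrier (subgroup_generated pi1_M {word_class rel_M w})"
    and fx: "act w fixv = fixv" and val: "z (word_class rel_M w) = d *\<^sub>R fixv"
  shows "represents_fixed (subgroup_generated pi1_M {word_class rel_M w}) (Ad (rho u \<zeta>)) frak_v
      (word_class rel_M w) (res (subgroup_generated pi1_M {word_class rel_M w}) (Ad (rho u \<zeta>)) frak_v
        (H1_class pi1_M (Ad (rho u \<zeta>)) frak_v z)) (d *\<^sub>R fixv)"
  unfolding represents_fixed_def
proof (intro conjI bexI)
  show "d *\<^sub>R fixv \<in> frak_v" by (intro subspace_scale subspace_frak_v fixv_in_frak_v)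
  show "Ad (rho u \<zeta>) (word_class rel_M w) (d *\<^sub>R fixv) = d *\<^sub>R fixv"
    by (simp add: Ad_word_class act.scale fx)
  show "restrict z (carrier (subgroup_generated pi1_M {word_class rel_M w})) \<in>
      Z1 (subgroup_generated pi1_M {word_class rel_M w}) (Ad (rho u \<zeta>)) frak_v"
    by (rule M.Z1_restrict[OF z])
qed (use w in \<open>simp_all add: val M.res_H1_class z\<close>)

lemma elem_in_cyc: "elem_x \<in> carrier cyc_x" "elem_l \<in> carrier cyc_l"
  using M.subgroup_generated_subset_carrier_subset elem_in_carrier by (auto simp: cyc_x_def cyc_l_def)

text \<open>Rescaling the generator of \<open>H\<^sup>1\<close> or the fixed vector multiplies both coefficients in the
  definition of the slope by the same factor, so they can be computed from \<open>z\<close> and \<open>fixv\<close>.\<close>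

lemma slope_eq:
  assumes l: "z elem_l = t *\<^sub>R fixv" and t: "t \<noteq> 0"
  shows "slope u \<zeta> = inverse t"
  unfolding slope_def
proof (rule the_equality)
  let ?H = "H1 pi1_M (Ad (rho u \<zeta>)) frak_v"
  let ?C = "H1_class pi1_M (Ad (rho u \<zeta>)) frak_v z"
  have x1: "z elem_x = 1 *\<^sub>R fixv" by (simp add: z_x)
  have "?C \<in> carrier ?H" by (auto simp: M.carrier_H1 z)
  moreover have "carrier ?H = range (\<lambda>r. r \<odot>\<^bsub>?H\<^esub> ?C)" by (rule M.H1_generator_carrier[OF H1_generator_M])
  moreover have "represents_fixed cyc_x (Ad (rho u \<zeta>)) frak_v elem_x
      (res cyc_x (Ad (rho u \<zeta>)) frak_v ?C) (1 *\<^sub>R fixv)"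
    using represents_fixed_generator[OF _ act_x_fixv, of 1] elem_in_cyc x1
    by (simp add: elem_x_def cyc_x_def)
  moreover have "represents_fixed cyc_l (Ad (rho u \<zeta>)) frak_v elem_l
      (res cyc_l (Ad (rho u \<zeta>)) frak_v ?C) (t *\<^sub>R fixv)"
    using represents_fixed_generator[OF _ act_l_fixv, of t] elem_in_cyc l
    by (simp add: elem_l_def cyc_l_def)
  ultimately show "\<exists>C a c1 c2. C \<in> carrier ?H \<and> carrier ?H = range (\<lambda>r. r \<odot>\<^bsub>?H\<^esub> C) \<and>
     a \<noteq> 0 \<and> H0 pi1_T2 (Ad (rho u \<zeta>)) frak_v = span {a} \<and>
     represents_fixed cyc_x (Ad (rho u \<zeta>)) frak_v elem_x (res cyc_x (Ad (rho u \<zeta>)) frak_v C) (c1 *\<^sub>R a) \<and>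
     represents_fixed cyc_l (Ad (rho u \<zeta>)) frak_v elem_l (res cyc_l (Ad (rho u \<zeta>)) frak_v C) (c2 *\<^sub>R a) \<and>
     c2 \<noteq> 0 \<and> inverse t = c1 / c2"
    using t fixv_nonzero H0_T2 by (intro exI[of _ ?C] exI[of _ fixv] exI[of _ 1] exI[of _ t])
      (simp add: inverse_eq_divide)
next
  fix s
  let ?H = "H1 pi1_M (Ad (rho u \<zeta>)) frak_v"
  assume "\<exists>C a c1 c2. C \<in> carrier ?H \<and> carrier ?H = range (\<lambda>r. r \<odot>\<^bsub>?H\<^esub> C) \<and>
     a \<noteq> 0 \<and> H0 pi1_T2 (Ad (rho u \<zeta>)) frak_v = span {a} \<and>
     represents_fixed cyc_x (Ad (rho u \<zeta>)) frak_v elem_x (res cyc_x (Ad (rho u \<zeta>)) frak_v C) (c1 *\<^sub>R a) \<and>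
     represents_fixed cyc_l (Ad (rho u \<zeta>)) frak_v elem_l (res cyc_l (Ad (rho u \<zeta>)) frak_v C) (c2 *\<^sub>R a) \<and>
     c2 \<noteq> 0 \<and> s = c1 / c2"
  then obtain C a c1 c2 where C: "C \<in> carrier ?H" and a: "a \<noteq> 0" "span {fixv} = span {a}"
    and rx: "represents_fixed cyc_x (Ad (rho u \<zeta>)) frak_v elem_x (res cyc_x (Ad (rho u \<zeta>)) frak_v C) (c1 *\<^sub>R a)"
    and rl: "represents_fixed cyc_l (Ad (rho u \<zeta>)) frak_v elem_l (res cyc_l (Ad (rho u \<zeta>)) frak_v C) (c2 *\<^sub>R a)"
    and c2: "c2 \<noteq> 0" "s = c1 / c2"
    unfolding H0_T2 by blast
  obtain r where r: "C = H1_class pi1_M (Ad (rho u \<zeta>)) frak_v (\<lambda>g\<in>carrier pi1_M. r *\<^sub>R z g)"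
    using M.H1_generator_smult_eqD[OF H1_generator_M C] .
  have "a \<in> span {fixv}" using a(2) span_base[of a "{a}"] by simp
  then obtain b where b: "a = b *\<^sub>R fixv" by (auto simp: span_singleton)
  have "c1 * b = r * 1"
    using represents_fixed_unique[OF _ act_x_fixv, of r "c1 * b" 1] rx elem_in_cyc z_x
    by (simp add: elem_x_def cyc_x_def r b)
  moreover have "c2 * b = r * t"
    using represents_fixed_unique[OF _ act_l_fixv, of r "c2 * b" t] rl elem_in_cyc l
    by (simp add: elem_l_def cyc_l_def r b)
  ultimately have "c2 * b = c1 * t * b" by simp
  then have "c2 = c1 * t" using b a(1) by simp
  then show "s = inverse t" using c2 t by (auto simp: field_simps)
qed

text \<open>A cocycle of a filling is a multiple of \<open>z\<close> up to a coboundary, and its value on the new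
  relator is this multiple of \<open>p + q t\<close> times the fixed vector.\<close>

lemma H1_filling_frak_v:
  assumes l: "z elem_l = t *\<^sub>R fixv" and pq: "of_int p + of_int q * t \<noteq> 0"
    and rel: "spinor_map (E (pow_word word_x p @ pow_word word_l q)) = mat 1"
  shows "carrier (H1 (pi1_filling p q) (Ad (rho u \<zeta>)) frak_v)
    = {\<zero>\<^bsub>H1 (pi1_filling p q) (Ad (rho u \<zeta>)) frak_v\<^esub>}"
proof -
  define r where "r = pow_word word_x p @ pow_word word_l q"
  interpret F: fig8_rep u \<zeta> "rel_M \<union> {r}"
    by unfold_locales (use relators rel in \<open>auto simp: r_def\<close>)
  interpret FG: group_rep "pi1_filling p q" "Ad (rho u \<zeta>)" frak_v
    unfolding pi1_filling_def r_def[symmetric] by (rule F.group_rep[OF invariant_frak_v])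
  show ?thesis
  proof (rule FG.H1_trivialI)
    fix f assume f: "f \<in> Z1 (pi1_filling p q) (Ad (rho u \<zeta>)) frak_v"
    let ?c = "word_class (rel_M \<union> {r})"
    define X where "X = (\<lambda>g. f (?c [(g, True)]))"
    have fw: "f (?c w) = word_deriv act X w" for w
      using F.Z1_word_class[OF invariant_frak_v, of f w] f
      by (simp add: pi1_filling_def r_def X_def)
    have f0: "word_deriv act X w = 0" if "w \<in> rel_M \<union> {r}" for w
    proof -
      have "?c w = ?c []" unfolding word_class_eq_iff by (rule pres_eq.relator[OF that])
      then show ?thesis using fw[of w] fw[of "[]"] by simp
    qed
    have X: "X g \<in> frak_v" for g
      using FG.Z1_closed[OF f, of "?c [(g, True)]"] by (simp add: X_def pi1_filling_def r_def)
    obtain f' where f': "f' \<in> Z1 pi1_M (Ad (rho u \<zeta>)) frak_v"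
      "\<And>w. f' (word_class rel_M w) = word_deriv act X w"
    proof (rule Z1_from_word_deriv[OF invariant_frak_v, of X])
      show "word_deriv act X w = 0" if "w \<in> rel_M" for w using f0 that by blast
    qed (use X that in \<open>auto simp: pi1_M_def\<close>)
    obtain b m where m: "m \<in> frak_v" "\<forall>g\<in>carrier pi1_M. f' g = b *\<^sub>R z g + (Ad (rho u \<zeta>) g m - m)"
      using H1_generator_M f'(1) unfolding M.H1_generator_def by blast
    have f'w: "word_deriv act X w = b *\<^sub>R z (word_class rel_M w) + (act w m - m)" for w
      using bspec[OF m(2), of "word_class rel_M w"] by (simp add: f'(2) Ad_word_class pi1_M_def)
    let ?z = "word_deriv act (\<lambda>g. z (word_class rel_M [(g, True)]))"
    have x: "?z word_x = fixv" and zl: "?z word_l = t *\<^sub>R fixv"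
      using z_word[of word_x] z_word[of word_l] z_x l by (simp_all only: elem_x_def elem_l_def)
    have px: "act (pow_word word_x p) fixv = fixv"
      by (rule act.fixed_pow_word[OF act_x_fixv])
    have "?z r = (of_int p + of_int q * t) *\<^sub>R fixv"
      unfolding r_def act.word_deriv_append
      using act.word_deriv_pow_word[of word_x "\<lambda>g. z (word_class rel_M [(g, True)])" p]
        act.word_deriv_pow_word[of word_l "\<lambda>g. z (word_class rel_M [(g, True)])" q]
      by (simp add: x zl act_x_fixv act_l_fixv act.scale px scaleR_add_left)
    then have "b *\<^sub>R (of_int p + of_int q * t) *\<^sub>R fixv = 0"
      using f0[of r] f'w[of r] z_word[of r] F.act_relator[of r m] by simp
    then have "b = 0" using pq fixv_nonzero by simp
    have "f g = Ad (rho u \<zeta>) g m - m" if g: "g \<in> carrier (pi1_filling p q)" for g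
    proof -
      obtain w where w: "g = ?c w" using g by (auto simp: pi1_filling_def r_def)
      have "f (?c w) = act w m - m" using fw[of w] f'w[of w] \<open>b = 0\<close> by simp
      then show ?thesis by (simp only: w F.Ad_word_class)
    qed
    then show "\<exists>m\<in>frak_v. \<forall>g\<in>carrier (pi1_filling p q). f g = Ad (rho u \<zeta>) g m - m"
      using m(1) by blast
  qed
qed

end

end

section \<open>Local rigidity of the hyperbolic structure\<close>

lemma has_field_derivative_matrix_mult:
  fixes A B :: "complex \<Rightarrow> complex ^ 2 ^ 2"
  assumes "\<And>i j. ((\<lambda>s. A s $ i $ j) has_field_derivative A' $ i $ j) (at c)"
    and "\<And>i j. ((\<lambda>s. B s $ i $ j) has_field_derivative B' $ i $ j) (at c)"
  shows "((\<lambda>s. (A s ** B s) $ i $ j) has_field_derivative (A' ** B c + A c ** B') $ i $ j) (at c)"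
proof -
  have "((\<lambda>s. A s $ i $ 1 * B s $ 1 $ j + A s $ i $ 2 * B s $ 2 $ j) has_field_derivative
      (A' $ i $ 1 * B c $ 1 $ j + B' $ 1 $ j * A c $ i $ 1) + (A' $ i $ 2 * B c $ 2 $ j + B' $ 2 $ j * A c $ i $ 2)) (at c)"
    by (intro DERIV_add DERIV_mult assms)
  then show ?thesis
    by (simp add: matrix_matrix_mult_def sum_2 algebra_simps)
qed

lemma conj2_upper:
  assumes "A $ 2 $ 1 = 0" "det A = 1" "X $ 2 $ 1 = 0"
  shows "conj2 A X $ 2 $ 1 = 0" "conj2 A X $ 1 $ 1 = X $ 1 $ 1"
proof -
  obtain a b c d where A: "A = mat2 a b c d" using mat2_cases by blast
  obtain a' b' c' d' where X: "X = mat2 a' b' c' d'" using mat2_cases by blast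
  have "a * d = 1" "c = 0" "c' = 0" using assms by (simp_all add: A X)
  then show "conj2 A X $ 2 $ 1 = 0" "conj2 A X $ 1 $ 1 = X $ 1 $ 1"
    by (simp_all add: conj2_def A X matrix_inv_mat2 algebra_simps)
qed

text \<open>The kernel of the spinor map on \<open>SL(2,C)\<close> consists of \<open>\<plusminus> 1\<close>.\<close>

lemma conj2_trivial:
  assumes "spinor_map A = mat 1" "det A = 1"
  shows "conj2 A X = X"
proof -
  obtain a b c d where A: "A = mat2 a b c d" using mat2_cases by blast
  have "spinor_map A = spinor_map (mat 1)" using assms by simp
  note eq = spinor_map_eqD[OF this]
  have "b * cnj b = 0" "c * cnj c = 0" "a * cnj d = 1" "d * cnj d = 1"
    using eq[of 1 2 1 2] eq[of 2 1 2 1] eq[of 1 1 2 2] eq[of 2 2 2 2] by (simp_all add: A mat_eq_mat2)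
  then have bc: "b = 0" "c = 0" and "a * cnj d = d * cnj d" "cnj d \<noteq> 0" by auto
  then have ad: "a = d" by (metis mult_right_cancel)
  have "d * d = 1" using assms(2) by (simp add: A bc ad)
  obtain a' b' c' d' where X: "X = mat2 a' b' c' d'" using mat2_cases by blast
  have "d * (d * z) = z" for z using \<open>d * d = 1\<close> by (metis mult.assoc mult_1)
  then show ?thesis
    using \<open>d * d = 1\<close> by (simp add: conj2_def A X bc ad matrix_inv_mat2 mult.assoc mult.left_commute)
qed

lemma conj2_fig8_x:
  fixes m n k :: complex
  assumes mn: "m * n = 1" and k: "m * m = k"
  shows "conj2 (mat2 n (- n) 0 m) (mat2 p q r (- p)) - mat2 p q r (- p) =
    mat2 (- r) (n\<^sup>2 * (2 * p - r + q) - q) ((k - 1) * r) r"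
proof -
  have c: "m * (n * z) = z" for z using mn by (metis mult.assoc mult_1)
  show ?thesis
    using mn by (simp add: conj2_def matrix_inv_mat2 mult.commute)
      (simp add: mn c k[symmetric] algebra_simps power2_eq_square)
qed

lemma conj2_fig8_y:
  fixes m n k :: complex
  assumes mn: "m * n = 1" and k: "m * m = k"
  obtains s where "conj2 (mat2 m 0 (- \<zeta> * n) n) (mat2 p q r (- p)) - mat2 p q r (- p) =
    mat2 (\<zeta> * q) ((k - 1) * q) s (- (\<zeta> * q))"
proof -
  have c: "m * (n * z) = z" for z using mn by (metis mult.assoc mult_1)
  have "\<exists>s. conj2 (mat2 m 0 (- \<zeta> * n) n) (mat2 p q r (- p)) - mat2 p q r (- p) =
      mat2 (\<zeta> * q) ((k - 1) * q) s (- (\<zeta> * q))"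
    using mn by (simp add: conj2_def matrix_inv_mat2 mult.commute)
      (simp add: mn c k[symmetric] algebra_simps)
  then show ?thesis using that by blast
qed

lemma has_field_derivative_mat2:
  assumes "(a has_field_derivative a') F" "(b has_field_derivative b') F"
    "(c has_field_derivative c') F" "(d has_field_derivative d') F"
  shows "((\<lambda>s. mat2 (a s) (b s) (c s) (d s) $ i $ j) has_field_derivative mat2 a' b' c' d' $ i $ j) F"
  using exhaust_2[of i] exhaust_2[of j] assms by auto

lemma has_field_derivative_riley:
  assumes "(K has_field_derivative K') (at s)" "(Z has_field_derivative Z') (at s)"
  shows "((\<lambda>s. riley (K s) (Z s)) has_field_derivative
    (2 * Z s + K s - 1 - (K s)\<^sup>2) * Z' + ((1 - 2 * K s) * Z s + 2 * K s) * K') (at s)"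
proof -
  have "((\<lambda>s. Z s * Z s + (K s - 1 - K s * K s) * Z s + K s * K s) has_field_derivative
      (Z' * Z s + Z' * Z s) + ((K' - 0 - (K' * K s + K' * K s)) * Z s + Z' * (K s - 1 - K s * K s))
      + (K' * K s + K' * K s)) (at s)"
    by (intro DERIV_add DERIV_mult DERIV_diff DERIV_const assms)
  then show ?thesis by (simp add: riley_def power2_eq_square algebra_simps)
qed

context fig8_knot
begin

abbreviation conjE :: "gen word \<Rightarrow> complex ^ 2 ^ 2 \<Rightarrow> complex ^ 2 ^ 2" where
  "conjE w \<equiv> conj2 (E w)"

sublocale conjE: word_action conjE
  by (rule word_action_conj2) (rule det_rho_gen)

lemma \<mu>_neq_\<nu>: "\<mu> \<noteq> \<nu>"
  using mn m2 k_neq_1 by metis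

text \<open>Up to coboundaries, a derivation with values in \<open>sl(2,C)\<close> is the velocity of a deformation
  within the family of pairs of matrices that is used to define the representations.\<close>

lemma normal_form:
  assumes tr: "\<And>g. trace (X g) = 0"
  obtains M \<alpha> \<beta> \<gamma> where "trace M = 0"
    "X GX - (conjE word_x M - M) = mat2 \<alpha> 0 0 (- \<alpha>)"
    "X GY - (conjE word_y M - M) = mat2 \<beta> 0 \<gamma> (- \<beta>)"
proof -
  let ?k = "exp u"
  have k1: "?k - 1 \<noteq> 0" using k_neq_1 by simp
  have nu: "\<nu> \<noteq> 0" by simp
  obtain a b c d where X: "X GX = mat2 a b c d" using mat2_cases by blast
  obtain a' b' c' d' where Y: "X GY = mat2 a' b' c' d'" using mat2_cases by blast
  have d: "d = - a" "d' = - a'"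
    using tr[of GX] tr[of GY] by (simp_all add: X Y eq_neg_iff_add_eq_0 add.commute)
  define q where "q = b' / (?k - 1)"
  define r where "r = c / (?k - 1)"
  define p where "p = ((b + q) / \<nu>\<^sup>2 + r - q) / 2"
  define M where "M = mat2 p q r (- p)"
  have x: "conjE word_x M - M = mat2 (- r) (\<nu>\<^sup>2 * (2 * p - r + q) - q) ((?k - 1) * r) r"
    unfolding E_x M_def by (rule conj2_fig8_x[OF mn m2])
  have 1: "\<nu>\<^sup>2 * (2 * p - r + q) - q = b" using nu by (simp add: p_def field_simps)
  have 2: "(?k - 1) * r = c" "(?k - 1) * q = b'" using k1 by (simp_all add: r_def q_def)
  obtain s where s: "conjE word_y M - M = mat2 (\<zeta> * q) b' s (- (\<zeta> * q))"
    using conj2_fig8_y[OF mn m2, of \<zeta> p q r] unfolding E_y M_def 2 by blast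
  show ?thesis
  proof (rule that[of M "a + r" "a' - \<zeta> * q" "c' - s"])
    show "X GX - (conjE word_x M - M) = mat2 (a + r) 0 0 (- (a + r))"
      unfolding x 1 2 X d by simp
    show "X GY - (conjE word_y M - M) = mat2 (a' - \<zeta> * q) 0 (c' - s) (- (a' - \<zeta> * q))"
      unfolding s Y d by simp
  qed (simp add: M_def)
qed

lemma zeta_neq: "\<zeta> \<noteq> 0" "1 - \<zeta> \<noteq> 0"
  using Im_pos by auto

lemma E_longitude: "E word_l $ 2 $ 1 = 0" "E word_l $ 1 $ 1 = \<zeta> / (1 - \<zeta>)\<^sup>2"
proof -
  have R: "riley (\<mu>\<^sup>2) \<zeta> = 0" using riley m2 by (simp add: power2_eq_square)
  show "E word_l $ 2 $ 1 = 0"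
    unfolding rho_gen_eq_fig8_gen fig8_longitude_21[OF mn] R by (rule mult_zero_left)
  have "(1 - \<zeta>)\<^sup>2 * E word_l $ 1 $ 1 = \<zeta>"
    unfolding rho_gen_eq_fig8_gen fig8_longitude_11[OF mn] R by (simp only: mult_zero_left add_0_right)
  then show "E word_l $ 1 $ 1 = \<zeta> / (1 - \<zeta>)\<^sup>2"
    using zeta_neq by (simp add: nonzero_eq_divide_eq mult.commute)
qed

context
  fixes X :: "gen \<Rightarrow> complex ^ 2 ^ 2" and \<alpha> \<beta> \<gamma> :: complex
  assumes Xx: "X GX = mat2 \<alpha> 0 0 (- \<alpha>)" and Xy: "X GY = mat2 \<beta> 0 \<gamma> (- \<beta>)"
    and relator: "word_deriv conjE X word_w = 0"
begin

abbreviation F :: "gen word \<Rightarrow> complex ^ 2 ^ 2" where "F \<equiv> word_deriv conjE X"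

lemma F_relation: "F (word_a @ word_x) = F (word_y @ word_a)"
proof -
  have "pres_eq {} (word_a @ word_x) (word_w @ word_y @ word_a)"
    by (rule pres_eq_if_reduce_eq) (simp add: fig8_words)
  then have "F (word_a @ word_x) = F (word_w @ word_y @ word_a)"
    by (intro conjE.pres_eq_imp_word_deriv_eq[of "{}"]) simp_all
  then show ?thesis
    by (simp add: conjE.word_deriv_append relator E_relator conj2_def)
qed

lemma E_relation: "E (word_a @ word_x) = E (word_y @ word_a)"
proof -
  have "E word_a ** E word_x ** matrix_inv (E word_a) ** (matrix_inv (E word_y) ** E word_y) = E word_y"
    using arg_cong[OF E_relator, of "\<lambda>M. M ** E word_y"]
    by (simp add: word_w_def eval_word_append E_inv matrix_mul_assoc)
  then have "E word_a ** E word_x ** matrix_inv (E word_a) = E word_y"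
    using SL2_inv[OF det_E] by simp
  then have "E word_a ** E word_x ** (matrix_inv (E word_a) ** E word_a) = E word_y ** E word_a"
    by (metis matrix_mul_assoc)
  then show ?thesis using SL2_inv[OF det_E] by (simp add: eval_word_append)
qed

lemma F_x: "F word_x = X GX" and F_y: "F word_y = X GY"
  by (simp_all add: word_x_def word_y_def conj2_def matrix_linear)

text \<open>As \<open>x\<close> and \<open>y\<close> are conjugate by \<open>a\<close>, their traces have the same derivative.\<close>

lemma \<beta>_eq: "\<beta> = - \<alpha>"
proof -
  let ?a = "E word_a" and ?x = "E word_x" and ?y = "E word_y"
  have tr: "trace (P ** Q) = trace (Q ** P)" for P Q :: "complex ^ 2 ^ 2" by (rule trace_mul_sym)
  have tadd: "trace (P + Q) = trace P + trace Q" "trace (P - Q) = trace P - trace Q" for P Q :: "complex ^ 2 ^ 2"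
    by (simp_all add: trace_def sum_2)
  have "X GY = F word_a + conjE word_a (X GX) - conjE word_y (F word_a)"
    using F_relation by (simp add: conjE.word_deriv_append F_x F_y)
  then have "trace (X GY ** ?y) = trace (F word_a ** ?y) + trace (conjE word_a (X GX) ** ?y) - trace (conjE word_y (F word_a) ** ?y)"
    by (simp add: matrix_linear tadd)
  moreover have "conjE word_y (F word_a) ** ?y = ?y ** F word_a"
    using SL2_inv[OF det_E, of word_y] by (simp add: conj2_def flip: matrix_mul_assoc)
  moreover have "trace (conjE word_a (X GX) ** ?y) = trace (X GX ** ?x)"
  proof -
    have "trace (conjE word_a (X GX) ** ?y) = trace (?a ** (X GX ** (matrix_inv ?a ** ?y)))"
      by (simp add: conj2_def matrix_mul_assoc)
    also have "\<dots> = trace (X GX ** (matrix_inv ?a ** ?y) ** ?a)" by (rule tr)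
    also have "X GX ** (matrix_inv ?a ** ?y) ** ?a = X GX ** (matrix_inv ?a ** (?a ** ?x))"
      using E_relation by (simp add: eval_word_append matrix_mul_assoc[symmetric])
    also have "\<dots> = X GX ** ?x" using SL2_inv[OF det_E, of word_a] by (simp add: matrix_mul_assoc)
    finally show ?thesis .
  qed
  ultimately have "trace (X GY ** ?y) = trace (X GX ** ?x)" using tr[of "F word_a" ?y] by simp
  then have "\<beta> * \<mu> - \<beta> * \<nu> = \<alpha> * \<nu> - \<alpha> * \<mu>" by (simp add: Xx Xy E_x E_y)
  then have "(\<beta> + \<alpha>) * (\<mu> - \<nu>) = 0" by (simp add: algebra_simps)
  then show ?thesis using \<mu>_neq_\<nu> by (simp add: eq_neg_iff_add_eq_0)
qed

text \<open>A deformation with velocity \<open>X\<close>, in which \<open>\<eta>\<close> is the velocity of \<open>\<zeta>\<close>. Exponentials keep the two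
  eigenvalues inverse to each other.\<close>

definition \<eta> :: complex where "\<eta> = - \<gamma> * exp u"

definition deform :: "complex \<Rightarrow> gen \<Rightarrow> complex ^ 2 ^ 2" where
  "deform s = fig8_gen (\<mu> * exp (- \<alpha> * s)) (\<nu> * exp (\<alpha> * s)) (\<zeta> + \<eta> * s)"

lemma mn_deform: "\<mu> * exp (- \<alpha> * s) * (\<nu> * exp (\<alpha> * s)) = 1"
  by (simp flip: exp_add)

lemma deform_0: "deform 0 = rho_gen u \<zeta>"
  by (simp add: deform_def rho_gen_eq_fig8_gen)

lemma deriv_entries:
  "((\<lambda>s. \<mu> * exp (- \<alpha> * s)) has_field_derivative - \<alpha> * \<mu>) (at 0)"
  "((\<lambda>s. \<nu> * exp (\<alpha> * s)) has_field_derivative \<alpha> * \<nu>) (at 0)"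
  "((\<lambda>s. \<zeta> + \<eta> * s) has_field_derivative \<eta>) (at 0)"
  "((\<lambda>s. (\<zeta> + \<eta> * s) * (\<nu> * exp (\<alpha> * s))) has_field_derivative \<zeta> * (\<alpha> * \<nu>) - \<gamma> * \<mu>) (at 0)"
proof -
  show 1: "((\<lambda>s. \<nu> * exp (\<alpha> * s)) has_field_derivative \<alpha> * \<nu>) (at 0)"
    by (rule derivative_eq_intros refl | simp)+
  show 2: "((\<lambda>s. \<zeta> + \<eta> * s) has_field_derivative \<eta>) (at 0)"
    by (rule derivative_eq_intros refl | simp)+
  show "((\<lambda>s. \<mu> * exp (- \<alpha> * s)) has_field_derivative - \<alpha> * \<mu>) (at 0)"
    by (rule derivative_eq_intros refl | simp)+
  have "exp u * \<nu> = \<mu>" by (simp flip: exp_add)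
  then have "\<eta> * \<nu> = - \<gamma> * \<mu>" unfolding \<eta>_def by (metis mult.assoc mult_minus_left)
  then show "((\<lambda>s. (\<zeta> + \<eta> * s) * (\<nu> * exp (\<alpha> * s))) has_field_derivative \<zeta> * (\<alpha> * \<nu>) - \<gamma> * \<mu>) (at 0)"
    using DERIV_mult[OF 2 1] by (simp add: algebra_simps)
qed

lemma deriv_letter:
  "((\<lambda>s. eval_word (deform s) [(g, e)] $ i $ j) has_field_derivative (F [(g, e)] ** E [(g, e)]) $ i $ j) (at 0)"
proof -
  have cancel: "matrix_inv (E [(g, True)]) ** X g ** E [(g, True)] ** matrix_inv (E [(g, True)]) =
      matrix_inv (E [(g, True)]) ** X g" for g
    using SL2_inv(1)[OF det_E, of "[(g, True)]"] by (simp only: matrix_mul_assoc[symmetric] matrix_mul_rid)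
  have inv_inv: "matrix_inv (matrix_inv (E w)) = E w" for w
    using SL2_inv[OF det_E, of w] by (intro matrix_inv_eqI)
  have F_inv: "F [(g, False)] ** E [(g, False)] = - (matrix_inv (E [(g, True)]) ** X g)" for g
    using cancel[of g] inv_inv[of "[(g, True)]"] by (simp add: conj2_def matrix_linear)
  have x: "E [(GX, True)] = mat2 \<nu> (- \<nu>) 0 \<mu>" and y: "E [(GY, True)] = mat2 \<mu> 0 (- \<zeta> * \<nu>) \<nu>"
    using E_x E_y by (simp_all only: word_x_def word_y_def)
  have inv: "matrix_inv (fig8_gen m n z GX) = mat2 m n 0 n" "matrix_inv (fig8_gen m n z GY) = mat2 n 0 (z * n) m"
    if "m * n = 1" for m n z :: complex
    using that by (simp_all add: matrix_inv_mat2 mult.commute)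
  note d = deriv_entries
  consider "g = GX" "e" | "g = GX" "\<not> e" | "g = GY" "e" | "g = GY" "\<not> e" by (cases g) auto
  then show ?thesis
  proof cases
    case 1
    have "F [(g, e)] ** E [(g, e)] = X GX ** E [(GX, True)]"
      using 1 by (simp add: conj2_def matrix_linear)
    also have "\<dots> = mat2 (\<alpha> * \<nu>) (- (\<alpha> * \<nu>)) 0 (- \<alpha> * \<mu>)" by (simp only: x Xx) simp
    finally have D: "F [(g, e)] ** E [(g, e)] = mat2 (\<alpha> * \<nu>) (- (\<alpha> * \<nu>)) 0 (- \<alpha> * \<mu>)" .
    have "eval_word (deform s) [(g, e)] = mat2 (\<nu> * exp (\<alpha> * s)) (- (\<nu> * exp (\<alpha> * s))) 0 (\<mu> * exp (- \<alpha> * s))" for s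
      using 1 by (simp add: deform_def)
    then show ?thesis
      unfolding D by (simp only:) (intro has_field_derivative_mat2 d DERIV_minus DERIV_const)
  next
    case 2
    have "F [(g, e)] ** E [(g, e)] = - (matrix_inv (E [(GX, True)]) ** X GX)"
      using F_inv[of GX] 2 by simp
    also have "\<dots> = - (mat2 \<mu> \<nu> 0 \<nu> ** mat2 \<alpha> 0 0 (- \<alpha>))"
      using mn by (simp only: x Xx) (simp add: matrix_inv_mat2 mult.commute)
    also have "\<dots> = mat2 (- \<alpha> * \<mu>) (\<alpha> * \<nu>) 0 (\<alpha> * \<nu>)" by simp
    finally have D: "F [(g, e)] ** E [(g, e)] = mat2 (- \<alpha> * \<mu>) (\<alpha> * \<nu>) 0 (\<alpha> * \<nu>)" .
    have "eval_word (deform s) [(g, e)] = mat2 (\<mu> * exp (- \<alpha> * s)) (\<nu> * exp (\<alpha> * s)) 0 (\<nu> * exp (\<alpha> * s))" for s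
      using 2 inv(1)[OF mn_deform] by (simp add: deform_def del: fig8_gen.simps)
    then show ?thesis
      unfolding D by (simp only:) (intro has_field_derivative_mat2 d DERIV_const)
  next
    case 3
    have "F [(g, e)] ** E [(g, e)] = X GY ** E [(GY, True)]"
      using 3 by (simp add: conj2_def matrix_linear)
    also have "\<dots> = mat2 (- \<alpha> * \<mu>) 0 (- (\<zeta> * (\<alpha> * \<nu>) - \<gamma> * \<mu>)) (\<alpha> * \<nu>)"
      by (simp only: y Xy \<beta>_eq) (simp add: algebra_simps)
    finally have D: "F [(g, e)] ** E [(g, e)] = mat2 (- \<alpha> * \<mu>) 0 (- (\<zeta> * (\<alpha> * \<nu>) - \<gamma> * \<mu>)) (\<alpha> * \<nu>)" .
    have "eval_word (deform s) [(g, e)] = mat2 (\<mu> * exp (- \<alpha> * s)) 0 (- ((\<zeta> + \<eta> * s) * (\<nu> * exp (\<alpha> * s)))) (\<nu> * exp (\<alpha> * s))" for s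
      using 3 by (simp add: deform_def algebra_simps)
    then show ?thesis
      unfolding D by (simp only:) (intro has_field_derivative_mat2 d DERIV_minus DERIV_const)
  next
    case 4
    have "F [(g, e)] ** E [(g, e)] = - (matrix_inv (E [(GY, True)]) ** X GY)"
      using F_inv[of GY] 4 by simp
    also have "\<dots> = - (mat2 \<nu> 0 (\<zeta> * \<nu>) \<mu> ** mat2 (- \<alpha>) 0 \<gamma> \<alpha>)"
      using mn by (simp only: y Xy \<beta>_eq) (simp add: matrix_inv_mat2 mult.commute)
    also have "\<dots> = mat2 (\<alpha> * \<nu>) 0 (\<zeta> * (\<alpha> * \<nu>) - \<gamma> * \<mu>) (- \<alpha> * \<mu>)" by (simp add: algebra_simps)
    finally have D: "F [(g, e)] ** E [(g, e)] = mat2 (\<alpha> * \<nu>) 0 (\<zeta> * (\<alpha> * \<nu>) - \<gamma> * \<mu>) (- \<alpha> * \<mu>)" .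
    have "eval_word (deform s) [(g, e)] = mat2 (\<nu> * exp (\<alpha> * s)) 0 ((\<zeta> + \<eta> * s) * (\<nu> * exp (\<alpha> * s))) (\<mu> * exp (- \<alpha> * s))" for s
      using 4 inv(2)[OF mn_deform] by (simp add: deform_def del: fig8_gen.simps)
    then show ?thesis
      unfolding D by (simp only:) (intro has_field_derivative_mat2 d DERIV_const)
  qed
qed

lemma deriv_word:
  "((\<lambda>s. eval_word (deform s) w $ i $ j) has_field_derivative (F w ** E w) $ i $ j) (at 0)"
proof (induction w arbitrary: i j)
  case (Cons l w)
  obtain g e where l: "l = (g, e)" by fastforce
  have *: "eval_word \<rho> (l # w) = eval_word \<rho> [(g, e)] ** eval_word \<rho> w" for \<rho>
    using eval_word_append[of \<rho> "[(g, e)]" w] by (simp only: l append_Cons append_Nil)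
  have "F (l # w) ** E (l # w) = F [(g, e)] ** E [(g, e)] ** eval_word (deform 0) w
      + eval_word (deform 0) [(g, e)] ** (F w ** E w)"
  proof -
    have "F (l # w) = F [(g, e)] + conjE [(g, e)] (F w)"
      using conjE.word_deriv_append[of X "[(g, e)]" w] by (simp only: l append_Cons append_Nil)
    moreover have "conjE [(g, e)] (F w) ** E [(g, e)] = E [(g, e)] ** F w"
      using SL2_inv(2)[OF det_E, of "[(g, e)]"] by (simp only: conj2_def matrix_mul_assoc[symmetric] matrix_mul_rid)
    ultimately show ?thesis
      by (simp only: * deform_0 matrix_linear matrix_mul_assoc)
  qed
  then show ?case
    unfolding * by (simp only:) (rule has_field_derivative_matrix_mult[OF deriv_letter Cons.IH])
qed (simp add: conj2_def matrix_linear)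

definition riley' :: complex where
  "riley' = (2 * \<zeta> + exp u - 1 - (exp u)\<^sup>2) * \<eta> + ((1 - 2 * exp u) * \<zeta> + 2 * exp u) * (- 2 * \<alpha> * exp u)"

lemma deriv_riley:
  "((\<lambda>s. riley ((\<mu> * exp (- \<alpha> * s))\<^sup>2) (\<zeta> + \<eta> * s)) has_field_derivative riley') (at 0)"
proof -
  have K: "((\<lambda>s. (\<mu> * exp (- \<alpha> * s))\<^sup>2) has_field_derivative - 2 * \<alpha> * exp u) (at 0)"
    unfolding power2_eq_square
    using DERIV_mult[OF deriv_entries(1) deriv_entries(1)] m2 by (simp add: mult.assoc mult.left_commute)
  have "(\<mu> * exp (- \<alpha> * 0))\<^sup>2 = exp u" using m2 by (simp add: power2_eq_square)
  then show ?thesis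
    using has_field_derivative_riley[OF K deriv_entries(3)] unfolding riley'_def by (simp only:) simp
qed

text \<open>The relation of the group persists to first order, so the deformation is tangent to the
  curve cut out by the Riley polynomial.\<close>

lemma riley'_eq_0: "riley' = 0"
proof -
  let ?R = "\<lambda>s. riley ((\<mu> * exp (- \<alpha> * s))\<^sup>2) (\<zeta> + \<eta> * s)"
  have "((\<lambda>s. eval_word (deform s) (word_a @ word_x) $ 1 $ 2 - eval_word (deform s) (word_y @ word_a) $ 1 $ 2)
      has_field_derivative (F (word_a @ word_x) ** E (word_a @ word_x)) $ 1 $ 2
        - (F (word_y @ word_a) ** E (word_y @ word_a)) $ 1 $ 2) (at 0)"
    by (intro DERIV_diff deriv_word)
  moreover have "eval_word (deform s) (word_a @ word_x) $ 1 $ 2 - eval_word (deform s) (word_y @ word_a) $ 1 $ 2 =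
      ?R s * (- ((\<nu> * exp (\<alpha> * s)) ^ 5))" for s
    using arg_cong[OF fig8_relation[OF mn_deform[of s], of "\<zeta> + \<eta> * s"], of "\<lambda>M. M $ 1 $ 2"]
    by (simp only: deform_def vector_minus_component mat2_nth)
  ultimately have "((\<lambda>s. ?R s * (- ((\<nu> * exp (\<alpha> * s)) ^ 5))) has_field_derivative 0) (at 0)"
    by (simp only: F_relation E_relation diff_self)
  moreover have "((\<lambda>s. ?R s * (- ((\<nu> * exp (\<alpha> * s)) ^ 5))) has_field_derivative
      riley' * (- ((\<nu> * exp (\<alpha> * 0)) ^ 5)) + - (of_nat 5 * (\<alpha> * \<nu> * (\<nu> * exp (\<alpha> * 0)) ^ (5 - Suc 0))) * ?R 0) (at 0)"
    by (intro DERIV_mult deriv_riley DERIV_minus DERIV_power deriv_entries)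
  moreover have "?R 0 = 0" using riley m2 by (simp add: power2_eq_square)
  ultimately have "riley' * (- (\<nu> ^ 5)) = 0" using DERIV_unique by fastforce
  then show ?thesis by simp
qed

text \<open>The upper left entry of \<open>l\<close> is \<open>\<zeta> / (1 - \<zeta>)\<^sup>2\<close> up to a multiple of the Riley polynomial, which does
  not contribute to the derivative because the deformation is tangent to its zero set.\<close>

lemma F_longitude: "F word_l $ 2 $ 1 = 0" "F word_l $ 1 $ 1 = \<eta> * (1 + \<zeta>) / (\<zeta> * (1 - \<zeta>))"
proof -
  let ?R = "\<lambda>s. riley ((\<mu> * exp (- \<alpha> * s))\<^sup>2) (\<zeta> + \<eta> * s)"
  let ?D = "F word_l ** E word_l"
  have R0: "?R 0 = 0" using riley m2 by (simp add: power2_eq_square)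
  have R': "(?R has_field_derivative 0) (at 0)" using deriv_riley by (simp only: riley'_eq_0)
  have RK: "((\<lambda>s. ?R s * K s) has_field_derivative 0) (at 0)" if "K field_differentiable (at 0)" for K
  proof -
    obtain K' where "(K has_field_derivative K') (at 0)" using \<open>K field_differentiable _\<close> by (auto simp: field_differentiable_def)
    from DERIV_mult[OF R' this]
    have "((\<lambda>s. ?R s * K s) has_field_derivative 0 * K 0 + K' * ?R 0) (at 0)" .
    moreover have "0 * K 0 + K' * ?R 0 = 0" unfolding R0 by simp
    ultimately show ?thesis by (simp only:)
  qed
  have fd: "(\<lambda>s. \<nu> * exp (\<alpha> * s)) field_differentiable (at 0)" "(\<lambda>s. \<zeta> + \<eta> * s) field_differentiable (at 0)"
    using deriv_entries field_differentiable_def by blast+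
  have "((\<lambda>s. eval_word (deform s) word_l $ 2 $ 1) has_field_derivative 0) (at 0)"
    unfolding deform_def fig8_longitude_21[OF mn_deform]
    by (rule RK) (intro field_differentiable_add field_differentiable_diff field_differentiable_mult
        field_differentiable_power field_differentiable_const fd)
  with deriv_word[of word_l 2 1] have D21: "?D $ 2 $ 1 = 0" by (rule DERIV_unique)
  have "((\<lambda>s. (1 - (\<zeta> + \<eta> * s))\<^sup>2 * eval_word (deform s) word_l $ 1 $ 1) has_field_derivative \<eta> + 0) (at 0)"
    unfolding deform_def fig8_longitude_11[OF mn_deform]
    by (rule DERIV_add[OF deriv_entries(3) RK])
      (intro field_differentiable_add field_differentiable_diff field_differentiable_mult
        field_differentiable_power field_differentiable_const fd)
  moreover have "((\<lambda>s. (1 - (\<zeta> + \<eta> * s))\<^sup>2 * eval_word (deform s) word_l $ 1 $ 1) has_field_derivative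
      (of_nat 2 * ((0 - \<eta>) * (1 - (\<zeta> + \<eta> * 0)) ^ (2 - Suc 0))) * eval_word (deform 0) word_l $ 1 $ 1
      + ?D $ 1 $ 1 * (1 - (\<zeta> + \<eta> * 0))\<^sup>2) (at 0)"
    by (intro DERIV_mult DERIV_power DERIV_diff DERIV_const deriv_entries deriv_word)
  ultimately have "\<eta> + 0 = (of_nat 2 * ((0 - \<eta>) * (1 - (\<zeta> + \<eta> * 0)) ^ (2 - Suc 0))) * eval_word (deform 0) word_l $ 1 $ 1
      + ?D $ 1 $ 1 * (1 - (\<zeta> + \<eta> * 0))\<^sup>2"
    by (rule DERIV_unique)
  then have D11: "\<eta> = ?D $ 1 $ 1 * (1 - \<zeta>)\<^sup>2 - 2 * (\<eta> * ((1 - \<zeta>) * (\<zeta> / (1 - \<zeta>)\<^sup>2)))"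
    by (simp add: deform_0 E_longitude mult.assoc)
  obtain a b c d where l: "E word_l = mat2 a b c d" using mat2_cases by blast
  have c: "c = 0" and a: "a = \<zeta> / (1 - \<zeta>)\<^sup>2" using E_longitude by (simp_all add: l)
  obtain a' b' c' d' where f: "F word_l = mat2 a' b' c' d'" using mat2_cases by blast
  have "c' * a = 0" and D: "?D $ 1 $ 1 = a' * a" using D21 by (simp_all add: l f c)
  then have "c' = 0" using a zeta_neq by simp
  then show "F word_l $ 2 $ 1 = 0" by (simp add: f)
  have "\<eta> = a' * \<zeta> - 2 * \<eta> * \<zeta> / (1 - \<zeta>)"
  proof -
    have "(1 - \<zeta>) * (\<zeta> / (1 - \<zeta>)\<^sup>2) = \<zeta> / (1 - \<zeta>)" using zeta_neq by (simp add: power2_eq_square)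
    moreover have "?D $ 1 $ 1 * (1 - \<zeta>)\<^sup>2 = a' * \<zeta>" using zeta_neq by (simp add: D a)
    ultimately show ?thesis using D11 by (simp add: mult.assoc)
  qed
  then have "a' * \<zeta> * (1 - \<zeta>) = \<eta> * (1 + \<zeta>)" using zeta_neq by (simp add: field_simps)
  then show "F word_l $ 1 $ 1 = \<eta> * (1 + \<zeta>) / (\<zeta> * (1 - \<zeta>))"
    using zeta_neq by (simp add: f field_simps)
qed

text \<open>On words whose matrices are upper triangular, such as those in \<open>x\<close> and \<open>l\<close>, the upper
  left entry of the derivation is additive: it is the logarithmic derivative of an eigenvalue.\<close>

definition peripheral :: "gen word \<Rightarrow> bool" where
  "peripheral w \<longleftrightarrow> E w $ 2 $ 1 = 0 \<and> F w $ 2 $ 1 = 0"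

lemma peripheral_append:
  assumes "peripheral v" "peripheral w"
  shows "peripheral (v @ w)" "F (v @ w) $ 1 $ 1 = F v $ 1 $ 1 + F w $ 1 $ 1"
  using assms conj2_upper[OF _ det_E, of v "F w"]
  by (auto simp: peripheral_def eval_word_append conjE.word_deriv_append matrix_matrix_mult_def sum_2)

lemma peripheral_inv_word:
  assumes "peripheral w"
  shows "peripheral (inv_word w)" "F (inv_word w) $ 1 $ 1 = - F w $ 1 $ 1"
proof -
  obtain a b c d where w: "E w = mat2 a b c d" using mat2_cases by blast
  have "a * d - b * c = 1" using det_E[of w] by (simp add: w)
  then have E: "E (inv_word w) $ 2 $ 1 = 0"
    using assms by (simp add: E_inv w matrix_inv_mat2 peripheral_def)
  then show "peripheral (inv_word w)" "F (inv_word w) $ 1 $ 1 = - F w $ 1 $ 1"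
    using assms conj2_upper[OF E det_E, of "F w"]
    by (auto simp: peripheral_def conjE.word_deriv_inv_word)
qed

lemma peripheral_pow_word:
  assumes "peripheral w"
  shows "peripheral (pow_word w n)" "F (pow_word w n) $ 1 $ 1 = of_int n * F w $ 1 $ 1"
proof -
  have *: "peripheral (concat (replicate k v)) \<and> F (concat (replicate k v)) $ 1 $ 1 = of_nat k * F v $ 1 $ 1"
    if "peripheral v" for v k
  proof (induction k)
    case 0
    then show ?case by (simp add: peripheral_def mat_def)
  next
    case (Suc k)
    then show ?case using peripheral_append[OF that, of "concat (replicate k v)"] by (simp add: algebra_simps)
  qed
  show "peripheral (pow_word w n)" "F (pow_word w n) $ 1 $ 1 = of_int n * F w $ 1 $ 1"
    using *[OF assms, of "nat n"] *[OF peripheral_inv_word(1)[OF assms], of "nat (- n)"] peripheral_inv_word(2)[OF assms]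
    by (auto simp: pow_word_def of_nat_nat)
qed

lemma F_peripheral:
  "F (pow_word word_x p @ pow_word word_l q) $ 1 $ 1 = of_int p * \<alpha> + of_int q * (\<eta> * (1 + \<zeta>) / (\<zeta> * (1 - \<zeta>)))"
proof -
  have x: "peripheral word_x" and l: "peripheral word_l"
    by (simp_all add: peripheral_def E_x F_x Xx E_longitude F_longitude)
  show ?thesis
    using peripheral_append(2)[OF peripheral_pow_word(1)[OF x, of p] peripheral_pow_word(1)[OF l, of q]]
      peripheral_pow_word(2)[OF x, of p] peripheral_pow_word(2)[OF l, of q]
    by (simp add: F_x Xx F_longitude)
qed

end

text \<open>Hence the only derivations that also vanish on the filling relator are coboundaries, unless
  the function \<open>p u + q v\<close> is stationary on the deformation curve.\<close>

lemma H1_filling_so31: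
  assumes rel: "spinor_map (E (pow_word word_x p @ pow_word word_l q)) = mat 1"
    and nonstationary: "\<And>\<alpha> \<eta>. (2 * \<zeta> + exp u - 1 - (exp u)\<^sup>2) * \<eta> +
        ((1 - 2 * exp u) * \<zeta> + 2 * exp u) * (- 2 * \<alpha> * exp u) = 0 \<Longrightarrow>
      of_int p * \<alpha> + of_int q * (\<eta> * (1 + \<zeta>) / (\<zeta> * (1 - \<zeta>))) = 0 \<Longrightarrow> \<alpha> = 0 \<and> \<eta> = 0"
    and f: "f \<in> Z1 (pi1_filling p q) (Ad (rho u \<zeta>)) so31"
  obtains m where "m \<in> so31" "\<And>g. g \<in> carrier (pi1_filling p q) \<Longrightarrow> f g = Ad (rho u \<zeta>) g m - m"
proof -
  define r where "r = pow_word word_x p @ pow_word word_l q"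
  interpret F: fig8_rep u \<zeta> "rel_M \<union> {r}"
    by unfold_locales (use relators rel in \<open>auto simp: r_def\<close>)
  interpret FG: group_rep "pi1_filling p q" "Ad (rho u \<zeta>)" so31
    unfolding pi1_filling_def r_def[symmetric] by (rule F.group_rep[OF invariant_so31])
  let ?c = "word_class (rel_M \<union> {r})"
  have f': "f \<in> Z1 (presented_group (rel_M \<union> {r})) (Ad (rho u \<zeta>)) so31"
    using f by (simp add: pi1_filling_def r_def)
  have c: "?c w \<in> carrier (pi1_filling p q)" for w by (simp add: pi1_filling_def r_def)
  have mult: "?c v \<otimes>\<^bsub>pi1_filling p q\<^esub> ?c w = ?c (v @ w)" for v w
    unfolding pi1_filling_def r_def[symmetric] by (rule mult_word_class)
  define P where "P w = sl2_of_so31 (f (?c w))" for w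
  have fP: "f (?c w) = spinor_deriv (P w)" for w
    unfolding P_def by (rule spinor_deriv_sl2_of_so31[symmetric]) (rule FG.Z1_closed[OF f c])
  define X where "X g = P [(g, True)]" for g
  have P0: "P w = 0" if "?c w = ?c []" for w
  proof -
    have "f (?c []) = 0" using FG.Z1_one[OF f] by (simp add: pi1_filling_def r_def)
    then show ?thesis using that by (simp add: P_def sl2_of_so31_def Let_def zero_eq_mat2 Complex_eq_0)
  qed
  have P: "P w = word_deriv conjE X w" for w
    unfolding X_def
  proof (rule conjE.derivation_eq_word_deriv)
    show "P (v @ w) = P v + conjE v (P w)" for v w
      using FG.Z1_mult[OF f c c, of v w] sl2_of_so31_spin_Ad[OF det_E FG.Z1_closed[OF f c], of v w]
      unfolding mult F.Ad_word_class P_def by (simp only: sl2_of_so31_add conj2_def)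
    show "P [(g, e), (g, \<not> e)] = 0" for g e
      by (rule P0) (simp only: word_class_eq_iff pres_eq.cancel)
  qed
  have rel0: "?c w = ?c []" if "w \<in> rel_M \<union> {r}" for w
    unfolding word_class_eq_iff by (rule pres_eq.relator[OF that])
  have Pw: "P word_w = 0" and Pr: "P r = 0" by (rule P0, rule rel0, simp add: rel_M_def)+
  obtain M \<alpha> \<beta> \<gamma> where M: "trace M = 0"
    and Xx: "X GX - (conjE word_x M - M) = mat2 \<alpha> 0 0 (- \<alpha>)"
    and Xy: "X GY - (conjE word_y M - M) = mat2 \<beta> 0 \<gamma> (- \<beta>)"
    by (rule normal_form[of X]) (simp_all only: X_def P_def trace_sl2_of_so31)
  define Y where "Y g = X g - (conjE [(g, True)] M - M)" for g
  have Y: "word_deriv conjE Y w = P w - (conjE w M - M)" for w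
  proof -
    have "Y = (\<lambda>g. X g + (- 1) *\<^sub>R (conjE [(g, True)] M - M))" by (simp add: Y_def fun_eq_iff)
    then have "word_deriv conjE Y w = P w + (- 1) *\<^sub>R (conjE w M - M)"
      by (simp only: conjE.word_deriv_add conjE.word_deriv_scale conjE.word_deriv_coboundary P)
    then show ?thesis by simp
  qed
  have Yx: "Y GX = mat2 \<alpha> 0 0 (- \<alpha>)" and Yy: "Y GY = mat2 \<beta> 0 \<gamma> (- \<beta>)"
    using Xx Xy by (simp_all only: Y_def word_x_def word_y_def)
  have Yw: "word_deriv conjE Y word_w = 0"
    by (simp add: Y Pw E_relator conj2_def)
  have Yr: "word_deriv conjE Y r = 0"
    by (simp only: Y Pr conj2_trivial[OF rel[folded r_def] det_E] diff_self)
  have "\<alpha> = 0 \<and> \<eta> \<gamma> = 0"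
  proof (rule nonstationary)
    show "(2 * \<zeta> + exp u - 1 - (exp u)\<^sup>2) * \<eta> \<gamma> + ((1 - 2 * exp u) * \<zeta> + 2 * exp u) * (- 2 * \<alpha> * exp u) = 0"
      using riley'_eq_0[OF Yx Yy Yw] by (simp only: riley'_def[OF Yx Yy Yw])
    show "of_int p * \<alpha> + of_int q * (\<eta> \<gamma> * (1 + \<zeta>) / (\<zeta> * (1 - \<zeta>))) = 0"
      using F_peripheral[OF Yx Yy Yw, of p q] Yr by (simp add: r_def)
  qed
  then have "\<alpha> = 0" "\<gamma> = 0" "\<beta> = 0"
    using \<beta>_eq[OF Yx Yy Yw] by (auto simp: \<eta>_def[OF Yx Yy Yw])
  then have "Y g = 0" for g using Yx Yy by (cases g) (simp_all add: zero_eq_mat2)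
  then have PM: "P [(g, True)] = conjE [(g, True)] M - M" for g by (simp add: Y_def X_def)
  have fg: "f (?c [(g, True)]) = act [(g, True)] (spinor_deriv M) - spinor_deriv M" for g
    unfolding fP PM by (simp add: spin_Ad_spinor_deriv det_rho_gen conj2_def spinor_deriv_diff)
  show ?thesis
  proof (rule that)
    show m: "spinor_deriv M \<in> so31" by (rule spinor_deriv_in_so31[OF M])
    show "f g = Ad (rho u \<zeta>) g (spinor_deriv M) - spinor_deriv M" if "g \<in> carrier (pi1_filling p q)" for g
      using F.Z1_coboundary_iff[OF invariant_so31 f' m _ _ that[unfolded pi1_filling_def r_def[symmetric]]]
        fg by (simp only: word_x_def word_y_def)
  qed
qed

end

section \<open>Dehn filling space\<close>

subsection \<open>Smoothness\<close>

text \<open>Real parts of exponential polynomials in \<open>u\<close> and its conjugate form a class of functions that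
  is closed under directional derivatives.\<close>

definition exp_sum :: "(complex \<times> complex \<times> complex \<times> 'b) list \<Rightarrow> complex \<Rightarrow> 'b::real_normed_vector" where
  "exp_sum T u = (\<Sum>(c, a, b, M)\<leftarrow>T. Re (c * exp (a * u + b * cnj u)) *\<^sub>R M)"

definition exp_sum_deriv :: "complex \<Rightarrow> (complex \<times> complex \<times> complex \<times> 'b) list \<Rightarrow> (complex \<times> complex \<times> complex \<times> 'b) list" where
  "exp_sum_deriv d T = map (\<lambda>(c, a, b, M). (c * (a * d + b * cnj d), a, b, M)) T"

lemma has_derivative_exp_sum:
  "(exp_sum T has_derivative (\<lambda>d. exp_sum (exp_sum_deriv d T) u)) (at u)"
proof (induction T)
  case Nil
  then show ?case by (simp add: exp_sum_def[abs_def] exp_sum_deriv_def)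
next
  case (Cons t T)
  obtain c a b M where t: "t = (c, a, b, M)" using prod_cases4 by blast
  have "((\<lambda>u. a * u + b * cnj u) has_derivative (\<lambda>d. a * d + b * cnj d)) (at u)"
    by (intro has_derivative_add has_derivative_mult_right has_derivative_ident has_derivative_cnj)
  then have "((\<lambda>u. exp (a * u + b * cnj u)) has_derivative
      (\<lambda>d. exp (a * u + b * cnj u) * (a * d + b * cnj d))) (at u)"
    by (rule has_derivative_compose[of _ _ _ _ exp, OF _ DERIV_exp[unfolded has_field_derivative_def]])
  then have "((\<lambda>u. Re (c * exp (a * u + b * cnj u)) *\<^sub>R M) has_derivative
      (\<lambda>d. Re (c * (exp (a * u + b * cnj u) * (a * d + b * cnj d))) *\<^sub>R M)) (at u)"
    by (intro has_derivative_scaleR_left has_derivative_Re has_derivative_mult_right)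
  from has_derivative_add[OF this Cons.IH] show ?case
    by (simp only: exp_sum_def[abs_def] exp_sum_deriv_def t list.map sum_list.Cons prod.case mult_ac)
qed

lemma C_times_exp_sum: "C_times n S (exp_sum T)"
proof (induction n arbitrary: T)
  case 0
  then show ?case
    using has_derivative_continuous[OF has_derivative_exp_sum]
    by (auto intro!: continuous_at_imp_continuous_on)
next
  case (Suc n)
  have "frechet_derivative (exp_sum T) (at s) = (\<lambda>d. exp_sum (exp_sum_deriv d T) s)" for s
    using frechet_derivative_at[OF has_derivative_exp_sum] by metis
  then show ?case
    unfolding C_times.simps
    using Suc.IH by (intro conjI ballI allI differentiableI[OF has_derivative_exp_sum]) simp
qed

lemma smooth_on_exp_sum: "smooth_on S (exp_sum T)"
  by (simp add: smooth_on_def C_times_exp_sum)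

definition fixed_vector :: "complex \<Rightarrow> real ^ 4 ^ 4" where
  "fixed_vector u = spinor_map (mat2 (1 - exp u) (- 2) 0 (exp u - 1))"

text \<open>The entries are real polynomials of degree at most two in the real and imaginary parts of
  \<open>exp u\<close>.\<close>

lemma smooth_on_fixed_vector: "smooth_on S fixed_vector"
proof -
  define h where "h k = spinor_map (mat2 (1 - k) (- 2) 0 (k - 1))" for k :: complex
  define M1 where "M1 = h 1 - h 0 - spinor_map (mat2 (- 1) 0 0 1)"
  define M2 where "M2 = h \<i> - h 0 - spinor_map (mat2 (- 1) 0 0 1)"
  define M3 where "M3 = spinor_map (mat2 (- 1) 0 0 1)"
  have h: "h k = h 0 + Re k *\<^sub>R M1 + Im k *\<^sub>R M2 + (Re k * Re k + Im k * Im k) *\<^sub>R M3" for k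
    unfolding M1_def M2_def M3_def h_def
    by (simp add: vec_eq_iff forall_4 spinor_map_nth algebra_simps add_divide_distrib diff_divide_distrib
        cmod_power2[unfolded power2_eq_square])
  have c: "Re k * Re k + Im k * Im k = Re (k * cnj k)" for k by simp
  have "fixed_vector u = exp_sum [(1, 0, 0, h 0), (1, 1, 0, M1), (- \<i>, 1, 0, M2), (1, 1, 1, M3)] u" for u
  proof -
    have "fixed_vector u = h 0 + Re (exp u) *\<^sub>R M1 + Im (exp u) *\<^sub>R M2 + Re (exp u * cnj (exp u)) *\<^sub>R M3"
      using h[of "exp u"] by (simp only: fixed_vector_def h_def[symmetric] c)
    then show ?thesis by (simp add: exp_sum_def exp_add exp_cnj del: complex_mult_cnj)
  qed
  then have "fixed_vector = exp_sum [(1, 0, 0, h 0), (1, 1, 0, M1), (- \<i>, 1, 0, M2), (1, 1, 1, M3)]" by (rule ext)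
  then show ?thesis by (rule ssubst) (rule smooth_on_exp_sum)
qed

subsection \<open>Stability of kernels\<close>

text \<open>If a family of linear maps has a continuous family of vectors in its kernel that spans the
  kernel at one parameter, then it spans the kernel at all nearby parameters, because the maps are
  bounded away from zero on the unit vectors orthogonal to it.\<close>

lemma kernel_stable:
  fixes L :: "complex \<Rightarrow> 'a::euclidean_space \<Rightarrow> 'a" and a :: "complex \<Rightarrow> 'a"
  assumes V: "subspace V" and U: "open U" "u \<in> U"
    and L: "\<And>w. w \<in> U \<Longrightarrow> linear (L w)" "continuous_on (U \<times> UNIV) (\<lambda>(w, X). L w X)"
    and a: "continuous_on U a" "\<And>w. w \<in> U \<Longrightarrow> a w \<in> V" "\<And>w. w \<in> U \<Longrightarrow> L w (a w) = 0"
    and ker: "\<And>X. X \<in> V \<Longrightarrow> L u X = 0 \<Longrightarrow> X \<in> span {a u}"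
  obtains N where "open N" "u \<in> N" "N \<subseteq> U" "\<And>w X. w \<in> N \<Longrightarrow> X \<in> V \<Longrightarrow> L w X = 0 \<Longrightarrow> X \<in> span {a w}"
proof -
  define K where "K = sphere 0 1 \<inter> V"
  have K: "compact K" unfolding K_def
    by (intro compact_Int_closed compact_sphere closed_subspace V)
  define g where "g = (\<lambda>(w, X). norm (L w X) + \<bar>X \<bullet> a w\<bar>)"
  have ca: "continuous_on (U \<times> UNIV) (\<lambda>p. a (fst p))" for UNIV :: "'a set"
    by (rule continuous_on_compose2[OF a(1) continuous_on_fst[OF continuous_on_id]]) auto
  have g: "continuous_on (U \<times> UNIV) g"
    unfolding g_def case_prod_unfold
    using L(2) ca by (intro continuous_intros) (simp_all add: case_prod_unfold)
  obtain N where N: "open N" "u \<in> N" "N \<subseteq> U" "\<And>w X. w \<in> N \<Longrightarrow> X \<in> K \<Longrightarrow> g (w, X) > 0"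
  proof (cases "K = {}")
    case False
    obtain e where e: "e > 0" "cball u e \<subseteq> U" using U open_contains_cball by blast
    have "continuous_on (cball u e \<times> K) g" by (rule continuous_on_subset[OF g]) (use e in auto)
    moreover have C: "compact (cball u e \<times> K)" by (intro compact_Times compact_cball K)
    ultimately have uc: "uniformly_continuous_on (cball u e \<times> K) g" by (rule compact_uniformly_continuous)
    have "continuous_on K (\<lambda>X. g (u, X))"
      by (rule continuous_on_compose2[OF g]) (use U in \<open>auto intro!: continuous_intros\<close>)
    then obtain X0 where X0: "X0 \<in> K" "\<And>X. X \<in> K \<Longrightarrow> g (u, X0) \<le> g (u, X)"
      using continuous_attains_inf[OF K False] by blast
    have "g (u, X0) > 0"
    proof (rule ccontr)
      assume "\<not> g (u, X0) > 0"
      then have "norm (L u X0) + \<bar>X0 \<bullet> a u\<bar> \<le> 0" by (simp add: g_def)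
      then have "norm (L u X0) = 0" "\<bar>X0 \<bullet> a u\<bar> = 0"
        using norm_ge_zero[of "L u X0"] abs_ge_zero[of "X0 \<bullet> a u"] by linarith+
      then have "L u X0 = 0" "X0 \<bullet> a u = 0" by auto
      then obtain c where "X0 = c *\<^sub>R a u" using ker[of X0] X0(1) by (auto simp: K_def span_singleton)
      then have "X0 \<bullet> X0 = 0" using \<open>X0 \<bullet> a u = 0\<close> by (metis inner_scaleR_right mult_zero_right)
      then show False using X0(1) by (simp add: K_def)
    qed
    then obtain d where d: "d > 0" "\<And>p p'. p \<in> cball u e \<times> K \<Longrightarrow> p' \<in> cball u e \<times> K \<Longrightarrow> dist p' p < d \<Longrightarrow> dist (g p') (g p) < g (u, X0)"
      using uc unfolding uniformly_continuous_on_def by metis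
    show ?thesis
    proof (rule that[of "ball u (min d e)"])
      fix w X assume w: "w \<in> ball u (min d e)" "X \<in> K"
      have "dist (w, X) (u, X) = dist u w" by (simp add: dist_prod_def dist_commute)
      then have "dist (g (w, X)) (g (u, X)) < g (u, X0)"
        using w e by (intro d(2)) (auto simp: dist_commute)
      then show "g (w, X) > 0" using X0(2)[OF w(2)] by (simp add: dist_real_def)
    qed (use d e in auto)
  next
    case True
    then show ?thesis using that[of U] U by auto
  qed
  show ?thesis
  proof (rule that[OF N(1-3)])
    fix w X assume w: "w \<in> N" and X: "X \<in> V" "L w X = 0"
    have wU: "w \<in> U" using w N by auto
    define c where "c = (X \<bullet> a w) / (a w \<bullet> a w)"
    define Y where "Y = X - c *\<^sub>R a w"
    have Y: "Y \<in> V" "L w Y = 0" "Y \<bullet> a w = 0"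
      using X a(2,3)[OF wU] V L(1)[OF wU]
      by (auto simp: Y_def c_def subspace_diff subspace_scale linear_diff linear_scale inner_diff_left)
    have "Y = 0"
    proof (rule ccontr)
      assume "Y \<noteq> 0"
      define Z where "Z = inverse (norm Y) *\<^sub>R Y"
      have "Z \<in> K" using \<open>Y \<noteq> 0\<close> Y V by (simp add: K_def Z_def subspace_scale)
      moreover have "g (w, Z) = 0" using Y L(1)[OF wU] by (simp add: g_def Z_def linear_scale)
      ultimately show False using N(4)[OF w] by fastforce
    qed
    then show "X \<in> span {a w}" by (simp add: Y_def span_mul span_base)
  qed
qed

subsection \<open>Derivatives along the curve of representations\<close>

text \<open>Continuity of a branch of simple roots suffices for implicit differentiation, because the
  increment of the Riley polynomial in \<open>\<zeta>\<close> factors.\<close>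

lemma riley_implicit:
  assumes U: "open U" "u \<in> U" and z: "continuous_on U z" "\<And>w. w \<in> U \<Longrightarrow> riley (exp w) (z w) = 0"
    and D: "2 * z u + exp u - 1 - (exp u)\<^sup>2 \<noteq> 0"
  shows "(z has_field_derivative - (((1 - 2 * exp u) * z u + 2 * exp u) * exp u)
      / (2 * z u + exp u - 1 - (exp u)\<^sup>2)) (at u)"
proof -
  define G where "G w = riley (exp w) (z u)" for w
  define H where "H w = z w + z u + exp w - 1 - (exp w)\<^sup>2" for w
  have G: "(G has_field_derivative ((1 - 2 * exp u) * z u + 2 * exp u) * exp u) (at u)"
    using has_field_derivative_riley[OF DERIV_exp[of u] DERIV_const[where k = "z u"]] by (simp add: G_def[abs_def])
  have zc: "isCont z u" using U z(1) by (simp add: continuous_on_eq_continuous_at)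
  then have Hc: "isCont H u" unfolding H_def by (intro continuous_intros)
  have Hu: "H u \<noteq> 0" using D by (simp add: H_def algebra_simps)
  have "eventually (\<lambda>w. H w \<noteq> 0) (at u)"
    using Hc Hu unfolding isCont_def by (rule tendsto_imp_eventually_ne)
  moreover have "eventually (\<lambda>w. w \<in> U) (at u)" using U by (rule eventually_at_in_open')
  ultimately have "eventually (\<lambda>w. - ((G w - G u) / (w - u)) / H w = (z w - z u) / (w - u)) (at u)"
  proof eventually_elim
    case (elim w)
    have "G w + (z w - z u) * H w = riley (exp w) (z w)"
      by (simp add: G_def H_def riley_def power2_eq_square algebra_simps)
    moreover have "G u = 0" using z(2)[OF U(2)] by (simp add: G_def)
    ultimately have "(z w - z u) * H w = - (G w - G u)"
      using z(2) elim by (simp add: eq_neg_iff_add_eq_0 add.commute)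
    then have "z w - z u = - (G w - G u) / H w" using elim by (simp add: nonzero_eq_divide_eq)
    then show ?case by (simp only: minus_divide_left[symmetric] divide_divide_eq_left mult.commute)
  qed
  moreover have "((\<lambda>w. - ((G w - G u) / (w - u)) / H w) \<longlongrightarrow> - (((1 - 2 * exp u) * z u + 2 * exp u) * exp u) / H u) (at u)"
    using G Hc Hu unfolding has_field_derivative_iff isCont_def by (intro tendsto_intros)
  ultimately have "((\<lambda>w. (z w - z u) / (w - u)) \<longlongrightarrow> - (((1 - 2 * exp u) * z u + 2 * exp u) * exp u) / H u) (at u)"
    by (rule Lim_transform_eventually[rotated])
  moreover have "H u = 2 * z u + exp u - 1 - (exp u)\<^sup>2" by (simp add: H_def)
  ultimately show ?thesis by (simp add: has_field_derivative_iff)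
qed

text \<open>Near \<open>u\<close>, the function \<open>f - f u\<close> stays in the strip on which \<open>Ln\<close> inverts \<open>exp\<close>.\<close>

lemma has_field_derivative_continuous_log:
  fixes f :: "complex \<Rightarrow> complex"
  assumes f: "isCont f u" and g: "(g has_field_derivative g') (at u)"
    and U: "open U" "u \<in> U" and eq: "\<And>w. w \<in> U \<Longrightarrow> exp (f w) = g w"
  shows "(f has_field_derivative g' / g u) (at u)"
proof -
  have gu: "g u \<noteq> 0" using eq[OF U(2)] by (metis exp_not_eq_zero)
  have "((\<lambda>w. g w / g u) has_field_derivative g' / g u) (at u)"
    by (rule DERIV_cdivide[OF g])
  moreover have "(Ln has_field_derivative inverse (g u / g u)) (at (g u / g u))"
    using gu by (intro has_field_derivative_Ln) simp
  ultimately have "((\<lambda>w. Ln (g w / g u)) has_field_derivative inverse (g u / g u) * (g' / g u)) (at u)"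
    by (rule DERIV_chain2[rotated])
  then have D: "((\<lambda>w. f u + Ln (g w / g u)) has_field_derivative 0 + g' / g u) (at u)"
    using gu by (intro DERIV_add DERIV_const) simp
  have "eventually (\<lambda>w. f u + Ln (g w / g u) = f w) (nhds u)"
  proof -
    have "((\<lambda>w. f w - f u) \<longlongrightarrow> 0) (nhds u)"
      using f unfolding isCont_def tendsto_at_iff_tendsto_nhds by (intro tendsto_eq_intros) auto
    then have "eventually (\<lambda>w. cmod (f w - f u) < pi) (nhds u)"
      by (auto dest!: tendstoD[of _ _ _ pi] simp: dist_norm)
    moreover have "eventually (\<lambda>w. w \<in> U) (nhds u)" using U by (rule eventually_nhds_in_open)
    ultimately show ?thesis
    proof eventually_elim
      case (elim w)
      have "g w / g u = exp (f w - f u)" using eq elim U(2) by (simp add: exp_diff)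
      moreover have "\<bar>Im (f w - f u)\<bar> < pi" using elim abs_Im_le_cmod[of "f w - f u"] by linarith
      ultimately show ?case by (simp add: Ln_exp abs_less_iff)
    qed
  qed
  from DERIV_cong_ev[THEN iffD1, OF HOL.refl this HOL.refl D] show ?thesis by simp
qed

subsection \<open>The shape equations\<close>

text \<open>With \<open>k = z1 (1 - z2)\<close>, the first shape equation says that \<open>k\<^sup>2 = (1 - z1) z2\<close>; eliminating \<open>z1\<close> gives
  the Riley polynomial.\<close>

lemma shape_equation_imp_riley:
  assumes Im: "0 < Im z1" "0 < Im z2"
    and shape: "2 * Ln z1 + Ln (1 / (1 - z1)) + Ln z2 + 2 * Ln (1 - 1 / z2) = 2 * of_real pi * \<i>"
    and k: "k = z1 * (1 - z2)"
  shows "riley k z2 = 0"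
proof -
  have nz: "z1 \<noteq> 0" "z2 \<noteq> 0" "1 - z1 \<noteq> 0" "1 - z2 \<noteq> 0" using Im by auto
  then have nz': "1 - 1 / z2 \<noteq> 0" by (simp add: field_simps)
  have "exp (2 * Ln z1 + Ln (1 / (1 - z1)) + Ln z2 + 2 * Ln (1 - 1 / z2)) = 1"
    unfolding shape by (rule exp_two_pi_i)
  then have "z1\<^sup>2 * (1 / (1 - z1)) * z2 * (1 - 1 / z2)\<^sup>2 = 1"
    using nz nz' by (simp add: exp_add exp_double)
  moreover have "1 - 1 / z2 = (z2 - 1) / z2" using nz by (simp add: diff_divide_distrib)
  ultimately have "z1\<^sup>2 * (1 / (1 - z1)) * z2 * ((z2 - 1) / z2)\<^sup>2 = 1" by simp
  moreover have "z1\<^sup>2 * (1 / (1 - z1)) * z2 * ((z2 - 1) / z2)\<^sup>2 = z1\<^sup>2 * (z2 - 1)\<^sup>2 / ((1 - z1) * z2)"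
    using nz by (simp add: power2_eq_square)
  ultimately have "z1\<^sup>2 * (z2 - 1)\<^sup>2 = (1 - z1) * z2"
    using nz by (simp add: divide_eq_1_iff)
  moreover have "(z2 - 1)\<^sup>2 = (1 - z2)\<^sup>2" by (simp add: power2_eq_square algebra_simps)
  ultimately have k2: "k\<^sup>2 = (1 - z1) * z2" by (simp add: k power_mult_distrib)
  have "riley k z2 = z2\<^sup>2 + (k - 1) * z2 + k\<^sup>2 * (1 - z2)" by (simp add: riley_def algebra_simps)
  also have "\<dots> = 0" unfolding k2 by (simp add: k power2_eq_square algebra_simps)
  finally show ?thesis .
qed

text \<open>At a double root, \<open>k = \<plusminus> \<zeta>\<close>. One sign makes \<open>\<zeta>\<close> real, the other one makes \<open>z1 = 1 / \<zeta>\<close> lie in the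
  lower half plane, so that a tetrahedron would be degenerate or negatively oriented.\<close>

lemma riley_simple_root:
  assumes Im: "0 < Im z1" "0 < Im \<zeta>" and k: "k = z1 * (1 - \<zeta>)" and riley: "riley k \<zeta> = 0"
  shows "2 * \<zeta> + k - 1 - k\<^sup>2 \<noteq> 0"
proof
  assume D: "2 * \<zeta> + k - 1 - k\<^sup>2 = 0"
  then have e: "k - 1 - k\<^sup>2 = - 2 * \<zeta>" by (simp add: eq_neg_iff_add_eq_0 algebra_simps)
  have "(k - \<zeta>) * (k + \<zeta>) = 0"
    using riley unfolding riley_def e by (simp add: power2_eq_square algebra_simps)
  then consider "k = \<zeta>" | "k = - \<zeta>" by (auto simp: eq_neg_iff_add_eq_0)
  then show False
  proof cases
    case 1
    then have "\<zeta>\<^sup>2 = 3 * \<zeta> - 1" using D by (simp add: algebra_simps)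
    then have "Re (\<zeta>\<^sup>2) = 3 * Re \<zeta> - 1" "Im (\<zeta>\<^sup>2) = 3 * Im \<zeta>" by simp_all
    then have re: "Re \<zeta> * Re \<zeta> - Im \<zeta> * Im \<zeta> = 3 * Re \<zeta> - 1" and "2 * (Re \<zeta> * Im \<zeta>) = 3 * Im \<zeta>"
      by (simp_all add: power2_eq_square)
    then have re2: "Re \<zeta> = 3 / 2" using Im by simp
    then have "Re \<zeta> * Re \<zeta> = 9 / 4" by (simp only:)
    with re2 have "Im \<zeta> * Im \<zeta> = - 5 / 4" using re by linarith
    then show False using mult_pos_pos[OF Im(2) Im(2)] by simp
  next
    case 2
    have "(1 - \<zeta>) + \<zeta>\<^sup>2 = - (2 * \<zeta> + k - 1 - k\<^sup>2)" unfolding 2 by simp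
    then have z: "1 - \<zeta> = - \<zeta>\<^sup>2" using D by (simp only: eq_neg_iff_add_eq_0 minus_zero)
    have "\<zeta> \<noteq> 0" using Im by auto
    moreover have "- \<zeta> = z1 * (- \<zeta>\<^sup>2)" using k 2 z by simp
    ultimately have "z1 * \<zeta> = 1" by (simp add: power2_eq_square)
    then have z1: "z1 = inverse \<zeta>" using \<open>\<zeta> \<noteq> 0\<close> by (simp add: field_simps)
    have "Im (inverse \<zeta>) < 0"
      using Im(2) \<open>\<zeta> \<noteq> 0\<close> by (simp add: divide_neg_pos sum_power2_gt_zero_iff complex_eq_iff)
    then show False using Im z1 by simp
  qed
qed

text \<open>If \<open>x\<close> is parabolic, its invariants in \<open>frak_v\<close> are not just a line: with \<open>e\<close> the
  logarithm of \<open>x\<close>, both \<open>e \<otimes> e\<^sup>*\<close> and the antisymmetric part of \<open>e \<otimes> h\<^sup>*\<close> are fixed for the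
  diagonal matrix \<open>h\<close>.\<close>

lemma parabolic_dim_neq_1:
  assumes riley: "riley (exp u) \<zeta> = 0" and k: "exp u = 1"
  shows "dim (H0 cyc_x (Ad (rho u \<zeta>)) frak_v) \<noteq> 1"
proof
  interpret fig8_rep u \<zeta> rel_M
    by unfold_locales (simp add: rel_M_def eval_word_w[OF riley])
  interpret M: group_rep pi1_M "Ad (rho u \<zeta>)" frak_v
    unfolding pi1_M_def by (rule group_rep[OF invariant_frak_v])
  define S where "S = {X \<in> frak_v. act word_x X = X}"
  assume "dim (H0 cyc_x (Ad (rho u \<zeta>)) frak_v) = 1"
  moreover have "H0 cyc_x (Ad (rho u \<zeta>)) frak_v = S"
    unfolding cyc_x_def S_def
    by (subst M.H0_subgroup_generated) (auto simp: elem_x_def pi1_M_def Ad_word_class)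
  ultimately have dim: "dim S = 1" by simp
  define n where "n = exp (- u / 2)"
  define m where "m = exp (u / 2)"
  have mn: "m * n = 1" and mm: "m * m = 1" using k by (simp_all add: m_def n_def flip: exp_add)
  then have "m = n" by (metis mult_left_cancel mult_zero_left zero_neq_one)
  then have nn: "n * n = 1" "n * (n * z) = z" for z using mm mult.assoc[of n n z] by simp_all
  have x: "E word_x = mat2 n (- n) 0 n"
    using \<open>m = n\<close> by (simp add: rho_gen_eq_fig8_gen word_x_def m_def n_def)
  have act: "act word_x (spinor_map (mat2 a b 0 d)) = spinor_map (mat2 a (a + b - d) 0 d)" for a b d
    unfolding spin_Ad_spinor_map x
    using nn by (simp add: matrix_inv_mat2 algebra_simps)
  define e where "e = spinor_map (mat2 0 1 0 0)"
  define f where "f = spinor_map (mat2 1 \<i> 0 (- 1)) - spinor_map (mat2 1 0 0 (- 1))"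
  have "e \<in> S" using act[of 0 1 0] by (simp add: S_def e_def spinor_map_in_frak_v)
  moreover have "f \<in> S"
  proof -
    have "act word_x f = spinor_map (mat2 1 (2 + \<i>) 0 (- 1)) - spinor_map (mat2 1 2 0 (- 1))"
      unfolding f_def using act[of 1 \<i> "- 1"] act[of 1 0 "- 1"] by (simp add: linear_diff[OF linear_spin_Ad])
    also have "\<dots> = f"
      by (simp add: f_def vec_eq_iff forall_4 spinor_map_nth)
    finally show ?thesis
      unfolding S_def f_def by (auto intro!: subspace_diff[OF subspace_frak_v] spinor_map_in_frak_v)
  qed
  moreover have ent: "e $ 4 $ 4 \<noteq> 0" "e $ 2 $ 4 = 0" "f $ 2 $ 4 \<noteq> 0"
    by (simp_all add: e_def f_def spinor_map_nth)
  moreover have "subspace S"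
    unfolding S_def using linear_add[OF linear_spin_Ad] linear_scale[OF linear_spin_Ad] subspace_frak_v
    by (auto simp: subspace_def)
  moreover have "e \<noteq> 0" using ent by auto
  ultimately have "f \<in> span {e}" using span_singleton_eq_if_dim_1[OF _ dim, of e] by auto
  then obtain c where "f = c *\<^sub>R e" by (auto simp: span_singleton)
  then show False using \<open>e $ 2 $ 4 = 0\<close> \<open>f $ 2 $ 4 \<noteq> 0\<close> by simp
qed

subsection \<open>Continuity of the representations\<close>

lemma continuous_on_matrix_mult:
  fixes A :: "'a::topological_space \<Rightarrow> 'b::real_normed_algebra_1 ^ 'n ^ 'm"
  assumes "continuous_on S A" "continuous_on S B"
  shows "continuous_on S (\<lambda>s. A s ** B s)"
  unfolding matrix_matrix_mult_def
  by (intro continuous_on_vec_lambda continuous_intros assms)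

lemma continuous_on_mat2:
  assumes "continuous_on S a" "continuous_on S b" "continuous_on S c" "continuous_on S d"
  shows "continuous_on S (\<lambda>s. mat2 (a s) (b s) (c s) (d s) :: complex ^ 2 ^ 2)"
proof -
  have eq: "mat2 (a s) (b s) (c s) (d s) = (\<chi> i j. if i = 1 then if j = 1 then a s else b s else if j = 1 then c s else d s)"
    for s by (simp add: mat2_eq_iff)
  show ?thesis
    unfolding eq
    apply (intro continuous_on_vec_lambda)
    subgoal for i j by (cases "i = 1"; cases "j = 1") (simp_all add: assms)
    done
qed

lemma continuous_on_spinor_map:
  assumes "continuous_on S A"
  shows "continuous_on S (\<lambda>s. spinor_map (A s))"
proof -
  have ct: "continuous_on S (\<lambda>s. ctranspose (A s))"
    unfolding ctranspose_def by (intro continuous_on_vec_lambda continuous_intros assms)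
  have hc: "continuous_on S (\<lambda>s. hermitian_coords (M s))" if "continuous_on S M" for M
  proof -
    have "continuous_on UNIV hermitian_coords"
      using linear_hermitian_coords by (simp add: linear_continuous_on linear_conv_bounded_linear)
    from continuous_on_compose2[OF this that] show ?thesis by simp
  qed
  have eq: "spinor_map (A s) = (\<chi> i j. hermitian_coords (A s ** hermitian (axis j 1) ** ctranspose (A s)) $ i)" for s
    by (simp add: vec_eq_iff spinor_map_nth)
  show ?thesis
    unfolding eq
    by (intro continuous_on_vec_lambda continuous_on_component hc continuous_on_matrix_mult assms ct continuous_on_const)
qed

lemma continuous_on_eval_word:
  assumes "continuous_on S z"
  shows "continuous_on S (\<lambda>w. eval_word (rho_gen w (z w)) r)"
proof (induction r)
  case (Cons l r)
  obtain g e where l: "l = (g, e)" by fastforce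
  have mn: "exp (w / 2) * exp (- w / 2) = 1" for w :: complex by (simp flip: exp_add)
  have "continuous_on S (\<lambda>w. if e then rho_gen w (z w) g else matrix_inv (rho_gen w (z w) g))"
  proof (cases g)
    case GX
    have "matrix_inv (rho_gen w (z w) GX) = mat2 (exp (w / 2)) (exp (- w / 2)) 0 (exp (- w / 2))" for w
      using mn[of w] unfolding rho_gen_eq_fig8_gen by (simp add: matrix_inv_mat2 mult.commute)
    moreover have "rho_gen w (z w) GX = mat2 (exp (- w / 2)) (- exp (- w / 2)) 0 (exp (w / 2))" for w
      unfolding rho_gen_eq_fig8_gen by simp
    ultimately show ?thesis
      using GX by (cases e) (simp_all only: if_True if_False, auto intro!: continuous_on_mat2 continuous_intros)
  next
    case GY
    have "matrix_inv (rho_gen w (z w) GY) = mat2 (exp (- w / 2)) 0 (z w * exp (- w / 2)) (exp (w / 2))" for w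
      using mn[of w] unfolding rho_gen_eq_fig8_gen by (simp add: matrix_inv_mat2 mult.commute)
    moreover have "rho_gen w (z w) GY = mat2 (exp (w / 2)) 0 (- z w * exp (- w / 2)) (exp (- w / 2))" for w
      unfolding rho_gen_eq_fig8_gen by simp
    ultimately show ?thesis
      using GY by (cases e) (simp_all only: if_True if_False, auto intro!: continuous_on_mat2 continuous_intros assms)
  qed
  then show ?case
    using Cons.IH by (simp only: l eval_word.simps) (intro continuous_on_matrix_mult)
qed simp

lemma continuous_on_spin_Ad:
  assumes "continuous_on S z" and "continuous_on T X" and "\<And>t. t \<in> T \<Longrightarrow> p t \<in> S" "continuous_on T p"
  shows "continuous_on T (\<lambda>t. spin_Ad (eval_word (rho_gen (p t) (z (p t))) r) (X t))"
proof -
  have inv: "matrix_inv (eval_word (rho_gen w (z w)) r) = eval_word (rho_gen w (z w)) (inv_word r)" for w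
    by (rule eval_word_inv_word[symmetric]) (rule det_rho_gen)
  have "continuous_on T (\<lambda>t. spinor_map (eval_word (rho_gen (p t) (z (p t))) v))" for v
    by (intro continuous_on_compose2[OF continuous_on_spinor_map[OF continuous_on_eval_word[OF assms(1)]] assms(4)])
      (use assms(3) in auto)
  then show ?thesis
    unfolding spin_Ad_def inv by (intro continuous_on_matrix_mult assms(2))
qed

subsection \<open>Properties of points of Dehn filling space\<close>

locale filling_space =
  fixes U :: "complex set" and z1 z2 v :: "complex \<Rightarrow> complex"
  assumes dfs: "dehn_filling_space U z1 z2 v"
begin

lemma open_U: "open U" and cont_z2: "continuous_on U z2" and cont_v: "continuous_on U v"
  using dfs by (simp_all add: dehn_filling_space_def)

lemma riley_z2:
  assumes "w \<in> U"
  shows "riley (exp w) (z2 w) = 0" "0 < Im (z2 w)" "2 * z2 w + exp w - 1 - (exp w)\<^sup>2 \<noteq> 0"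
    "exp (v w / 2) = - (1 - z2 w)\<^sup>2 / z2 w"
proof -
  have *: "0 < Im (z1 w)" "0 < Im (z2 w)" "exp w = z1 w * (1 - z2 w)"
    "2 * Ln (z1 w) + Ln (1 / (1 - z1 w)) + Ln (z2 w) + 2 * Ln (1 - 1 / z2 w) = 2 * of_real pi * \<i>"
    "exp (v w / 2) = - (1 - z2 w)\<^sup>2 / z2 w"
    using dfs assms unfolding dehn_filling_space_def by blast+
  show r: "riley (exp w) (z2 w) = 0" by (rule shape_equation_imp_riley[OF *(1,2,4,3)])
  show "0 < Im (z2 w)" "exp (v w / 2) = - (1 - z2 w)\<^sup>2 / z2 w" by (rule *)+
  show "2 * z2 w + exp w - 1 - (exp w)\<^sup>2 \<noteq> 0" by (rule riley_simple_root[OF *(1,2,3) r])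
qed

lemma fig8_knot: "w \<in> U \<Longrightarrow> exp w \<noteq> 1 \<Longrightarrow> fig8_knot w (z2 w)"
  using riley_z2 by unfold_locales auto

lemma fixv_eq: "w \<in> U \<Longrightarrow> exp w \<noteq> 1 \<Longrightarrow> fig8_knot.fixv w = fixed_vector w"
  using fig8_knot.fixv_def[OF fig8_knot] fig8_knot.h_def[OF fig8_knot] by (simp add: fixed_vector_def)

text \<open>Both dimension hypotheses bound the kernel of a continuous family of linear maps, and
  \<open>fixv\<close> and its coboundary provide continuous families of vectors in these kernels.\<close>

lemma exists_regular_neighbourhood:
  assumes u: "u \<in> U" "exp u \<noteq> 1"
    and dwdy: "dim {X \<in> frak_v. fox_dwdy u (z2 u) X = 0} = 1"
    and x: "dim (H0 cyc_x (Ad (rho u (z2 u))) frak_v) = 1"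
  obtains N where "open N" "u \<in> N" "N \<subseteq> U" "\<And>w. w \<in> N \<Longrightarrow> fig8_regular w (z2 w)"
proof -
  define W where "W = U \<inter> (exp -` (- {1}))"
  have W: "open W" "u \<in> W" "W \<subseteq> U"
    unfolding W_def using u by (auto intro!: open_Int open_U open_vimage continuous_intros)
  have knot: "fig8_knot w (z2 w)" if "w \<in> W" for w using that fig8_knot by (auto simp: W_def)
  have cz: "continuous_on W z2" by (rule continuous_on_subset[OF cont_z2 W(3)])
  define act where "act w r = spin_Ad (eval_word (rho_gen w (z2 w)) r)" for w r
  have lin: "linear (act w r)" for w r unfolding act_def by (rule linear_spin_Ad)
  have fv: "continuous_on S fixed_vector" for S
    using smooth_on_fixed_vector[of S] unfolding smooth_on_def by (metis C_times.simps(1))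
  have fv_v: "fixed_vector w \<in> frak_v" for w
    unfolding fixed_vector_def by (rule spinor_map_in_frak_v) simp
  have cact: "continuous_on (W \<times> UNIV) (\<lambda>p. act (fst p) r (snd p))" for r
    unfolding act_def by (intro continuous_on_spin_Ad[OF cz] continuous_intros) auto
  have fixw: "fig8_knot.fixv w = fixed_vector w" if "w \<in> W" for w using that fixv_eq by (auto simp: W_def)
  have act_x: "act w word_x (fixed_vector w) = fixed_vector w" if "w \<in> W" for w
    using fig8_knot.act_x_fixv[OF knot[OF that]] fixw[OF that] by (simp add: act_def)
  interpret K: fig8_knot u "z2 u" by (rule knot[OF W(2)])
  interpret M: group_rep pi1_M "Ad (rho u (z2 u))" frak_v
    unfolding pi1_M_def by (rule K.group_rep[OF K.invariant_frak_v])
  have actu: "act u r = K.act r" for r by (simp add: act_def)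
  have kerx: "X \<in> span {fixed_vector u}" if X: "X \<in> frak_v" "act u word_x X - X = 0" for X
  proof -
    have "H0 cyc_x (Ad (rho u (z2 u))) frak_v = {X \<in> frak_v. K.act word_x X = X}"
      unfolding cyc_x_def by (subst M.H0_subgroup_generated) (auto simp: elem_x_def pi1_M_def K.Ad_word_class)
    then have d: "dim {X \<in> frak_v. K.act word_x X = X} = 1" using x by simp
    have "subspace {X \<in> frak_v. K.act word_x X = X}"
      using linear_add[OF linear_spin_Ad] linear_scale[OF linear_spin_Ad] subspace_frak_v
      by (auto simp: subspace_def)
    from span_singleton_eq_if_dim_1[OF this d, of K.fixv] show ?thesis
      using X K.fixv_in_frak_v K.act_x_fixv K.fixv_nonzero by (auto simp: actu fixw[OF W(2)])
  qed
  obtain N1 where N1: "open N1" "u \<in> N1" "N1 \<subseteq> W"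
    "\<And>w X. w \<in> N1 \<Longrightarrow> X \<in> frak_v \<Longrightarrow> act w word_x X - X = 0 \<Longrightarrow> X \<in> span {fixed_vector w}"
  proof (rule kernel_stable[OF subspace_frak_v W(1,2), of "\<lambda>w X. act w word_x X - X" fixed_vector])
    show "linear (\<lambda>X. act w word_x X - X)" for w by (intro linear_compose_sub lin linear_ident)
    show "continuous_on (W \<times> UNIV) (\<lambda>(w, X). act w word_x X - X)"
      unfolding case_prod_unfold by (intro continuous_intros cact)
  qed (use act_x fv fv_v kerx in auto)
  define b where "b w = act w word_y (fixed_vector w) - fixed_vector w" for w
  define L where "L w X = (\<Sum>(s, r)\<leftarrow>fox_deriv GY word_w. of_int s *\<^sub>R act w r X)" for w X
  have L: "fox_dwdy w (z2 w) X = L w X" if "w \<in> W" for w X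
  proof -
    interpret fig8_knot w "z2 w" by (rule knot[OF that])
    show ?thesis by (simp add: fox_dwdy_def L_def act_def Ad_word_class)
  qed
  have cL: "continuous_on (W \<times> UNIV) (\<lambda>p. L (fst p) (snd p))"
  proof -
    have "continuous_on (W \<times> UNIV) (\<lambda>p. \<Sum>(s, r)\<leftarrow>T. real_of_int s *\<^sub>R act (fst p) r (snd p))" for T
      by (induction T) (auto intro!: continuous_intros cact)
    then show ?thesis unfolding L_def .
  qed
  have linL: "linear (L w)" if "w \<in> W" for w
    using fig8_knot.linear_fox_dwdy[OF knot[OF that]] L[OF that] by (metis ext)
  have "b u \<noteq> 0" using K.act_y_fixv fixw[OF W(2)] by (simp add: b_def actu)
  obtain N2 where N2: "open N2" "u \<in> N2" "N2 \<subseteq> W"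
    "\<And>w X. w \<in> N2 \<Longrightarrow> X \<in> frak_v \<Longrightarrow> L w X = 0 \<Longrightarrow> X \<in> span {b w}"
  proof (rule kernel_stable[OF subspace_frak_v W(1,2), of L b])
    show "continuous_on (W \<times> UNIV) (\<lambda>(w, X). L w X)" unfolding case_prod_unfold by (rule cL)
    show "continuous_on W b"
      unfolding b_def act_def by (intro continuous_on_diff continuous_on_spin_Ad[OF cz] fv continuous_on_id) simp
    show bv: "b w \<in> frak_v" if "w \<in> W" for w
      unfolding b_def act_def
      by (intro subspace_diff subspace_frak_v spin_Ad_closed fv_v) (rule det_eval_word, rule det_rho_gen)
    show b0: "L w (b w) = 0" if "w \<in> W" for w
      using fig8_knot.fox_dwdy_coboundary[OF knot[OF that]] L[OF that] fixw[OF that] by (simp add: b_def act_def)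
    show "X \<in> span {b u}" if X: "X \<in> frak_v" "L u X = 0" for X
    proof -
      have d: "dim {X \<in> frak_v. L u X = 0} = 1" using dwdy L[OF W(2)] by simp
      have "subspace {X \<in> frak_v. L u X = 0}"
        using linL[OF W(2)] subspace_frak_v by (auto simp: subspace_def linear_add linear_scale linear_0)
      from span_singleton_eq_if_dim_1[OF this d, of "b u"] show ?thesis
        using X bv[OF W(2)] b0[OF W(2)] \<open>b u \<noteq> 0\<close> by auto
    qed
  qed (use linL in auto)
  show ?thesis
  proof (rule that[of "N1 \<inter> N2"])
    fix w assume w: "w \<in> N1 \<inter> N2"
    then have wW: "w \<in> W" using N1 by auto
    interpret Kw: fig8_knot w "z2 w" by (rule knot[OF wW])
    show "fig8_regular w (z2 w)"
    proof
      show "X \<in> span {Kw.fixv}" if "X \<in> frak_v" "Kw.act word_x X = X" for X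
        using N1(4)[of w X] that w fixw[OF wW] by (simp add: act_def)
      show "X \<in> span {Kw.act word_y Kw.fixv - Kw.fixv}" if "X \<in> frak_v" "fox_dwdy w (z2 w) X = 0" for X
        using N2(4)[of w X] that w fixw[OF wW] L[OF wW] by (simp add: act_def b_def)
    qed
  qed (use N1 N2 W in auto)
qed

lemma has_field_derivative_z2_v:
  assumes u: "u \<in> U"
  obtains z' where "(z2 has_field_derivative z') (at u)"
    "(2 * z2 u + exp u - 1 - (exp u)\<^sup>2) * z' = - (((1 - 2 * exp u) * z2 u + 2 * exp u) * exp u)"
    "(v has_field_derivative - 2 * (z' * (1 + z2 u) / (z2 u * (1 - z2 u)))) (at u)"
proof -
  let ?\<zeta> = "z2 u"
  define z' where "z' = - (((1 - 2 * exp u) * ?\<zeta> + 2 * exp u) * exp u) / (2 * ?\<zeta> + exp u - 1 - (exp u)\<^sup>2)"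
  have z': "(z2 has_field_derivative z') (at u)"
    unfolding z'_def by (rule riley_implicit[OF open_U u cont_z2 riley_z2(1) riley_z2(3)[OF u]])
  have nz: "?\<zeta> \<noteq> 0" "1 - ?\<zeta> \<noteq> 0" using riley_z2(2)[OF u] by auto
  have vc: "isCont (\<lambda>w. v w / 2) u"
    using cont_v open_U u by (intro continuous_intros) (simp_all add: continuous_on_eq_continuous_at)
  have "((\<lambda>w. - (1 - z2 w)\<^sup>2 / z2 w) has_field_derivative
      (- (of_nat 2 * ((0 - z') * (1 - ?\<zeta>) ^ (2 - Suc 0))) * ?\<zeta> - (- (1 - ?\<zeta>)\<^sup>2) * z') / (?\<zeta> * ?\<zeta>)) (at u)"
    by (intro DERIV_divide DERIV_minus DERIV_power DERIV_diff DERIV_const z' nz)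
  from has_field_derivative_continuous_log[OF vc this open_U u riley_z2(4)]
  have "((\<lambda>w. v w / 2) has_field_derivative
      ((- (of_nat 2 * ((0 - z') * (1 - ?\<zeta>) ^ (2 - Suc 0))) * ?\<zeta> - (- (1 - ?\<zeta>)\<^sup>2) * z') / (?\<zeta> * ?\<zeta>))
        / (- (1 - ?\<zeta>)\<^sup>2 / ?\<zeta>)) (at u)" .
  moreover have "((- (of_nat 2 * ((0 - z') * (1 - ?\<zeta>) ^ (2 - Suc 0))) * ?\<zeta> - (- (1 - ?\<zeta>)\<^sup>2) * z') / (?\<zeta> * ?\<zeta>))
        / (- (1 - ?\<zeta>)\<^sup>2 / ?\<zeta>) = - (z' * (1 + ?\<zeta>) / (?\<zeta> * (1 - ?\<zeta>)))"
  proof -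
    have "- (of_nat 2 * ((0 - z') * (1 - ?\<zeta>) ^ (2 - Suc 0))) * ?\<zeta> - (- (1 - ?\<zeta>)\<^sup>2) * z' = (1 - ?\<zeta>) * (z' * (1 + ?\<zeta>))"
      by (simp add: power2_eq_square algebra_simps)
    then show ?thesis using nz by (simp add: power2_eq_square)
  qed
  ultimately have "((\<lambda>w. v w / 2) has_field_derivative - (z' * (1 + ?\<zeta>) / (?\<zeta> * (1 - ?\<zeta>)))) (at u)" by (simp only:)
  from DERIV_cmult[OF this, of 2]
  have "(v has_field_derivative 2 * - (z' * (1 + ?\<zeta>) / (?\<zeta> * (1 - ?\<zeta>)))) (at u)" by simp
  then have "(v has_field_derivative - 2 * (z' * (1 + ?\<zeta>) / (?\<zeta> * (1 - ?\<zeta>)))) (at u)" by simp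
  moreover have "(2 * ?\<zeta> + exp u - 1 - (exp u)\<^sup>2) * z' = - (((1 - 2 * exp u) * ?\<zeta> + 2 * exp u) * exp u)"
    using riley_z2(3)[OF u] by (simp add: z'_def)
  ultimately show ?thesis using that z' by blast
qed

lemma filling_coeffs_eq:
  assumes "u \<in> U - {0}"
  shows "filling_eq u (v u) (filling_coeffs v u)" "filling_eq u (v u) pq \<Longrightarrow> pq = filling_coeffs v u"
proof -
  have ex: "\<exists>!pq. filling_eq u (v u) pq" using dfs assms unfolding dehn_filling_space_def by blast
  show "filling_eq u (v u) (filling_coeffs v u)" unfolding filling_coeffs_def by (rule theI'[OF ex])
  then show "filling_eq u (v u) pq \<Longrightarrow> pq = filling_coeffs v u" using ex by blast
qed

text \<open>Differentiating \<open>p u + q v = 2 \<pi> i\<close> shows that where \<open>p + q dv/du\<close> vanishes, so does the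
  differential of \<open>u \<mapsto> (p, q)\<close>, which is invertible.\<close>

lemma filling_slope_nonzero:
  assumes u: "u \<in> U - {0}" and v': "(v has_field_derivative v') (at u)"
  shows "of_real (fst (filling_coeffs v u)) + of_real (snd (filling_coeffs v u)) * v' \<noteq> 0"
proof
  let ?W = "U - {0}" and ?f = "filling_coeffs v"
  let ?p = "complex_of_real (fst (?f u))" and ?q = "complex_of_real (snd (?f u))"
  assume pq0: "?p + ?q * v' = 0"
  have diffeo: "diffeomorphism ?W (?f ` ?W) ?f" using dfs unfolding dehn_filling_space_def by blast
  have diff: "g differentiable (at x)" if "smooth_on S g" "x \<in> S" for S x and g :: "'a::real_normed_vector \<Rightarrow> 'b::real_normed_vector"
    using that unfolding smooth_on_def by (metis C_times.simps(2))
  have inj: "inj_on ?f ?W" and W: "open ?W"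
    using diffeo by (auto simp: diffeomorphism_def bij_betw_def)
  obtain f' where f': "(?f has_derivative f') (at u)"
    using diff[of ?W ?f u] diffeo u by (auto simp: diffeomorphism_def differentiable_def)
  obtain g' where g': "(inv_into ?W ?f has_derivative g') (at (?f u))"
    using diff[of "?f ` ?W" "inv_into ?W ?f" "?f u"] diffeo u by (auto simp: diffeomorphism_def differentiable_def)
  have "((\<lambda>w. inv_into ?W ?f (?f w)) has_derivative (\<lambda>h. g' (f' h))) (at u)"
    by (rule has_derivative_compose[OF f' g'])
  then have "((\<lambda>w. w) has_derivative (\<lambda>h. g' (f' h))) (at u)"
    by (rule has_derivative_transform_within_open[OF _ W u]) (simp add: inj inv_into_f_f)
  then have id: "g' (f' h) = h" for h
    using has_derivative_unique[OF has_derivative_ident] by metis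
  have vd: "(v has_derivative (\<lambda>h. v' * h)) (at u)"
    using v' by (simp add: has_field_derivative_def)
  have "((\<lambda>w. of_real (fst (?f w)) * w + of_real (snd (?f w)) * v w) has_derivative
      (\<lambda>h. (?p * h + of_real (fst (f' h)) * u) + (?q * (v' * h) + of_real (snd (f' h)) * v u))) (at u)"
    by (intro has_derivative_add has_derivative_mult has_derivative_of_real has_derivative_fst
        has_derivative_snd f' has_derivative_ident vd)
  moreover have "of_real (fst (?f w)) * w + of_real (snd (?f w)) * v w = 2 * of_real pi * \<i>" if "w \<in> ?W" for w
    using filling_coeffs_eq(1)[OF that] by (simp add: filling_eq_def)
  ultimately have D: "((\<lambda>w. 2 * of_real pi * \<i>) has_derivative
      (\<lambda>h. (?p * h + of_real (fst (f' h)) * u) + (?q * (v' * h) + of_real (snd (f' h)) * v u))) (at u)"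
    by (rule has_derivative_transform_within_open[OF _ W u])
  then have "(?p * h + of_real (fst (f' h)) * u) + (?q * (v' * h) + of_real (snd (f' h)) * v u) = 0" for h
    using fun_cong[OF has_derivative_unique[OF has_derivative_const D], of h] by simp
  then have "h * (?p + ?q * v') + (of_real (fst (f' h)) * u + of_real (snd (f' h)) * v u) = 0" for h
    by (simp add: algebra_simps)
  then have f0: "of_real (fst (f' h)) * u + of_real (snd (f' h)) * v u = 0" for h
    unfolding pq0 by simp
  have "f' h = 0" for h
  proof -
    have "filling_eq u (v u) (?f u + f' h)"
      using filling_coeffs_eq(1)[OF u] f0[of h] by (simp add: filling_eq_def algebra_simps)
    then have "?f u + f' h = ?f u" by (rule filling_coeffs_eq(2)[OF u])
    then show ?thesis by simp
  qed
  then have "g' 0 = 1" using id[of 1] by simp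
  moreover have "g' 0 = 0" using g' has_derivative_linear linear_0 by blast
  ultimately show False by simp
qed

text \<open>A filling with \<open>p = 0\<close> has \<open>exp (v / 2) = - 1\<close>, that is \<open>(1 - z2)\<^sup>2 = z2\<close>, an equation with real roots.\<close>

lemma p_nonzero:
  assumes u: "u \<in> U - {0}" and pq: "filling_coeffs v u = (of_int p, of_int q)" and cop: "coprime p q"
  shows "p \<noteq> 0"
proof
  assume "p = 0"
  then have q: "q = 1 \<or> q = - 1" using cop by auto
  have "of_int q * v u = 2 * of_real pi * \<i>"
    using filling_coeffs_eq(1)[OF u] \<open>p = 0\<close> by (simp add: pq filling_eq_def)
  then have "v u = 2 * of_real pi * \<i> \<or> v u = - (2 * of_real pi * \<i>)"
    using q by (metis minus_minus mult_1 mult_minus1 of_int_1 of_int_minus)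
  then have "v u / 2 = of_real pi * \<i> \<or> v u / 2 = - (of_real pi * \<i>)" by auto
  then have "exp (v u / 2) = - 1" by (auto simp: exp_minus)
  then have "(1 - z2 u)\<^sup>2 = z2 u" using riley_z2(2,4)[of u] u by (auto simp: field_simps)
  then have "z2 u * z2 u = 3 * z2 u - 1" by (simp add: power2_eq_square algebra_simps)
  then have "Re (z2 u * z2 u) = 3 * Re (z2 u) - 1" "Im (z2 u * z2 u) = 3 * Im (z2 u)" by simp_all
  then have re: "Re (z2 u) * Re (z2 u) - Im (z2 u) * Im (z2 u) = 3 * Re (z2 u) - 1"
    and "2 * (Re (z2 u) * Im (z2 u)) = 3 * Im (z2 u)" by simp_all
  then have re2: "Re (z2 u) = 3 / 2" using riley_z2(2)[of u] u by simp
  then have "Re (z2 u) * Re (z2 u) = 9 / 4" by (simp only:)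
  with re2 have "Im (z2 u) * Im (z2 u) = - 5 / 4" using re by linarith
  then show False using mult_pos_pos[of "Im (z2 u)" "Im (z2 u)"] riley_z2(2)[of u] u by simp
qed

end

text \<open>For upper triangular matrices the upper left entry is a character; this computes the eigenvalue
  of the filling relator.\<close>

lemma (in fig8_knot) upper_pow_word:
  assumes "E w $ 2 $ 1 = 0"
  shows "E (pow_word w n) $ 2 $ 1 = 0" "E (pow_word w n) $ 1 $ 1 = (E w $ 1 $ 1) powi n"
proof -
  have *: "E (concat (replicate k v)) $ 2 $ 1 = 0 \<and> E (concat (replicate k v)) $ 1 $ 1 = (E v $ 1 $ 1) ^ k"
    if "E v $ 2 $ 1 = 0" for v k
    by (induction k) (use that in \<open>simp_all add: mat_def eval_word_append matrix_matrix_mult_def sum_2\<close>)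
  obtain a b c d where w: "E w = mat2 a b c d" using mat2_cases by blast
  have c: "c = 0" and "a * d - b * c = 1" using assms det_E[of w] by (simp_all add: w)
  then have ad: "a * d = 1" by simp
  then have "E (inv_word w) = mat2 d (- b) 0 a" by (simp add: E_inv w matrix_inv_mat2 c)
  moreover have "d = inverse a" using ad by (metis inverse_unique)
  ultimately have "E (inv_word w) $ 2 $ 1 = 0" "E (inv_word w) $ 1 $ 1 = inverse (E w $ 1 $ 1)"
    by (simp_all add: w)
  then show "E (pow_word w n) $ 2 $ 1 = 0" "E (pow_word w n) $ 1 $ 1 = (E w $ 1 $ 1) powi n"
    using *[OF assms, of "nat n"] *[of "inv_word w" "nat (- n)"] by (auto simp: pow_word_def power_int_def)
qed

context filling_space
begin

text \<open>The filling relator maps to \<open>\<plusminus> 1\<close>: it is upper triangular, its diagonal entries square to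
  \<open>exp (- (p u + q v)) = 1\<close>, and it commutes with \<open>x\<close>.\<close>

lemma filling_relator:
  assumes u: "u \<in> U - {0}" and k: "exp u \<noteq> 1" and pq: "filling_coeffs v u = (of_int p, of_int q)"
  shows "spinor_map (eval_word (rho_gen u (z2 u)) (pow_word word_x p @ pow_word word_l q)) = mat 1"
proof -
  have uU: "u \<in> U" using u by simp
  interpret fig8_knot u "z2 u" by (rule fig8_knot[OF uU k])
  let ?r = "pow_word word_x p @ pow_word word_l q"
  have ll: "E word_l $ 1 $ 1 * E word_l $ 1 $ 1 = exp (- v u)"
  proof -
    have "E word_l $ 1 $ 1 = - exp (- (v u / 2))"
      using riley_z2(4)[OF uU] zeta_neq by (simp add: E_longitude exp_minus)
    then show ?thesis by (simp flip: exp_add)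
  qed
  have x: "E word_x $ 2 $ 1 = 0" "E word_x $ 1 $ 1 = \<nu>" by (simp_all add: E_x)
  define c where "c = E ?r $ 1 $ 1"
  have r21: "E ?r $ 2 $ 1 = 0" and "c = (E word_x $ 1 $ 1) powi p * (E word_l $ 1 $ 1) powi q"
    using upper_pow_word[OF x(1), of p] upper_pow_word[OF E_longitude(1), of q]
    by (simp_all add: c_def eval_word_append matrix_matrix_mult_def sum_2)
  then have "c * c = (\<nu> * \<nu>) powi p * (E word_l $ 1 $ 1 * E word_l $ 1 $ 1) powi q"
    unfolding x(2) by (simp only: power_int_mult_distrib mult_ac)
  also have "\<nu> * \<nu> = exp (- u)" by (simp flip: exp_add)
  also have "exp (- u) powi p * (E word_l $ 1 $ 1 * E word_l $ 1 $ 1) powi q = exp (- (of_int p * u + of_int q * v u))"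
    unfolding ll exp_power_int by (simp flip: exp_add)
  also have "of_int p * u + of_int q * v u = 2 * of_real pi * \<i>"
    using filling_coeffs_eq(1)[OF u] by (simp add: pq filling_eq_def)
  finally have cc: "c * c = 1" by (simp add: exp_minus)
  obtain a b c' d where r: "E ?r = mat2 a b c' d" using mat2_cases by blast
  have c': "c' = 0" and a: "a = c" using r21 by (simp_all add: r c_def)
  have "c * d = 1" using det_E[of ?r] by (simp only: r) (simp add: c' a)
  then have d: "d = c" using cc by (metis mult_cancel_left mult_zero_left zero_neq_one)
  have comm: "E (pow_word w n) ** E word_x = E word_x ** E (pow_word w n)" if w: "E w ** E word_x = E word_x ** E w" for w n
  proof -
    have *: "E (concat (replicate k v)) ** E word_x = E word_x ** E (concat (replicate k v))"
      if "E v ** E word_x = E word_x ** E v" for v k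
    proof (induction k)
      case (Suc k)
      have "E v ** E (concat (replicate k v)) ** E word_x = E v ** E word_x ** E (concat (replicate k v))"
        using Suc.IH by (simp flip: matrix_mul_assoc)
      then show ?case using that by (simp add: eval_word_append matrix_mul_assoc)
    qed simp
    have "matrix_inv (E w) ** E word_x = matrix_inv (E w) ** (E word_x ** E w) ** matrix_inv (E w)"
      using SL2_inv[OF det_E, of w] by (simp flip: matrix_mul_assoc)
    also have "\<dots> = (matrix_inv (E w) ** E w) ** E word_x ** matrix_inv (E w)"
      by (simp only: w[symmetric] matrix_mul_assoc)
    finally have "E (inv_word w) ** E word_x = E word_x ** E (inv_word w)"
      using SL2_inv[OF det_E, of w] by (simp add: E_inv)
    then show ?thesis using *[OF w] * by (simp add: pow_word_def)
  qed
  have "E ?r ** E word_x = E word_x ** E ?r"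
    using comm[of word_x p] comm[OF E_longitude_commute, of q]
    by (metis eval_word_append matrix_mul_assoc)
  then have "c * - \<nu> + b * \<mu> = \<nu> * b + - \<nu> * c"
    unfolding r by (simp add: E_x c' a d)
  then have "b * (\<mu> - \<nu>) = 0" by (simp add: algebra_simps)
  then have "b = 0" using \<mu>_neq_\<nu> by simp
  then have "E ?r = mat c" by (simp add: r c' a d mat_eq_mat2)
  moreover have "(cmod c)\<^sup>2 = 1" using arg_cong[OF cc, of cmod] by (simp add: norm_mult power2_eq_square)
  ultimately show ?thesis by (simp add: spinor_map_scalar)
qed

lemma filling_nonstationary:
  assumes u: "u \<in> U - {0}" and pq: "filling_coeffs v u = (of_int p, of_int q)"
    and tangent: "(2 * z2 u + exp u - 1 - (exp u)\<^sup>2) * \<eta> +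
        ((1 - 2 * exp u) * z2 u + 2 * exp u) * (- 2 * \<alpha> * exp u) = 0"
    and stationary: "of_int p * \<alpha> + of_int q * (\<eta> * (1 + z2 u) / (z2 u * (1 - z2 u))) = 0"
  shows "\<alpha> = 0 \<and> \<eta> = 0"
proof -
  have uU: "u \<in> U" using u by simp
  let ?\<zeta> = "z2 u"
  let ?D = "2 * ?\<zeta> + exp u - 1 - (exp u)\<^sup>2"
  obtain z' where z': "?D * z' = - (((1 - 2 * exp u) * ?\<zeta> + 2 * exp u) * exp u)"
    and v': "(v has_field_derivative - 2 * (z' * (1 + ?\<zeta>) / (?\<zeta> * (1 - ?\<zeta>)))) (at u)"
    using has_field_derivative_z2_v[OF uU] by metis
  have "?D * (\<eta> + 2 * \<alpha> * z') = ?D * \<eta> + 2 * \<alpha> * (?D * z')" by (simp add: algebra_simps)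
  also have "\<dots> = 0" unfolding z' using tangent by (simp add: algebra_simps)
  finally have "\<eta> + 2 * \<alpha> * z' = 0" using riley_z2(3)[OF uU] by simp
  then have \<eta>: "\<eta> = - 2 * \<alpha> * z'" by (simp add: eq_neg_iff_add_eq_0)
  have "\<alpha> * (of_int p + of_int q * (- 2 * (z' * (1 + ?\<zeta>) / (?\<zeta> * (1 - ?\<zeta>))))) = 0"
    using stationary unfolding \<eta> by (simp add: algebra_simps)
  moreover have "of_int p + of_int q * (- 2 * (z' * (1 + ?\<zeta>) / (?\<zeta> * (1 - ?\<zeta>)))) \<noteq> 0"
    using filling_slope_nonzero[OF u v'] by (simp add: pq)
  ultimately have "\<alpha> = 0" by (metis mult_eq_0_iff)
  then show ?thesis by (simp add: \<eta>)
qed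

end

text \<open>A cocycle with values in \<open>sl(4,R)\<close> splits into its two components.\<close>

lemma (in fig8_rep) H1_sl4_trivial:
  assumes so: "\<And>f. f \<in> Z1 (presented_group R) (Ad (rho u \<zeta>)) so31 \<Longrightarrow>
      \<exists>m\<in>so31. \<forall>g\<in>carrier (presented_group R). f g = Ad (rho u \<zeta>) g m - m"
    and fv: "\<And>f. f \<in> Z1 (presented_group R) (Ad (rho u \<zeta>)) frak_v \<Longrightarrow>
      \<exists>m\<in>frak_v. \<forall>g\<in>carrier (presented_group R). f g = Ad (rho u \<zeta>) g m - m"
  shows "infinitesimally_projectively_rigid (presented_group R) (rho u \<zeta>)"
proof -
  let ?G = "presented_group R"
  interpret S: group_rep ?G "Ad (rho u \<zeta>)" sl4 by (rule group_rep[OF invariant_sl4])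
  interpret SO: group_rep ?G "Ad (rho u \<zeta>)" so31 by (rule group_rep[OF invariant_so31])
  interpret V: group_rep ?G "Ad (rho u \<zeta>)" frak_v by (rule group_rep[OF invariant_frak_v])
  note lt = linear_add[OF linear_lorentz_transpose] linear_diff[OF linear_lorentz_transpose]
  have lt_Ad: "lorentz_transpose (Ad (rho u \<zeta>) g X) = Ad (rho u \<zeta>) g (lorentz_transpose X)"
    if g: "g \<in> carrier ?G" for g X
  proof -
    obtain w where "g = word_class R w" using g by auto
    then show ?thesis by (simp add: Ad_word_class lorentz_transpose_spin_Ad det_E)
  qed
  show ?thesis
    unfolding infinitesimally_projectively_rigid_def
  proof (rule S.H1_trivialI)
    fix f assume f: "f \<in> Z1 ?G (Ad (rho u \<zeta>)) sl4"
    define f1 where "f1 = (\<lambda>g\<in>carrier ?G. (1 / 2) *\<^sub>R (f g + lorentz_transpose (f g)))"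
    define f2 where "f2 = (\<lambda>g\<in>carrier ?G. (1 / 2) *\<^sub>R (f g - lorentz_transpose (f g)))"
    have "f1 \<in> Z1 ?G (Ad (rho u \<zeta>)) frak_v"
      unfolding V.Z1_iff f1_def
    proof (intro conjI ballI)
      fix g h assume g: "g \<in> carrier ?G" and h: "h \<in> carrier ?G"
      then show "(\<lambda>g\<in>carrier ?G. (1 / 2) *\<^sub>R (f g + lorentz_transpose (f g))) (g \<otimes>\<^bsub>?G\<^esub> h) =
        (\<lambda>g\<in>carrier ?G. (1 / 2) *\<^sub>R (f g + lorentz_transpose (f g))) g +
        Ad (rho u \<zeta>) g ((\<lambda>g\<in>carrier ?G. (1 / 2) *\<^sub>R (f g + lorentz_transpose (f g))) h)"
        using S.m_closed[OF g h] by (simp add: S.Z1_mult[OF f g h] lt lt_Ad S.add S.scale scaleR_add_right del: presented_group_simps)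
    qed (use sl4_decompose(1) S.Z1_closed[OF f] in auto)
    then obtain m1 where m1: "m1 \<in> frak_v" "\<forall>g\<in>carrier ?G. f1 g = Ad (rho u \<zeta>) g m1 - m1"
      using fv by blast
    have "f2 \<in> Z1 ?G (Ad (rho u \<zeta>)) so31"
      unfolding SO.Z1_iff f2_def
    proof (intro conjI ballI)
      fix g h assume g: "g \<in> carrier ?G" and h: "h \<in> carrier ?G"
      then show "(\<lambda>g\<in>carrier ?G. (1 / 2) *\<^sub>R (f g - lorentz_transpose (f g))) (g \<otimes>\<^bsub>?G\<^esub> h) =
        (\<lambda>g\<in>carrier ?G. (1 / 2) *\<^sub>R (f g - lorentz_transpose (f g))) g +
        Ad (rho u \<zeta>) g ((\<lambda>g\<in>carrier ?G. (1 / 2) *\<^sub>R (f g - lorentz_transpose (f g))) h)"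
        using S.m_closed[OF g h] by (simp add: S.Z1_mult[OF f g h] lt lt_Ad S.diff S.scale scaleR_diff_right
            scaleR_add_right del: presented_group_simps)
    qed (use sl4_decompose(2) S.Z1_closed[OF f] in auto)
    then obtain m2 where m2: "m2 \<in> so31" "\<forall>g\<in>carrier ?G. f2 g = Ad (rho u \<zeta>) g m2 - m2"
      using so by blast
    have "f g = Ad (rho u \<zeta>) g (m1 + m2) - (m1 + m2)" if g: "g \<in> carrier ?G" for g
    proof -
      have "f g = f1 g + f2 g"
        using g by (simp add: f1_def f2_def scaleR_add_right scaleR_diff_right flip: scaleR_add_left del: presented_group_simps)
      then show ?thesis using m1(2) m2(2) g by (simp add: S.add del: presented_group_simps)
    qed
    moreover have "m1 + m2 \<in> sl4"
      using m1(1) m2(1) frak_v_subset_sl4 so31_subset_sl4 by (auto intro: subspace_add[OF subspace_sl4])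
    ultimately show "\<exists>m\<in>sl4. \<forall>g\<in>carrier ?G. f g = Ad (rho u \<zeta>) g m - m" by blast
  qed
qed

lemma (in group_rep) coboundary_if_H1_trivial:
  assumes "carrier (H1 G \<alpha> V) = {\<zero>\<^bsub>H1 G \<alpha> V\<^esub>}" and f: "f \<in> Z1 G \<alpha> V"
  shows "\<exists>m\<in>V. \<forall>g\<in>carrier G. f g = \<alpha> g m - m"
proof -
  have "H1_class G \<alpha> V (\<lambda>g\<in>carrier G. 0) = H1_class G \<alpha> V f"
    using assms unfolding carrier_H1 zero_H1 by blast
  then show ?thesis unfolding H1_class_eq_iff[OF Z1_zero f] by auto
qed

section \<open>Rigidity of Dehn fillings\<close>

theorem theorem4p3:
  fixes U :: "complex set" and z1 z2 v :: "complex \<Rightarrow> complex" and u :: complex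
  assumes "dehn_filling_space U z1 z2 v" and "u \<in> U"
    and "dim {X \<in> frak_v. fox_dwdy u (z2 u) X = 0} = 1"
    and "dim (H0 cyc_x (Ad (rho u (z2 u))) frak_v) = 1"
  shows "has_dim (H1 pi1_M (Ad (rho u (z2 u))) frak_v) 1 \<and>
    linear_iso (res cyc_x (Ad (rho u (z2 u))) frak_v)
      (H1 pi1_M (Ad (rho u (z2 u))) frak_v)
      (H1 cyc_x (Ad (rho u (z2 u))) frak_v) \<and>
    (\<exists>(N :: complex set) (a :: complex \<Rightarrow> real^4^4) (z :: complex \<Rightarrow> gen word set \<Rightarrow> real^4^4)
        (t :: complex \<Rightarrow> real).
      open N \<and> u \<in> N \<and> N \<subseteq> U \<and> smooth_on N a \<and>
      (\<forall>u' \<in> N.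
        a u' \<noteq> 0 \<and> H0 pi1_T2 (Ad (rho u' (z2 u'))) frak_v = span {a u'} \<and>
        z u' \<in> Z1 pi1_M (Ad (rho u' (z2 u'))) frak_v \<and>
        z u' elem_x = a u' \<and> z u' elem_l = t u' *\<^sub>R a u') \<and>
      (t u \<noteq> 0 \<longrightarrow>
        (has_dim (H1 cyc_l (Ad (rho u (z2 u))) frak_v) 1 \<longrightarrow>
          linear_iso (res cyc_l (Ad (rho u (z2 u))) frak_v)
            (H1 pi1_M (Ad (rho u (z2 u))) frak_v)
            (H1 cyc_l (Ad (rho u (z2 u))) frak_v)) \<and>
        t u = inverse (slope u (z2 u)) \<and>
        (\<forall>p q :: int. coprime p q \<and> filling_coeffs v u = (of_int p, of_int q) \<and>
            slope u (z2 u) \<noteq> - (of_int q / of_int p) \<longrightarrow>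
          infinitesimally_projectively_rigid (pi1_filling p q) (rho u (z2 u)) \<and>
          carrier (H1 (pi1_filling p q) (Ad (rho u (z2 u))) frak_v)
            = {\<zero>\<^bsub>H1 (pi1_filling p q) (Ad (rho u (z2 u))) frak_v\<^esub>})))"
proof -
  interpret filling_space U z1 z2 v by unfold_locales (rule assms(1))
  have k: "exp u \<noteq> 1" using parabolic_dim_neq_1[OF riley_z2(1)[OF assms(2)]] assms(4) by blast
  then have u: "u \<in> U - {0}" using assms(2) by auto
  obtain N where N: "open N" "u \<in> N" "N \<subseteq> U" and reg: "\<And>w. w \<in> N \<Longrightarrow> fig8_regular w (z2 w)"
    by (rule exists_regular_neighbourhood[OF assms(2) k assms(3,4)]) (rule that)
  have fixv: "fig8_knot.fixv w = fixed_vector w" if "w \<in> N" for w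
    using reg[OF that] fixv_eq[of w] N(3) that unfolding fig8_regular_def fig8_knot_def by blast
  have "\<exists>zt. fst zt \<in> Z1 pi1_M (Ad (rho w (z2 w))) frak_v \<and> fst zt elem_x = fixed_vector w \<and>
      fst zt elem_l = snd zt *\<^sub>R fixed_vector w" if w: "w \<in> N" for w
  proof -
    interpret R: fig8_regular w "z2 w" by (rule reg[OF w])
    obtain z where z: "z \<in> Z1 pi1_M (Ad (rho w (z2 w))) frak_v" "z elem_x = R.fixv" by (rule R.exists_cocycle)
    obtain t where "z elem_l = t *\<^sub>R R.fixv" by (rule R.z_longitude[OF z])
    then show ?thesis using z fixv[OF w] by (intro exI[of _ "(z, t)"]) simp
  qed
  then obtain zt where zt: "\<And>w. w \<in> N \<Longrightarrow> fst (zt w) \<in> Z1 pi1_M (Ad (rho w (z2 w))) frak_v"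
    "\<And>w. w \<in> N \<Longrightarrow> fst (zt w) elem_x = fixed_vector w"
    "\<And>w. w \<in> N \<Longrightarrow> fst (zt w) elem_l = snd (zt w) *\<^sub>R fixed_vector w"
    by metis
  define z where "z w = fst (zt w)" for w
  define t where "t w = snd (zt w)" for w
  interpret R: fig8_regular u "z2 u" by (rule reg[OF N(2)])
  have z: "z u \<in> Z1 pi1_M (Ad (rho u (z2 u))) frak_v" "z u elem_x = R.fixv" "z u elem_l = t u *\<^sub>R R.fixv"
    using zt[OF N(2)] fixv[OF N(2)] by (simp_all add: z_def t_def)
  have family: "fixed_vector w \<noteq> 0 \<and> H0 pi1_T2 (Ad (rho w (z2 w))) frak_v = span {fixed_vector w} \<and>
      z w \<in> Z1 pi1_M (Ad (rho w (z2 w))) frak_v \<and> z w elem_x = fixed_vector w \<and>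
      z w elem_l = t w *\<^sub>R fixed_vector w" if w: "w \<in> N" for w
  proof -
    interpret W: fig8_regular w "z2 w" by (rule reg[OF w])
    show ?thesis
      using W.fixv_nonzero W.H0_T2 zt[OF w] by (simp add: fixv[OF w] z_def t_def)
  qed
  have rigid: "infinitesimally_projectively_rigid (pi1_filling p q) (rho u (z2 u)) \<and>
      carrier (H1 (pi1_filling p q) (Ad (rho u (z2 u))) frak_v)
        = {\<zero>\<^bsub>H1 (pi1_filling p q) (Ad (rho u (z2 u))) frak_v\<^esub>}"
    if t0: "t u \<noteq> 0" and cop: "coprime p q" and pq: "filling_coeffs v u = (of_int p, of_int q)"
      and slope: "slope u (z2 u) \<noteq> - (of_int q / of_int p)" for p q
  proof -
    have p: "p \<noteq> 0" by (rule p_nonzero[OF u pq cop])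
    have s: "slope u (z2 u) = inverse (t u)" by (rule R.slope_eq[OF z t0])
    have pqt: "of_int p + of_int q * t u \<noteq> 0"
    proof
      assume "of_int p + of_int q * t u = 0"
      then have "inverse (t u) = - (of_int q / of_int p)"
        using p t0 by (simp add: field_simps add_eq_0_iff)
      then show False using slope s by simp
    qed
    note rel = filling_relator[OF u k pq]
    have H1v: "carrier (H1 (pi1_filling p q) (Ad (rho u (z2 u))) frak_v)
        = {\<zero>\<^bsub>H1 (pi1_filling p q) (Ad (rho u (z2 u))) frak_v\<^esub>}"
      by (rule R.H1_filling_frak_v[OF z(1,2,3) pqt rel])
    interpret F: fig8_rep u "z2 u" "rel_M \<union> {pow_word word_x p @ pow_word word_l q}"
      by unfold_locales (use R.relators rel in auto)
    have G: "presented_group (rel_M \<union> {pow_word word_x p @ pow_word word_l q}) = pi1_filling p q"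
      by (simp add: pi1_filling_def)
    interpret FV: group_rep "pi1_filling p q" "Ad (rho u (z2 u))" frak_v
      using F.group_rep[OF F.invariant_frak_v] unfolding G .
    have "infinitesimally_projectively_rigid (pi1_filling p q) (rho u (z2 u))"
    proof (rule F.H1_sl4_trivial[unfolded G])
      show "\<exists>m\<in>so31. \<forall>g\<in>carrier (pi1_filling p q). f g = Ad (rho u (z2 u)) g m - m"
        if f: "f \<in> Z1 (pi1_filling p q) (Ad (rho u (z2 u))) so31" for f
        using R.H1_filling_so31[OF rel filling_nonstationary[OF u pq] f] by metis
      show "\<exists>m\<in>frak_v. \<forall>g\<in>carrier (pi1_filling p q). f g = Ad (rho u (z2 u)) g m - m"
        if "f \<in> Z1 (pi1_filling p q) (Ad (rho u (z2 u))) frak_v" for f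
        by (rule FV.coboundary_if_H1_trivial[OF H1v that])
    qed
    then show ?thesis using H1v by blast
  qed
  show ?thesis
  proof (intro conjI exI[of _ N] exI[of _ fixed_vector] exI[of _ z] exI[of _ t] ballI impI allI)
    show "has_dim (H1 pi1_M (Ad (rho u (z2 u))) frak_v) 1"
      by (rule R.M.has_dim_1_if_H1_generator[OF R.H1_generator_M[OF z(1,2)]])
    show "linear_iso (res cyc_x (Ad (rho u (z2 u))) frak_v)
      (H1 pi1_M (Ad (rho u (z2 u))) frak_v) (H1 cyc_x (Ad (rho u (z2 u))) frak_v)"
      by (rule R.linear_iso_res_x[OF z(1,2)])
    show "smooth_on N fixed_vector" by (rule smooth_on_fixed_vector)
    show "linear_iso (res cyc_l (Ad (rho u (z2 u))) frak_v)
        (H1 pi1_M (Ad (rho u (z2 u))) frak_v) (H1 cyc_l (Ad (rho u (z2 u))) frak_v)"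
      if "t u \<noteq> 0" "has_dim (H1 cyc_l (Ad (rho u (z2 u))) frak_v) 1"
      by (rule R.linear_iso_res_l[OF z(1,2,3) that])
    show "t u = inverse (slope u (z2 u))" if "t u \<noteq> 0"
      using R.slope_eq[OF z that] by simp
  qed (use N family rigid in auto)
qed

end
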